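(* Let $\mathcal{H}$ be a finite-dimensional Hilbert space. Suppose the following. 1. For any $T>0$, the operators $\mathscr{A}:[0,T]\times\mathcal{H}\to\mathcal{H}$ and $\mathscr{G}:[0,T]\times\mathcal{H}\to\mathscr{L}^2(\mathfrak{U};\mathcal{H})$ are measurable. 2. There exist a function $C_\cdot:[0,\infty)\to\mathbb{R}$ bounded on $[0,T]$ for every $T$, and constants $c_i$, such that for every $\phi,\psi\in\mathcal{H}$ and $t\in[0,\infty)$, $$\|\mathscr{A}(t,\phi)\|^2_{\mathcal{H}}\le C_t[1+\|\phi\|^2_{\mathcal{H}}],\qquad\|\mathscr{G}_i(t,\phi)\|^2_{\mathcal{H}}\le C_tc_i[1+\|\phi\|^2_{\mathcal{H}}],\qquad\sum_{i=1}^\infty c_i<\infty,$$ $$\|\mathscr{A}(t,\phi)-\mathscr{A}(t,\psi)\|^2_{\mathcal{H}}+\sum_{i=1}^\infty\|\mathscr{G}_i(t,\phi)-\mathscr{G}_i(t,\psi)\|^2_{\mathcal{H}}\le C_t\|\phi-\psi\|^2_{\mathcal{H}}.$$ 3. $\Phi_0\in L^2(\Omega;\mathcal{H})$ is $\mathcal{F}_0$-measurable. Let $\Phi$ be a strong solution of the equation $$\Phi_t=\Phi_0+\int_0^t\mathscr{A}(s,\Phi_s)\,ds+\int_0^t\mathscr{G}(s,\Phi_s)\,d\mathcal{W}_s$$ and suppose that $\Psi$ is another strong solution of this equation (with the same initial condition $\Phi_0$). Then for every $T\ge0$, $$\mathbb{P}\big(\{\omega\in\Omega:\Phi_t(\omega)=\Psi_t(\omega)\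 \ \forall t\in[0,T]\}\big)=1.$$
   Context: $(\Omega,\mathcal{F},(\mathcal{F}_t)_{t\ge0},\mathbb{P})$ is a fixed filtered probability space, complete with respect to $\mathcal{F}_0$. $\mathfrak{U}$ is a separable (infinite dimensional) Hilbert space with orthonormal basis $(e_i)$, $(W^i)$ are independent standard real Brownian motions with respect to $(\mathcal F_t)$, and $\mathcal{W}=\sum_ie_iW^i$ (formal sum) is a cylindrical Brownian motion over $\mathfrak{U}$. $\mathscr{L}^2(\mathfrak{U};\mathcal{H})$ denotes Hilbert-Schmidt operators, and $\mathscr{G}_i(t,\phi):=\mathscr{G}(t,\phi)e_i$. A strong solution is a process $\Phi$, progressively measurable in $\mathcal{H}$, such that for $\mathbb{P}$-a.e. $\omega$, $\Phi_\cdot(\omega)\in C([0,T];\mathcal{H})$ for all $T>0$, and such that the identity holds $\mathbb{P}$-a.s. in $\mathcal{H}$ for all $t\ge0$. For a progressively measurable $\mathscr{L}^2(\mathfrak{U};\mathcal{H})$-valued process $B$ with $\mathbb{E}\int_0^T\|B(s)\|^2ds<\infty$ for all $T$, $\int_0^tB(s)d\mathcal{W}_s:=\sum_i\int_0^tB(s)e_i\,dW^i_s$, limit in $L^2(\Omega;\mathcal{H})$. If only $\int_0^T\|B(s)\|^2ds<\infty$ $\mathbb{P}$-a.s. for all $T$, the integral is defined by localisation: with $\tau_n=n\wedge\inf\{t\ge 0:\int_0^t\|B(s)\|^2ds\ge n\}$, it equals at $\omega$ the integral of $B\mathbbm{1}_{\cdot\le\tau_n}$ for any $n$ with $t\le\tau_n(\omega)$.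 *)

theory Defs
  imports "HOL-Probability.Probability"
begin

section \<open>Filtered probability spaces and Brownian motions\<close>

text \<open>Processes and filtrations are indexed by \<^typ>\<open>real\<close>; only times \<open>t \<ge> 0\<close> are ever used.\<close>

locale filtered_prob_space = prob_space M + complete_measure M
  for M :: "'w measure" +
  fixes F :: "real \<Rightarrow> 'w measure"
  assumes filtration_subalgebra: "\<And>t. 0 \<le> t \<Longrightarrow> subalgebra M (F t)"
    and filtration_mono: "\<And>s t. 0 \<le> s \<Longrightarrow> s \<le> t \<Longrightarrow> subalgebra (F t) (F s)"
    and filtration_complete: "null_sets M \<subseteq> sets (F 0)"

definition prog_measurable ::
    "(real \<Rightarrow> 'w measure) \<Rightarrow> 'b measure \<Rightarrow> (real \<Rightarrow> 'w \<Rightarrow> 'b) \<Rightarrow> bool" where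
  "prog_measurable F N X \<longleftrightarrow>
     (\<forall>T\<ge>0. (\<lambda>(t, \<omega>). X t \<omega>) \<in> measurable (restrict_space borel {0..T} \<Otimes>\<^sub>M F T) N)"

definition standard_brownian_motion ::
    "'w measure \<Rightarrow> (real \<Rightarrow> 'w measure) \<Rightarrow> (real \<Rightarrow> 'w \<Rightarrow> real) \<Rightarrow> bool" where
  "standard_brownian_motion M F W \<longleftrightarrow>
     (\<forall>t\<ge>0. W t \<in> borel_measurable (F t)) \<and>
     (AE \<omega> in M. W 0 \<omega> = 0) \<and>
     (AE \<omega> in M. continuous_on {0..} (\<lambda>t. W t \<omega>)) \<and>
     (\<forall>s t. 0 \<le> s \<and> s < t \<longrightarrow>
        prob_space.indep_set M (sets (F s))
          {(\<lambda>\<omega>. W t \<omega> - W s \<omega>) -` A \<inter> space M | A. A \<in> sets borel} \<and>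
        distributed M lborel (\<lambda>\<omega>. W t \<omega> - W s \<omega>) (normal_density 0 (sqrt (t - s))))"

definition orthonormal_basis :: "(nat \<Rightarrow> 'u::real_inner) \<Rightarrow> bool" where
  "orthonormal_basis e \<longleftrightarrow>
     (\<forall>i j. inner (e i) (e j) = (if i = j then 1 else 0)) \<and> closure (span (range e)) = UNIV"

text \<open>The formal sum \<open>\<Sum>\<^sub>i e\<^sub>i W\<^sup>i\<close> is represented by the pair of sequences \<open>e\<close>, \<open>W\<close>. Each \<open>W i\<close> is
  a Brownian motion relative to the filtration \<open>F\<close>, and the \<open>W i\<close> are independent as processes,
  that is, as random elements of \<open>\<real>\<^bsup>[0,\<infinity>)\<^esup>\<close> with the product sigma-algebra.\<close>

locale cylindrical_brownian_motion = filtered_prob_space M F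
  for M :: "'w measure" and F +
  fixes e :: "nat \<Rightarrow> 'u::{real_inner, banach}"
    and W :: "nat \<Rightarrow> real \<Rightarrow> 'w \<Rightarrow> real"
  assumes basis: "orthonormal_basis e"
    and brownian: "\<And>i. standard_brownian_motion M F (W i)"
    and independent:
      "indep_vars (\<lambda>_. PiM {0..} (\<lambda>_. borel)) (\<lambda>i \<omega>. \<lambda>t\<in>{0..}. W i t \<omega>) UNIV"


section \<open>Hilbert-Schmidt operators\<close>

definition hs_ops ::
    "(nat \<Rightarrow> 'u::{real_inner, banach}) \<Rightarrow> ('u \<Rightarrow>\<^sub>L 'h::{real_inner, banach}) set" where
  "hs_ops e = {B. summable (\<lambda>i. (norm (blinfun_apply B (e i)))\<^sup>2)}"

definition hs_norm ::
    "(nat \<Rightarrow> 'u::{real_inner, banach}) \<Rightarrow> ('u \<Rightarrow>\<^sub>L 'h::{real_inner, banach}) \<Rightarrow> real" where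
  "hs_norm e B = sqrt (\<Sum>i. (norm (blinfun_apply B (e i)))\<^sup>2)"

text \<open>The Borel sigma-algebra of the Hilbert-Schmidt norm, not of the operator norm of
  \<^typ>\<open>'u::{real_inner, banach} \<Rightarrow>\<^sub>L 'h::{real_inner, banach}\<close>.\<close>

definition hs_borel ::
    "(nat \<Rightarrow> 'u::{real_inner, banach}) \<Rightarrow> ('u \<Rightarrow>\<^sub>L 'h::{real_inner, banach}) measure" where
  "hs_borel e = sigma (hs_ops e)
     {U. U \<subseteq> hs_ops e \<and> (\<forall>B\<in>U. \<exists>r>0. \<forall>C\<in>hs_ops e. hs_norm e (C - B) < r \<longrightarrow> C \<in> U)}"


section \<open>The stochastic integral\<close>

text \<open>\<open>\<Sum>\<^sub>k \<xi>\<^sub>k 1\<^bsub>(p\<^sub>k, p\<^sub>k\<^sub>+\<^sub>1]\<^esub>\<close> with bounded, \<open>F\<^bsub>p\<^sub>k\<^esub>\<close>-measurable \<open>\<xi>\<^sub>k\<close>, where \<open>k < n\<close>.\<close>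

definition simple_data ::
    "'w measure \<Rightarrow> (real \<Rightarrow> 'w measure) \<Rightarrow> nat \<Rightarrow> (nat \<Rightarrow> real) \<Rightarrow>
     (nat \<Rightarrow> 'w \<Rightarrow> 'h::{real_inner, banach, second_countable_topology}) \<Rightarrow> bool" where
  "simple_data M F n p \<xi> \<longleftrightarrow>
     0 \<le> p 0 \<and> (\<forall>k<n. p k < p (Suc k)) \<and>
     (\<forall>k<n. \<xi> k \<in> borel_measurable (F (p k)) \<and> bounded (\<xi> k ` space M))"

definition simple_process ::
    "nat \<Rightarrow> (nat \<Rightarrow> real) \<Rightarrow> (nat \<Rightarrow> 'w \<Rightarrow> 'h::real_inner) \<Rightarrow> real \<Rightarrow> 'w \<Rightarrow> 'h" where
  "simple_process n p \<xi> s \<omega> = (\<Sum>k<n. indicat_real {p k<..p (Suc k)} s *\<^sub>R \<xi> k \<omega>)"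

definition simple_integral ::
    "(real \<Rightarrow> 'w \<Rightarrow> real) \<Rightarrow> nat \<Rightarrow> (nat \<Rightarrow> real) \<Rightarrow> (nat \<Rightarrow> 'w \<Rightarrow> 'h::real_inner) \<Rightarrow>
     real \<Rightarrow> 'w \<Rightarrow> 'h" where
  "simple_integral W n p \<xi> t \<omega> =
     (\<Sum>k<n. (W (min t (p (Suc k))) \<omega> - W (min t (p k)) \<omega>) *\<^sub>R \<xi> k \<omega>)"

text \<open>Stochastic integrals at a fixed time are only determined up to null sets, so they are given by
  predicates \<open>has_\<dots>\<close>, stating that the random variable \<open>I\<close> is a version of the integral over \<open>[0, t]\<close>.

  For a real Brownian motion: \<open>I\<close> is the limit in \<open>L\<^sup>2(\<Omega>)\<close> of the integrals of simple processes that
  converge to \<open>f\<close> in \<open>L\<^sup>2(\<Omega> \<times> [0, t])\<close>.\<close>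

definition has_ito_integral ::
    "'w measure \<Rightarrow> (real \<Rightarrow> 'w measure) \<Rightarrow> (real \<Rightarrow> 'w \<Rightarrow> real) \<Rightarrow>
     (real \<Rightarrow> 'w \<Rightarrow> 'h::{real_inner, banach, second_countable_topology}) \<Rightarrow> real \<Rightarrow> ('w \<Rightarrow> 'h) \<Rightarrow> bool"
  where
  "has_ito_integral M F W f t I \<longleftrightarrow>
     prog_measurable F borel f \<and>
     (\<forall>T\<ge>0. (\<integral>\<^sup>+\<omega>. (\<integral>\<^sup>+s\<in>{0..T}. ennreal ((norm (f s \<omega>))\<^sup>2) \<partial>lborel) \<partial>M) < \<infinity>) \<and>
     I \<in> borel_measurable M \<and>
     (\<exists>n p \<xi>. (\<forall>m. simple_data M F (n m) (p m) (\<xi> m)) \<and>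
        (\<lambda>m. \<integral>\<^sup>+\<omega>. (\<integral>\<^sup>+s\<in>{0..t}.
            ennreal ((norm (f s \<omega> - simple_process (n m) (p m) (\<xi> m) s \<omega>))\<^sup>2) \<partial>lborel) \<partial>M)
          \<longlonglongrightarrow> 0 \<and>
        (\<lambda>m. \<integral>\<^sup>+\<omega>.
            ennreal ((norm (I \<omega> - simple_integral W (n m) (p m) (\<xi> m) t \<omega>))\<^sup>2) \<partial>M)
          \<longlonglongrightarrow> 0)"

definition has_cylindrical_integral_L2 ::
    "'w measure \<Rightarrow> (real \<Rightarrow> 'w measure) \<Rightarrow> (nat \<Rightarrow> 'u::{real_inner, banach}) \<Rightarrow>
     (nat \<Rightarrow> real \<Rightarrow> 'w \<Rightarrow> real) \<Rightarrow>
     (real \<Rightarrow> 'w \<Rightarrow> 'u \<Rightarrow>\<^sub>L 'h::{real_inner, banach, second_countable_topology}) \<Rightarrow>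
     real \<Rightarrow> ('w \<Rightarrow> 'h) \<Rightarrow> bool"
  where
  "has_cylindrical_integral_L2 M F e W B t I \<longleftrightarrow>
     prog_measurable F (hs_borel e) B \<and>
     (\<forall>T\<ge>0. (\<integral>\<^sup>+\<omega>. (\<integral>\<^sup>+s\<in>{0..T}. ennreal ((hs_norm e (B s \<omega>))\<^sup>2) \<partial>lborel) \<partial>M) < \<infinity>) \<and>
     I \<in> borel_measurable M \<and>
     (\<exists>J. (\<forall>i. has_ito_integral M F (W i) (\<lambda>s \<omega>. blinfun_apply (B s \<omega>) (e i)) t (J i)) \<and>
        (\<lambda>n. \<integral>\<^sup>+\<omega>. ennreal ((norm (I \<omega> - (\<Sum>i<n. J i \<omega>)))\<^sup>2) \<partial>M) \<longlonglongrightarrow> 0)"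

text \<open>\<open>n \<and> inf {t \<ge> 0. \<integral>\<^sub>0\<^sup>t \<parallel>B\<parallel>\<^sup>2 \<ge> n}\<close>; inserting \<open>n\<close> into the set realises both the minimum with \<open>n\<close>
  and the convention that the infimum of the empty set is infinite.\<close>

definition localising_time ::
    "(nat \<Rightarrow> 'u::{real_inner, banach}) \<Rightarrow>
     (real \<Rightarrow> 'w \<Rightarrow> 'u \<Rightarrow>\<^sub>L 'h::{real_inner, banach}) \<Rightarrow> nat \<Rightarrow> 'w \<Rightarrow> real" where
  "localising_time e B n \<omega> = Inf (insert (real n)
     {t. 0 \<le> t \<and> (\<integral>\<^sup>+s\<in>{0..t}. ennreal ((hs_norm e (B s \<omega>))\<^sup>2) \<partial>lborel) \<ge> of_nat n})"

definition has_cylindrical_integral ::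
    "'w measure \<Rightarrow> (real \<Rightarrow> 'w measure) \<Rightarrow> (nat \<Rightarrow> 'u::{real_inner, banach}) \<Rightarrow>
     (nat \<Rightarrow> real \<Rightarrow> 'w \<Rightarrow> real) \<Rightarrow>
     (real \<Rightarrow> 'w \<Rightarrow> 'u \<Rightarrow>\<^sub>L 'h::{real_inner, banach, second_countable_topology}) \<Rightarrow>
     real \<Rightarrow> ('w \<Rightarrow> 'h) \<Rightarrow> bool"
  where
  "has_cylindrical_integral M F e W B t I \<longleftrightarrow>
     prog_measurable F (hs_borel e) B \<and>
     (AE \<omega> in M. \<forall>T\<ge>0. (\<integral>\<^sup>+s\<in>{0..T}. ennreal ((hs_norm e (B s \<omega>))\<^sup>2) \<partial>lborel) < \<infinity>) \<and>
     I \<in> borel_measurable M \<and>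
     (\<forall>n. \<exists>J.
        has_cylindrical_integral_L2 M F e W
          (\<lambda>s \<omega>. indicat_real {..localising_time e B n \<omega>} s *\<^sub>R B s \<omega>) t J \<and>
        (AE \<omega> in M. t \<le> localising_time e B n \<omega> \<longrightarrow> I \<omega> = J \<omega>))"


section \<open>Strong solutions\<close>

text \<open>The identity is required almost surely for each \<open>t \<ge> 0\<close>; the exceptional null set may depend
  on \<open>t\<close>, which is the natural reading for integrals that are defined for each \<open>t\<close> as limits in
  \<open>L\<^sup>2(\<Omega>)\<close>.\<close>

definition strong_solution ::
    "'w measure \<Rightarrow> (real \<Rightarrow> 'w measure) \<Rightarrow> (nat \<Rightarrow> 'u::{real_inner, banach}) \<Rightarrow>
     (nat \<Rightarrow> real \<Rightarrow> 'w \<Rightarrow> real) \<Rightarrow>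
     (real \<Rightarrow> 'h \<Rightarrow> 'h) \<Rightarrow>
     (real \<Rightarrow> 'h \<Rightarrow> 'u \<Rightarrow>\<^sub>L 'h::{real_inner, banach, second_countable_topology}) \<Rightarrow>
     ('w \<Rightarrow> 'h) \<Rightarrow> (real \<Rightarrow> 'w \<Rightarrow> 'h) \<Rightarrow> bool"
  where
  "strong_solution M F e W A G \<Phi>\<^sub>0 \<Phi> \<longleftrightarrow>
     prog_measurable F borel \<Phi> \<and>
     (AE \<omega> in M. \<forall>T>0. continuous_on {0..T} (\<lambda>t. \<Phi> t \<omega>)) \<and>
     (\<forall>t\<ge>0. \<exists>I. has_cylindrical_integral M F e W (\<lambda>s \<omega>. G s (\<Phi> s \<omega>)) t I \<and>
        (AE \<omega> in M. set_integrable lborel {0..t} (\<lambda>s. A s (\<Phi> s \<omega>)) \<and>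
           \<Phi> t \<omega> = \<Phi>\<^sub>0 \<omega> + (LINT s:{0..t}|lborel. A s (\<Phi> s \<omega>)) + I \<omega>))"

end

theory Submission
  imports Defs
begin

text \<open>Let \<open>Z\<^sub>t = \<integral>\<^sub>0\<^sup>t \<parallel>G(s, \<Phi>\<^sub>s)\<parallel>\<^sup>2 + \<parallel>G(s, \<Psi>\<^sub>s)\<parallel>\<^sup>2 + \<parallel>\<Phi>\<^sub>s - \<Psi>\<^sub>s\<parallel>\<^sup>2 ds\<close> and \<open>E\<^sub>t = {Z\<^sub>t \<le> n}\<close>, a decreasing
  adapted family of events. Let \<open>f(t)\<close> be the expectation of \<open>\<parallel>\<Phi>\<^sub>t - \<Psi>\<^sub>t\<parallel>\<^sup>2\<close> over \<open>E\<^sub>t\<close>. The Lipschitz bound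
  and the isometry give \<open>f(t) \<le> K \<integral>\<^sub>0\<^sup>t f(s) ds\<close>, and the integral of \<open>f\<close> over \<open>[0, T]\<close> is at most \<open>n\<close>,
  so \<open>f = 0\<close> by Gronwall's lemma. Letting \<open>n \<rightarrow> \<infinity>\<close> gives \<open>\<Phi>\<^sub>t = \<Psi>\<^sub>t\<close> almost surely for each \<open>t\<close>, and
  continuity makes the null set independent of \<open>t\<close>. The integrals are never stopped: a stochastic
  integral is estimated on \<open>E\<^sub>t\<close> by multiplying the integrand by the indicators of the larger events
  \<open>E\<^sub>s\<close>, \<open>s \<le> t\<close>, so no continuous version of it is needed.\<close>

section \<open>Increments of Brownian motion\<close>

text \<open>A strong solution comes with no moment bound, so neither the isometry nor Gronwall's
  lemma applies to it directly; each summand of Z closes one such gap. The two operator norms keep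
  E_t inside the event that t precedes both localising times of a sufficiently high level, where the
  integrals agree with integrals defined in L^2(\<Omega>). The squared distance makes the integral
  of f finite, as Gronwall's lemma requires. Constants may be lost freely, because with zero initial
  value any K will do; the isometry is therefore only used as an upper bound, extended by triangle
  inequalities. The difficulty lies in the indicator of E_s, which varies with s, whereas a
  coefficient of a simple process must be known at the left end point of its interval. The events
  are therefore first delayed by \<delta>, and the left continuity of E in s lets \<delta> tend to
  0.\<close>

context filtered_prob_space
begin

lemma space_F: "0 \<le> t \<Longrightarrow> space (F t) = space M"
  using filtration_subalgebra[of t] by (simp add: subalgebra_def)

lemma measurable_F_M: "0 \<le> t \<Longrightarrow> f \<in> measurable (F t) N \<Longrightarrow> f \<in> measurable M N"
  using filtration_subalgebra measurable_from_subalg by blast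

lemma measurable_F_mono: "0 \<le> s \<Longrightarrow> s \<le> t \<Longrightarrow> f \<in> measurable (F s) N \<Longrightarrow> f \<in> measurable (F t) N"
  using filtration_mono measurable_from_subalg by blast

lemma brownian_increment_measurable:
  assumes "standard_brownian_motion M F B" "0 \<le> s" "s \<le> t"
  shows "(\<lambda>\<omega>. B t \<omega> - B s \<omega>) \<in> borel_measurable (F t)"
  using assms measurable_F_mono[of s t "B s" borel]
  by (auto simp: standard_brownian_motion_def intro!: borel_measurable_diff)

lemma brownian_increment_moments:
  assumes B: "standard_brownian_motion M F B" "0 \<le> s" "s < t"
  shows "integrable M (\<lambda>\<omega>. B t \<omega> - B s \<omega>)"
    and "integrable M (\<lambda>\<omega>. (B t \<omega> - B s \<omega>)\<^sup>2)"
    and "expectation (\<lambda>\<omega>. B t \<omega> - B s \<omega>) = 0"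
    and "expectation (\<lambda>\<omega>. (B t \<omega> - B s \<omega>)\<^sup>2) = t - s"
proof -
  have d: "distributed M lborel (\<lambda>\<omega>. B t \<omega> - B s \<omega>) (normal_density 0 (sqrt (t - s)))"
    using B by (auto simp: standard_brownian_motion_def)
  have pos: "0 < sqrt (t - s)" using B by simp
  have *: "integrable M (\<lambda>\<omega>. (B t \<omega> - B s \<omega>) ^ k)" for k
    using distributed_integrable[OF d, of "\<lambda>x. x ^ k"] integrable_normal_moment[OF pos, of 0 k]
    by simp
  show "integrable M (\<lambda>\<omega>. B t \<omega> - B s \<omega>)" "integrable M (\<lambda>\<omega>. (B t \<omega> - B s \<omega>)\<^sup>2)"
    using *[of 1] *[of 2] by simp_all
  show E: "expectation (\<lambda>\<omega>. B t \<omega> - B s \<omega>) = 0"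
    using normal_distributed_expectation[OF pos d] .
  show "expectation (\<lambda>\<omega>. (B t \<omega> - B s \<omega>)\<^sup>2) = t - s"
    using normal_distributed_variance[OF pos d] B(3) by (simp add: E)
qed

text \<open>The definition of a Brownian motion relates \<open>F s\<close> to the preimages under
  the increment as families of sets. Both families of preimages are closed under intersection, so
  independence extends to the generated sigma-algebras, as \<open>indep_var\<close> demands.\<close>

lemma brownian_increment_indep:
  fixes U :: "'w \<Rightarrow> real"
  assumes B: "standard_brownian_motion M F B" "0 \<le> s" "s < t"
    and U: "U \<in> borel_measurable (F s)"
  shows "indep_var borel U borel (\<lambda>\<omega>. B t \<omega> - B s \<omega>)"
proof -
  let ?D = "\<lambda>\<omega>. B t \<omega> - B s \<omega>"
  let ?A = "{U -` A \<inter> space M |A. A \<in> sets borel}" and ?B = "{?D -` A \<inter> space M |A. A \<in> sets borel}"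
  have "indep_set (sets (F s)) ?B"
    using B by (auto simp: standard_brownian_motion_def)
  moreover have "?A \<subseteq> sets (F s)"
    using U measurable_sets[OF U] space_F[OF B(2)] by auto
  ultimately have "indep_set ?A ?B"
    unfolding indep_set_def by (elim indep_sets_mono_sets) (simp split: bool.split)
  moreover have Int: "Int_stable {f -` A \<inter> space M |A. A \<in> sets borel}" for f :: "'w \<Rightarrow> real"
  proof (rule Int_stableI)
    fix a b assume "a \<in> {f -` A \<inter> space M |A. A \<in> sets borel}" "b \<in> {f -` A \<inter> space M |A. A \<in> sets borel}"
    then obtain X Y where "a = f -` X \<inter> space M" "b = f -` Y \<inter> space M" "X \<in> sets borel" "Y \<in> sets borel"
      by auto
    then show "a \<inter> b \<in> {f -` A \<inter> space M |A. A \<in> sets borel}"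
      by (intro CollectI exI[of _ "X \<inter> Y"]) auto
  qed
  ultimately have "indep_set (sigma_sets (space M) ?A) (sigma_sets (space M) ?B)"
    using indep_set_sigma_sets[OF _ Int Int] by blast
  moreover have "U \<in> borel_measurable M" "?D \<in> borel_measurable M"
    using U measurable_F_M[OF B(2)] brownian_increment_moments(1)[OF B] by auto
  ultimately show ?thesis by (simp add: indep_var_eq)
qed

text \<open>Independence factorises both expectations. The vanishing first one makes different time
  intervals orthogonal; the second is the Ito isometry on a single interval, with \<open>U\<close>
  in the role of the squared coefficient.\<close>

lemma brownian_increment_mult:
  fixes U :: "'w \<Rightarrow> real"
  assumes B: "standard_brownian_motion M F B" "0 \<le> s" "s < t"
    and U: "U \<in> borel_measurable (F s)" "integrable M U"
  shows "integrable M (\<lambda>\<omega>. U \<omega> * (B t \<omega> - B s \<omega>))"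
    and "expectation (\<lambda>\<omega>. U \<omega> * (B t \<omega> - B s \<omega>)) = 0"
    and "integrable M (\<lambda>\<omega>. U \<omega> * (B t \<omega> - B s \<omega>)\<^sup>2)"
    and "expectation (\<lambda>\<omega>. U \<omega> * (B t \<omega> - B s \<omega>)\<^sup>2) = (t - s) * expectation U"
proof -
  note i = brownian_increment_indep[OF B U(1)] and m = brownian_increment_moments[OF B]
  have i2: "indep_var borel U borel (\<lambda>\<omega>. (B t \<omega> - B s \<omega>)\<^sup>2)"
    using indep_var_compose[OF i, of "\<lambda>x. x" borel "\<lambda>x. x\<^sup>2" borel] by (simp add: comp_def)
  show "integrable M (\<lambda>\<omega>. U \<omega> * (B t \<omega> - B s \<omega>))"
    by (rule indep_var_integrable[OF i U(2) m(1)])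
  show "integrable M (\<lambda>\<omega>. U \<omega> * (B t \<omega> - B s \<omega>)\<^sup>2)"
    by (rule indep_var_integrable[OF i2 U(2) m(2)])
  show "expectation (\<lambda>\<omega>. U \<omega> * (B t \<omega> - B s \<omega>)) = 0"
    using indep_var_lebesgue_integral[OF i U(2) m(1)] by (simp add: m)
  show "expectation (\<lambda>\<omega>. U \<omega> * (B t \<omega> - B s \<omega>)\<^sup>2) = (t - s) * expectation U"
    using indep_var_lebesgue_integral[OF i2 U(2) m(2)] by (simp add: m)
qed

end

section \<open>Products of increments of two different Brownian motions\<close>

context cylindrical_brownian_motion
begin

text \<open>Functionals of whole paths are allowed because the cross-term estimate needs
  independence of products of two increments, which read each path at up to four times.\<close>

lemma brownian_paths_indep:
  fixes f g :: "(real \<Rightarrow> real) \<Rightarrow> real"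
  assumes "i \<noteq> l"
    and f: "f \<in> borel_measurable (PiM {0..} (\<lambda>_. borel))"
    and g: "g \<in> borel_measurable (PiM {0..} (\<lambda>_. borel))"
  shows "indep_var borel (\<lambda>\<omega>. f (\<lambda>t\<in>{0..}. W i t \<omega>)) borel (\<lambda>\<omega>. g (\<lambda>t\<in>{0..}. W l t \<omega>))"
proof -
  let ?P = "PiM {0..} (\<lambda>_. borel :: real measure)"
  have *: "(\<lambda>x. f (x i)) \<in> borel_measurable (PiM {i} (\<lambda>_. ?P))"
    "(\<lambda>x. g (x l)) \<in> borel_measurable (PiM {l} (\<lambda>_. ?P))"
    using measurable_compose[of "\<lambda>x. x i" "PiM {i} (\<lambda>_. ?P)" ?P f borel]
      measurable_compose[of "\<lambda>x. x l" "PiM {l} (\<lambda>_. ?P)" ?P g borel] f g by auto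
  show ?thesis
    using indep_var_compose[OF indep_var_restrict[OF independent, of "{i}" "{l}"] *] \<open>i \<noteq> l\<close>
    by (simp add: comp_def)
qed

text \<open>\<open>W i\<close> and \<open>W l\<close> are independent of the past separately, not jointly, so the product of
  their increments is not known to be independent of the past. Along a partition of \<open>[s, t]\<close>
  into \<open>N\<close> pieces the product of increments may be replaced by the sum of the products of the
  small increments, which has second moment \<open>(t - s)\<^sup>2 / N\<close>.\<close>

lemma brownian_increment_cross:
  fixes U :: "'w \<Rightarrow> real"
  assumes il: "i \<noteq> l" and st: "0 \<le> s" "s < t"
    and U: "U \<in> borel_measurable (F s)" "\<And>\<omega>. \<omega> \<in> space M \<Longrightarrow> \<bar>U \<omega>\<bar> \<le> K"
  shows "integrable M (\<lambda>\<omega>. U \<omega> * (W i t \<omega> - W i s \<omega>) * (W l t \<omega> - W l s \<omega>))"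
    and "expectation (\<lambda>\<omega>. U \<omega> * (W i t \<omega> - W i s \<omega>) * (W l t \<omega> - W l s \<omega>)) = 0"
proof -
  have UM: "U \<in> borel_measurable M" using U(1) st measurable_F_M by auto
  have iU: "integrable M U"
    using integrable_const_bound[of U K] UM U(2) by auto
  have int_bdd: "integrable M (\<lambda>\<omega>. U \<omega> * Y \<omega>)" if "integrable M Y" for Y :: "'w \<Rightarrow> real"
  proof (rule Bochner_Integration.integrable_bound[of M "\<lambda>\<omega>. K * Y \<omega>"])
    show "AE \<omega> in M. norm (U \<omega> * Y \<omega>) \<le> norm (K * Y \<omega>)"
      using U(2) by (intro AE_I2) (auto simp: abs_mult intro!: mult_right_mono intro: order_trans[OF _ abs_ge_self])
  qed (use that UM in auto)
  have ind: "indep_var borel (\<lambda>\<omega>. (W i b \<omega> - W i a \<omega>) * (W i d \<omega> - W i c \<omega>))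
      borel (\<lambda>\<omega>. (W l b \<omega> - W l a \<omega>) * (W l d \<omega> - W l c \<omega>))"
    if "0 \<le> a" "0 \<le> b" "0 \<le> c" "0 \<le> d" for a b c d
    using brownian_paths_indep[OF il, of "\<lambda>p. (p b - p a) * (p d - p c)" "\<lambda>p. (p b - p a) * (p d - p c)"]
    that by simp
  have ind1: "indep_var borel (\<lambda>\<omega>. W i b \<omega> - W i a \<omega>) borel (\<lambda>\<omega>. W l d \<omega> - W l c \<omega>)"
    if "0 \<le> a" "0 \<le> b" "0 \<le> c" "0 \<le> d" for a b c d
    using brownian_paths_indep[OF il, of "\<lambda>p. p b - p a" "\<lambda>p. p d - p c"] that by simp
  have int1: "integrable M (\<lambda>\<omega>. (W i b \<omega> - W i a \<omega>) * (W l d \<omega> - W l c \<omega>))"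
    if "0 \<le> a" "a < b" "0 \<le> c" "c < d" for a b c d
    using that by (intro indep_var_integrable ind1 brownian_increment_moments(1)[OF brownian]) auto
  show "integrable M (\<lambda>\<omega>. U \<omega> * (W i t \<omega> - W i s \<omega>) * (W l t \<omega> - W l s \<omega>))"
    using int_bdd[OF int1[OF st st]] by (simp add: mult.assoc)
  let ?E = "expectation (\<lambda>\<omega>. U \<omega> * (W i t \<omega> - W i s \<omega>) * (W l t \<omega> - W l s \<omega>))"
  have K: "0 \<le> K"
    using U(2) not_empty by (meson abs_ge_zero order_trans ex_in_conv)
  have bound: "?E\<^sup>2 \<le> K\<^sup>2 * (t - s)\<^sup>2 / real N" if N: "N > 0" for N :: nat
  proof -
    define h where "h = (t - s) / N"
    have h: "h > 0" using N st by (simp add: h_def)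
    define q where "q k = s + real k * h" for k
    have q: "0 \<le> q k" "q k < q (Suc k)" "s \<le> q k" for k
      using st h by (auto simp: q_def algebra_simps)
    have qmono: "q j \<le> q k" if "j \<le> k" for j k
      using that h by (auto simp: q_def)
    have dq: "q (Suc k) - q k = h" for k by (simp add: q_def algebra_simps)
    have qN: "q 0 = s" "q N = t" using N by (auto simp: q_def h_def)
    define a where "a k \<omega> = W i (q (Suc k)) \<omega> - W i (q k) \<omega>" for k \<omega>
    define b where "b k \<omega> = W l (q (Suc k)) \<omega> - W l (q k) \<omega>" for k \<omega>
    have a_meas: "a j \<in> borel_measurable (F (q k))" "b j \<in> borel_measurable (F (q k))" if "j < k" for j k
      unfolding a_def b_def using that q(1) q(2)[of j] qmono[of "Suc j" k]
      by (intro measurable_F_mono[OF _ _ brownian_increment_measurable[OF brownian]]; simp add: order_less_imp_le)+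
    have a_int: "integrable M (a k)" "integrable M (b k)" "integrable M (\<lambda>\<omega>. (a k \<omega>)\<^sup>2)"
      "integrable M (\<lambda>\<omega>. (b k \<omega>)\<^sup>2)" "expectation (\<lambda>\<omega>. (a k \<omega>)\<^sup>2) = h" "expectation (\<lambda>\<omega>. (b k \<omega>)\<^sup>2) = h" for k
      unfolding a_def b_def using brownian_increment_moments[OF brownian q(1) q(2)] by (auto simp: dq)
    have aa: "integrable M (\<lambda>\<omega>. a j \<omega> * a k \<omega>) \<and> integrable M (\<lambda>\<omega>. b j \<omega> * b k \<omega>) \<and>
        expectation (\<lambda>\<omega>. a j \<omega> * a k \<omega>) = (if j = k then h else 0) \<and>
        expectation (\<lambda>\<omega>. b j \<omega> * b k \<omega>) = (if j = k then h else 0)" for j k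
    proof (induction j k rule: linorder_wlog)
      case (le j k)
      show ?case
      proof (cases "j = k")
        case True
        then show ?thesis using a_int[of k] by (simp add: power2_eq_square)
      next
        case False
        then have "j < k" using le by simp
        then show ?thesis
          using brownian_increment_mult[OF brownian[of i] q(1) q(2) a_meas(1) a_int(1), of j k]
            brownian_increment_mult[OF brownian[of l] q(1) q(2) a_meas(2) a_int(2), of j k] False
          by (simp add: a_def[of k] b_def[of k])
      qed
    next
      case (sym j k)
      then show ?case by (simp add: mult.commute eq_commute)
    qed
    \<comment> \<open>Off the diagonal one of the two increments lies later. \<open>U\<close> and
      the other increment are known when it starts, so independence of a single Brownian motion from
      the past suffices.\<close>
    have ab: "integrable M (\<lambda>\<omega>. U \<omega> * a j \<omega> * b k \<omega>) \<and> (j \<noteq> k \<longrightarrow> expectation (\<lambda>\<omega>. U \<omega> * a j \<omega> * b k \<omega>) = 0)"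
      for j k
    proof (intro conjI impI)
      show "integrable M (\<lambda>\<omega>. U \<omega> * a j \<omega> * b k \<omega>)"
        using int_bdd[OF int1[OF q(1) q(2) q(1) q(2), of j k]] by (simp add: a_def b_def mult.assoc)
      assume "j \<noteq> k"
      have Uq: "U \<in> borel_measurable (F (q k))" for k
        using measurable_F_mono[OF st(1) q(3) U(1)] .
      consider "j < k" | "k < j" using \<open>j \<noteq> k\<close> by linarith
      then show "expectation (\<lambda>\<omega>. U \<omega> * a j \<omega> * b k \<omega>) = 0"
      proof cases
        case 1
        have "(\<lambda>\<omega>. U \<omega> * a j \<omega>) \<in> borel_measurable (F (q k))"
          using Uq a_meas(1)[OF 1] by simp
        from brownian_increment_mult(2)[OF brownian[of l] q(1) q(2) this int_bdd[OF a_int(1)]]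
        show ?thesis by (simp add: b_def)
      next
        case 2
        have "(\<lambda>\<omega>. U \<omega> * b k \<omega>) \<in> borel_measurable (F (q j))"
          using Uq a_meas(2)[OF 2] by simp
        from brownian_increment_mult(2)[OF brownian[of i] q(1) q(2) this int_bdd[OF a_int(2)]]
        show ?thesis by (simp add: a_def mult.assoc mult.left_commute mult.commute)
      qed
    qed
    define Y where "Y \<omega> = (\<Sum>k<N. a k \<omega> * b k \<omega>)" for \<omega>
    have tel: "(\<Sum>k<N. a k \<omega>) = W i t \<omega> - W i s \<omega>" "(\<Sum>k<N. b k \<omega>) = W l t \<omega> - W l s \<omega>" for \<omega>
      unfolding a_def b_def using sum_lessThan_telescope[of "\<lambda>k. W i (q k) \<omega>" N]
        sum_lessThan_telescope[of "\<lambda>k. W l (q k) \<omega>" N] by (simp_all add: qN)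
    have "?E = expectation (\<lambda>\<omega>. \<Sum>j<N. \<Sum>k<N. U \<omega> * a j \<omega> * b k \<omega>)"
      unfolding tel[symmetric] by (simp add: sum_distrib_left sum_distrib_right) (simp add: ac_simps, subst sum.swap, simp)
    also have "\<dots> = (\<Sum>j<N. \<Sum>k<N. expectation (\<lambda>\<omega>. U \<omega> * a j \<omega> * b k \<omega>))"
      using ab by (simp add: Bochner_Integration.integral_sum)
    also have "\<dots> = (\<Sum>j<N. \<Sum>k<N. if j = k then expectation (\<lambda>\<omega>. U \<omega> * a k \<omega> * b k \<omega>) else 0)"
      using ab by (intro sum.cong) auto
    also have "\<dots> = expectation (\<lambda>\<omega>. U \<omega> * Y \<omega>)"
      using ab by (simp add: Y_def sum_distrib_left Bochner_Integration.integral_sum mult.assoc)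
    finally have E: "?E = expectation (\<lambda>\<omega>. U \<omega> * Y \<omega>)" .
    \<comment> \<open>The fourth moments are split between the two paths, each of which has
      orthogonal increments. The past plays no part in this, so \<open>Y\<close> is estimated
      without \<open>U\<close>, which re-enters only through its bound \<open>K\<close>.\<close>
    have ind': "indep_var borel (\<lambda>\<omega>. a j \<omega> * a k \<omega>) borel (\<lambda>\<omega>. b j \<omega> * b k \<omega>)" for j k
      unfolding a_def b_def using ind q(1) by blast
    have abab: "integrable M (\<lambda>\<omega>. (a j \<omega> * a k \<omega>) * (b j \<omega> * b k \<omega>)) \<and>
        expectation (\<lambda>\<omega>. (a j \<omega> * a k \<omega>) * (b j \<omega> * b k \<omega>)) = (if j = k then h\<^sup>2 else 0)" for j k
      using indep_var_integrable[OF ind'] indep_var_lebesgue_integral[OF ind'] aa[of j k]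
      by (simp add: power2_eq_square)
    have Y2: "(Y \<omega>)\<^sup>2 = (\<Sum>j<N. \<Sum>k<N. (a j \<omega> * a k \<omega>) * (b j \<omega> * b k \<omega>))" for \<omega>
      by (simp add: Y_def power2_eq_square sum_product ac_simps)
    have intY2: "integrable M (\<lambda>\<omega>. (Y \<omega>)\<^sup>2)" unfolding Y2 using abab by simp
    have EY2: "expectation (\<lambda>\<omega>. (Y \<omega>)\<^sup>2) = N * h\<^sup>2"
      unfolding Y2 using abab by (simp add: Bochner_Integration.integral_sum)
    have intY: "integrable M Y"
      unfolding Y_def using int1[OF q(1) q(2) q(1) q(2)] by (auto simp: a_def b_def)
    have "\<bar>?E\<bar> \<le> expectation (\<lambda>\<omega>. K * \<bar>Y \<omega>\<bar>)"
      unfolding E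
    proof (rule order_trans[OF integral_abs_bound])
      show "expectation (\<lambda>\<omega>. \<bar>U \<omega> * Y \<omega>\<bar>) \<le> expectation (\<lambda>\<omega>. K * \<bar>Y \<omega>\<bar>)"
        using int_bdd[OF intY] intY U(2)
        by (intro integral_mono integrable_abs integrable_mult_right) (simp_all add: abs_mult mult_right_mono)
    qed
    then have "\<bar>?E\<bar> \<le> K * expectation (\<lambda>\<omega>. \<bar>Y \<omega>\<bar>)" by simp
    then have "?E\<^sup>2 \<le> (K * expectation (\<lambda>\<omega>. \<bar>Y \<omega>\<bar>))\<^sup>2"
      by (subst power2_abs[symmetric]) (rule power_mono[OF _ abs_ge_zero])
    also have "\<dots> = K\<^sup>2 * (expectation (\<lambda>\<omega>. \<bar>Y \<omega>\<bar>))\<^sup>2" by (simp add: power_mult_distrib)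
    \<comment> \<open>Jensen's inequality, in the form that the variance of |Y| is
      nonnegative.\<close>
    also have "\<dots> \<le> K\<^sup>2 * expectation (\<lambda>\<omega>. (Y \<omega>)\<^sup>2)"
      using variance_positive[of "\<lambda>\<omega>. \<bar>Y \<omega>\<bar>"] variance_eq[of "\<lambda>\<omega>. \<bar>Y \<omega>\<bar>"] intY intY2
      by (intro mult_left_mono) auto
    also have "\<dots> = K\<^sup>2 * (t - s)\<^sup>2 / N"
      using N unfolding EY2 by (simp add: h_def power2_eq_square)
    finally show ?thesis .
  qed
  have "(\<lambda>N. K\<^sup>2 * (t - s)\<^sup>2 / real N) \<longlonglongrightarrow> 0"
    by (rule lim_const_over_n)
  moreover have "\<forall>\<^sub>F N in sequentially. ?E\<^sup>2 \<le> K\<^sup>2 * (t - s)\<^sup>2 / real N"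
    using eventually_gt_at_top[of 0] by eventually_elim (use bound in auto)
  ultimately have "?E\<^sup>2 \<le> 0"
    using tendsto_lowerbound[of "\<lambda>N. K\<^sup>2 * (t - s)\<^sup>2 / real N" 0 sequentially "?E\<^sup>2"] by simp
  then show "?E = 0" by simp
qed

end

section \<open>The isometry for sums of weighted increments\<close>

lemma partition_mono:
  fixes q :: "nat \<Rightarrow> real"
  assumes q: "\<And>k. k < N \<Longrightarrow> q k < q (Suc k)" and "j \<le> k" "k \<le> N"
  shows "q j \<le> q k"
  using assms(2,3)
proof (induction k rule: dec_induct)
  case (step n)
  then show ?case using q[of n] by simp
qed simp

lemma norm_sum_squared:
  fixes f :: "'a \<Rightarrow> 'b::real_inner"
  shows "(norm (\<Sum>i\<in>I. f i))\<^sup>2 = (\<Sum>i\<in>I. \<Sum>j\<in>I. f i \<bullet> f j)"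
  unfolding power2_norm_eq_inner inner_sum_left inner_sum_right by (subst sum.swap) simp

lemma norm_add_squared_le:
  fixes x y :: "'a::real_normed_vector"
  shows "(norm (x + y))\<^sup>2 \<le> 2 * (norm x)\<^sup>2 + 2 * (norm y)\<^sup>2"
proof -
  have "(norm (x + y))\<^sup>2 \<le> (norm x + norm y)\<^sup>2"
    by (intro power_mono norm_triangle_ineq norm_ge_zero)
  also have "\<dots> \<le> 2 * (norm x)\<^sup>2 + 2 * (norm y)\<^sup>2"
    using sum_squares_bound[of "norm x" "norm y"] by (simp add: power2_sum)
  finally show ?thesis .
qed

context cylindrical_brownian_motion
begin

text \<open>An index \<open>z\<close> pairs the number of the Brownian motion with that of the time
  interval, so that both kinds of orthogonality are handled over one index set.\<close>

definition increment :: "(nat \<Rightarrow> real) \<Rightarrow> nat \<times> nat \<Rightarrow> 'w \<Rightarrow> real" where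
  "increment q z \<omega> = W (fst z) (q (Suc (snd z))) \<omega> - W (fst z) (q (snd z)) \<omega>"

text \<open>For different intervals the earlier increment is absorbed into the coefficient, which is
  known when the later interval starts. On a common interval, different Brownian motions are covered
  by \<open>brownian_increment_cross\<close> and equal ones by the variance. Bounded coefficients
  make all products integrable.\<close>

lemma expectation_increment_product:
  fixes X :: "nat \<times> nat \<Rightarrow> 'w \<Rightarrow> 'h::{real_inner, second_countable_topology}"
  assumes q: "0 \<le> q 0" "\<And>k. k < N \<Longrightarrow> q k < q (Suc k)"
    and X: "\<And>z. z \<in> {..<m} \<times> {..<N} \<Longrightarrow> X z \<in> borel_measurable (F (q (snd z)))"
      "\<And>z. z \<in> {..<m} \<times> {..<N} \<Longrightarrow> bounded (X z ` space M)"
    and y: "y \<in> {..<m} \<times> {..<N}" and z: "z \<in> {..<m} \<times> {..<N}"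
  defines "Y \<equiv> \<lambda>z \<omega>. increment q z \<omega> *\<^sub>R X z \<omega>"
  shows "integrable M (\<lambda>\<omega>. Y y \<omega> \<bullet> Y z \<omega>) \<and>
    expectation (\<lambda>\<omega>. Y y \<omega> \<bullet> Y z \<omega>) =
      (if y = z then (q (Suc (snd z)) - q (snd z)) * expectation (\<lambda>\<omega>. (norm (X z \<omega>))\<^sup>2) else 0)"
proof -
  have qmono: "q j \<le> q k" if "j \<le> k" "k \<le> N" for j k
    using partition_mono[of N q, OF q(2)] that by blast
  have q0: "0 \<le> q k" if "k \<le> N" for k using qmono[of 0 k] q(1) that by simp
  define V where "V y z \<omega> = X y \<omega> \<bullet> X z \<omega>" for y z \<omega>
  have snd_less: "snd z < N" if "z \<in> {..<m} \<times> {..<N}" for z using that by auto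
  have V_bdd: "\<exists>K. \<forall>\<omega>\<in>space M. \<bar>V y z \<omega>\<bar> \<le> K" if yz: "y \<in> {..<m} \<times> {..<N}" "z \<in> {..<m} \<times> {..<N}" for y z
  proof -
    obtain a b where "\<forall>\<omega>\<in>space M. norm (X y \<omega>) \<le> a" "\<forall>\<omega>\<in>space M. norm (X z \<omega>) \<le> b"
      using X(2)[OF yz(1)] X(2)[OF yz(2)] unfolding bounded_iff by auto
    then have "\<forall>\<omega>\<in>space M. \<bar>V y z \<omega>\<bar> \<le> a * b"
      unfolding V_def by (intro ballI order_trans[OF Cauchy_Schwarz_ineq2] mult_mono') auto
    then show ?thesis by blast
  qed
  have V_meas: "V y z \<in> borel_measurable (F (q k))"
    if "y \<in> {..<m} \<times> {..<N}" "z \<in> {..<m} \<times> {..<N}" "snd y \<le> k" "snd z \<le> k" "k < N" for y z k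
    unfolding V_def using that
    by (intro borel_measurable_inner measurable_F_mono[OF _ _ X(1)] q0 qmono) auto
  have inc_meas: "increment q z \<in> borel_measurable (F (q k))" if "snd z < k" "k \<le> N" for z k
    unfolding increment_def using that q(2)[of "snd z"]
    by (intro measurable_F_mono[OF _ _ brownian_increment_measurable[OF brownian]] q0 qmono) auto
  have inc_int: "integrable M (increment q z)" if "snd z < N" for z
    unfolding increment_def using that
    by (intro brownian_increment_moments(1)[OF brownian] q0 q(2)) auto
  have inc_bdd: "integrable M (\<lambda>\<omega>. V y z \<omega> * increment q y \<omega>)"
    if yz: "y \<in> {..<m} \<times> {..<N}" "z \<in> {..<m} \<times> {..<N}" for y z
  proof -
    obtain K where K: "\<forall>\<omega>\<in>space M. \<bar>V y z \<omega>\<bar> \<le> K" using V_bdd[OF yz] by blast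
    show ?thesis
    proof (rule Bochner_Integration.integrable_bound[of M "\<lambda>\<omega>. K * increment q y \<omega>"])
      show "AE \<omega> in M. norm (V y z \<omega> * increment q y \<omega>) \<le> norm (K * increment q y \<omega>)"
        using K by (intro AE_I2) (simp add: abs_mult mult_right_mono order_trans[OF _ abs_ge_self])
      show "integrable M (\<lambda>\<omega>. K * increment q y \<omega>)" using inc_int[of y] yz by auto
      have "V y z \<in> borel_measurable M"
        using snd_less[OF yz(1)] snd_less[OF yz(2)]
        by (intro measurable_F_M[OF q0 V_meas[OF yz, of "max (snd y) (snd z)"]]) auto
      then show "(\<lambda>\<omega>. V y z \<omega> * increment q y \<omega>) \<in> borel_measurable M"
        using inc_int[of y] yz by auto
    qed
  qed
  have Y: "Y y \<omega> \<bullet> Y z \<omega> = V y z \<omega> * increment q y \<omega> * increment q z \<omega>" for y z \<omega>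
    by (simp add: Y_def V_def)
  have less: "integrable M (\<lambda>\<omega>. Y y \<omega> \<bullet> Y z \<omega>) \<and> expectation (\<lambda>\<omega>. Y y \<omega> \<bullet> Y z \<omega>) = 0"
    if yz: "y \<in> {..<m} \<times> {..<N}" "z \<in> {..<m} \<times> {..<N}" "snd y < snd z" for y z
  proof -
    have "(\<lambda>\<omega>. V y z \<omega> * increment q y \<omega>) \<in> borel_measurable (F (q (snd z)))"
      using yz V_meas[of y z "snd z"] inc_meas[of y "snd z"] by auto
    from brownian_increment_mult(1,2)[OF brownian[of "fst z"] q0 q(2) this inc_bdd[OF yz(1,2)]]
    show ?thesis using yz by (auto simp: Y increment_def[of _ z])
  qed
  consider "snd y < snd z" | "snd z < snd y" | "snd y = snd z" by linarith
  then show ?thesis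
  proof cases
    case 1
    then show ?thesis using less[OF y z] by auto
  next
    case 2
    then show ?thesis using less[OF z y] by (auto simp: inner_commute)
  next
    case 3
    have V: "V y z \<in> borel_measurable (F (q (snd z)))"
      using V_meas[OF y z, of "snd z"] 3 z by auto
    obtain K where K: "\<And>\<omega>. \<omega>\<in>space M \<Longrightarrow> \<bar>V y z \<omega>\<bar> \<le> K" using V_bdd[OF y z] by blast
    have pos: "0 \<le> q (snd z)" "q (snd z) < q (Suc (snd z))" using z q0 q(2) by auto
    have VM: "V y z \<in> borel_measurable M" using V measurable_F_M pos by blast
    have Vi: "integrable M (V y z)"
      using integrable_const_bound[of "V y z" K] VM K by auto
    show ?thesis
    proof (cases "y = z")
      case True
      have "V z z = (\<lambda>\<omega>. (norm (X z \<omega>))\<^sup>2)" by (simp add: V_def fun_eq_iff power2_norm_eq_inner)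
      then show ?thesis
        using brownian_increment_mult(3,4)[OF brownian[of "fst z"] pos V Vi] True
        by (simp add: Y increment_def power2_eq_square mult.assoc)
    next
      case False
      then have "fst y \<noteq> fst z" using 3 by (simp add: prod_eq_iff)
      from brownian_increment_cross[OF this pos V K] show ?thesis
        using False 3 by (simp add: Y increment_def)
    qed
  qed
qed

text \<open>Pythagoras' theorem: expanding the square leaves only the diagonal terms. The
  nonnegative integral is used because the identity feeds estimates whose right-hand sides may be
  infinite.\<close>

lemma nn_integral_increments_sum:
  fixes X :: "nat \<times> nat \<Rightarrow> 'w \<Rightarrow> 'h::{real_inner, second_countable_topology}"
  assumes q: "0 \<le> q 0" "\<And>k. k < N \<Longrightarrow> q k < q (Suc k)"
    and X: "\<And>z. z \<in> {..<m} \<times> {..<N} \<Longrightarrow> X z \<in> borel_measurable (F (q (snd z)))"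
      "\<And>z. z \<in> {..<m} \<times> {..<N} \<Longrightarrow> bounded (X z ` space M)"
  shows "(\<integral>\<^sup>+\<omega>. ennreal ((norm (\<Sum>z\<in>{..<m} \<times> {..<N}. increment q z \<omega> *\<^sub>R X z \<omega>))\<^sup>2) \<partial>M) =
    (\<Sum>z\<in>{..<m} \<times> {..<N}. ennreal (q (Suc (snd z)) - q (snd z)) * (\<integral>\<^sup>+\<omega>. ennreal ((norm (X z \<omega>))\<^sup>2) \<partial>M))"
proof -
  let ?I = "{..<m} \<times> {..<N}"
  let ?Y = "\<lambda>z \<omega>. increment q z \<omega> *\<^sub>R X z \<omega>"
  note * = expectation_increment_product[OF q X]
  have qmono: "q j \<le> q k" if "j \<le> k" "k \<le> N" for j k
    using partition_mono[of N q, OF q(2)] that by blast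
  have q0: "0 \<le> q k" if "k \<le> N" for k using qmono[of 0 k] q(1) that by simp
  have Xi: "integrable M (\<lambda>\<omega>. (norm (X z \<omega>))\<^sup>2)" if z: "z \<in> ?I" for z
  proof -
    obtain K where "\<forall>\<omega>\<in>space M. norm (X z \<omega>) \<le> K"
      using X(2)[OF z] unfolding bounded_iff by auto
    moreover have "X z \<in> borel_measurable M"
      using z by (intro measurable_F_M[OF q0 X(1)[OF z]]) auto
    ultimately show ?thesis
      by (intro integrable_const_bound[of _ "K\<^sup>2"]) (auto intro!: power_mono)
  qed
  have "(\<integral>\<^sup>+\<omega>. ennreal ((norm (\<Sum>z\<in>?I. ?Y z \<omega>))\<^sup>2) \<partial>M) =
      ennreal (expectation (\<lambda>\<omega>. (norm (\<Sum>z\<in>?I. ?Y z \<omega>))\<^sup>2))"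
  proof (rule nn_integral_eq_integral)
    show "integrable M (\<lambda>\<omega>. (norm (\<Sum>z\<in>?I. ?Y z \<omega>))\<^sup>2)"
      unfolding norm_sum_squared by (intro Bochner_Integration.integrable_sum) (use * in blast)
  qed simp
  also have "expectation (\<lambda>\<omega>. (norm (\<Sum>z\<in>?I. ?Y z \<omega>))\<^sup>2) =
      (\<Sum>y\<in>?I. \<Sum>z\<in>?I. expectation (\<lambda>\<omega>. ?Y y \<omega> \<bullet> ?Y z \<omega>))"
    unfolding norm_sum_squared
    using * by (subst Bochner_Integration.integral_sum Bochner_Integration.integrable_sum;
        (intro Bochner_Integration.integrable_sum sum.cong refl Bochner_Integration.integral_sum)?; blast)+
  also have "\<dots> = (\<Sum>z\<in>?I. (q (Suc (snd z)) - q (snd z)) * expectation (\<lambda>\<omega>. (norm (X z \<omega>))\<^sup>2))"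
  proof (rule sum.cong[OF refl])
    fix y assume y: "y \<in> ?I"
    have "(\<Sum>z\<in>?I. expectation (\<lambda>\<omega>. ?Y y \<omega> \<bullet> ?Y z \<omega>)) =
        (\<Sum>z\<in>?I. if y = z then (q (Suc (snd z)) - q (snd z)) * expectation (\<lambda>\<omega>. (norm (X z \<omega>))\<^sup>2) else 0)"
      using * y by (intro sum.cong refl) blast
    also have "\<dots> = (q (Suc (snd y)) - q (snd y)) * expectation (\<lambda>\<omega>. (norm (X y \<omega>))\<^sup>2)"
      using y by (subst sum.delta') auto
    finally show "(\<Sum>z\<in>?I. expectation (\<lambda>\<omega>. ?Y y \<omega> \<bullet> ?Y z \<omega>)) = \<dots>" .
  qed
  also have "ennreal \<dots> = (\<Sum>z\<in>?I. ennreal (q (Suc (snd z)) - q (snd z)) * (\<integral>\<^sup>+\<omega>. ennreal ((norm (X z \<omega>))\<^sup>2) \<partial>M))"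
  proof (subst sum_ennreal[symmetric])
    show "0 \<le> (q (Suc (snd z)) - q (snd z)) * expectation (\<lambda>\<omega>. (norm (X z \<omega>))\<^sup>2)" if "z \<in> ?I" for z
      using q(2)[of "snd z"] that by (intro mult_nonneg_nonneg integral_nonneg_AE) auto
    show "(\<Sum>z\<in>?I. ennreal ((q (Suc (snd z)) - q (snd z)) * expectation (\<lambda>\<omega>. (norm (X z \<omega>))\<^sup>2))) =
      (\<Sum>z\<in>?I. ennreal (q (Suc (snd z)) - q (snd z)) * (\<integral>\<^sup>+\<omega>. ennreal ((norm (X z \<omega>))\<^sup>2) \<partial>M))"
    proof (intro sum.cong refl)
      fix z assume z: "z \<in> ?I"
      then show "ennreal ((q (Suc (snd z)) - q (snd z)) * expectation (\<lambda>\<omega>. (norm (X z \<omega>))\<^sup>2)) =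
          ennreal (q (Suc (snd z)) - q (snd z)) * (\<integral>\<^sup>+\<omega>. ennreal ((norm (X z \<omega>))\<^sup>2) \<partial>M)"
        using q(2)[of "snd z"] by (subst nn_integral_eq_integral[OF Xi]) (auto simp: ennreal_mult)
    qed
  qed
  finally show ?thesis .
qed

end

section \<open>Common refinements of simple processes\<close>

text \<open>The partition ends exactly at \<open>t\<close>, and points of \<open>P\<close> beyond
  \<open>t\<close> are ignored, since a simple integral up to \<open>t\<close> sees them only
  through \<open>min t\<close>. One \<open>q\<close> can thus serve several simple processes with
  unrelated partitions.\<close>

definition refines :: "(nat \<Rightarrow> real) \<Rightarrow> nat \<Rightarrow> real \<Rightarrow> real set \<Rightarrow> bool" where
  "refines q N t P \<longleftrightarrow> q 0 = 0 \<and> q N = t \<and> (\<forall>k<N. q k < q (Suc k)) \<and> P \<inter> {0..t} \<subseteq> q ` {..N}"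

lemma refines_mono: "refines q N t P \<Longrightarrow> Q \<subseteq> P \<Longrightarrow> refines q N t Q"
  by (auto simp: refines_def)

lemma refines_le:
  assumes "refines q N t P" "j \<le> k" "k \<le> N"
  shows "q j \<le> q k"
  by (rule partition_mono[of N]) (use assms in \<open>auto simp: refines_def\<close>)

lemma refines_less:
  assumes "refines q N t P" "j < k" "k \<le> N"
  shows "q j < q k"
proof -
  have "q j < q (Suc j)" using assms by (simp add: refines_def)
  also have "\<dots> \<le> q k" using refines_le[OF assms(1), of "Suc j" k] assms by simp
  finally show ?thesis .
qed

lemma refinement_exists:
  assumes "finite P" "0 < t" "0 < \<delta>"
  obtains q N where "refines q N t P" "\<And>k. k < N \<Longrightarrow> q (Suc k) - q k \<le> \<delta>"
proof -
  \<comment> \<open>The multiples of \<delta>, capped at \<open>t\<close>, control the mesh; the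
    ceiling ensures that they reach \<open>t\<close>.\<close>
  define P' where "P' = (P \<inter> {0..t}) \<union> {0, t} \<union> (\<lambda>k. min t (real k * \<delta>)) ` {..nat \<lceil>t / \<delta>\<rceil>}"
  have fin: "finite P'" using assms by (simp add: P'_def)
  have P': "P' \<subseteq> {0..t}" using assms by (auto simp: P'_def)
  define xs where "xs = sorted_list_of_set P'"
  have set: "set xs = P'" and srt: "sorted_wrt (<) xs"
    using fin by (simp_all add: xs_def)
  define N where "N = length xs - 1"
  have len: "length xs = Suc N"
    using set by (cases xs) (auto simp: N_def P'_def)
  define q where "q k = xs ! k" for k
  have less: "q j < q k" if "j < k" "k \<le> N" for j k
    using sorted_wrt_nth_less[OF srt that(1)] that(2) by (simp add: q_def len)
  have img: "q ` {..N} = P'"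
    using set len by (auto simp: q_def set_conv_nth less_Suc_eq_le image_iff)
  have in_P: "q k \<in> P'" if "k \<le> N" for k using that img by blast
  have q0: "q 0 = 0"
  proof -
    have "0 \<in> q ` {..N}" unfolding img by (simp add: P'_def)
    then obtain k where "k \<le> N" "q k = 0" by auto
    then show ?thesis using less[of 0 k] in_P[of 0] P' by (cases "k = 0") auto
  qed
  have qN: "q N = t"
  proof -
    have "t \<in> q ` {..N}" unfolding img by (simp add: P'_def)
    then obtain k where "k \<le> N" "q k = t" by auto
    then show ?thesis using less[of k N] in_P[of N] P' by (cases "k = N") auto
  qed
  have mesh: "q (Suc k) - q k \<le> \<delta>" if k: "k < N" for k
  proof (rule ccontr)
    assume "\<not> ?thesis"
    then have gap: "q k + \<delta> < q (Suc k)" by simp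
    \<comment> \<open>\<open>m * \<delta>\<close> is the first multiple of \<delta> strictly after
      \<open>q k\<close>. A gap longer than \<delta> would contain it, although it is itself a
      partition point.\<close>
    define m where "m = Suc (nat \<lfloor>q k / \<delta>\<rfloor>)"
    have qk: "0 \<le> q k" "q (Suc k) \<le> t" using in_P[of k] in_P[of "Suc k"] k P' by auto
    have "real (nat \<lfloor>q k / \<delta>\<rfloor>) = of_int \<lfloor>q k / \<delta>\<rfloor>"
      using qk assms by (intro of_nat_nat) simp
    then have "q k / \<delta> < m" "m \<le> q k / \<delta> + 1" unfolding m_def by linarith+
    then have m: "q k < m * \<delta>" "m * \<delta> \<le> q k + \<delta>"
      using assms(3) by (simp_all add: field_simps)
    have "m * \<delta> \<le> t" using m gap qk by linarith
    then have "real m \<le> t / \<delta>" using assms(3) by (simp add: field_simps)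
    then have "m \<le> nat \<lceil>t / \<delta>\<rceil>" by linarith
    moreover have "m * \<delta> = min t (real m * \<delta>)" using \<open>m * \<delta> \<le> t\<close> by simp
    ultimately have "m * \<delta> \<in> P'" unfolding P'_def by blast
    then obtain l where l: "l \<le> N" "m * \<delta> = q l" using img by blast
    have "k < l" using less[of l k] l m k by (cases l k rule: linorder_cases) auto
    moreover have "l < Suc k" using less[of "Suc k" l] l m gap k
      by (cases l "Suc k" rule: linorder_cases) auto
    ultimately show False by simp
  qed
  have "refines q N t P"
    unfolding refines_def img using q0 qN less by (auto simp: P'_def)
  then show ?thesis using mesh that by blast
qed

lemma (in filtered_prob_space) simple_data_nonneg:
  assumes "simple_data M F n p \<xi>" "j \<le> n"
  shows "0 \<le> p j"
  using partition_mono[of n p 0 j] assms by (auto simp: simple_data_def intro: order_trans)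

context filtered_prob_space
begin

context
  fixes n p \<xi> q N t
  assumes d: "simple_data M F n p \<xi>"
    and r: "refines q N t (p ` {..n})"
begin

text \<open>A point \<open>p j\<close> below \<open>q (Suc k)\<close> is itself a partition point,
  and none lies strictly between \<open>q k\<close> and \<open>q (Suc k)\<close>. This makes a
  simple process constant between partition points and its active coefficients known at
  \<open>q k\<close>.\<close>

lemma refined_less_iff:
  assumes j: "j \<le> n" and k: "k < N" and s: "q k < s" "s \<le> q (Suc k)"
  shows "p j < s \<longleftrightarrow> p j \<le> q k"
proof
  assume "p j < s"
  have "q (Suc k) \<le> t" using refines_le[OF r, of "Suc k" N] k r by (auto simp: refines_def)
  then have "p j \<in> p ` {..n} \<inter> {0..t}"
    using simple_data_nonneg[OF d j] j \<open>p j < s\<close> s by auto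
  then obtain m where m: "m \<le> N" "p j = q m" using r by (auto simp: refines_def)
  have "m \<le> k"
  proof (rule ccontr)
    assume "\<not> m \<le> k"
    then have "q (Suc k) \<le> q m" using refines_le[OF r, of "Suc k" m] m by auto
    then show False using m s \<open>p j < s\<close> by simp
  qed
  then show "p j \<le> q k" using refines_le[OF r, of m k] k m by auto
qed (use s in simp)

text \<open>The right end point represents the whole interval because the steps of a simple process
  are open on the left; at \<open>q k\<close> the preceding step may still be active.\<close>

lemma simple_process_refined:
  assumes "k < N" "q k < s" "s \<le> q (Suc k)"
  shows "simple_process n p \<xi> s \<omega> = simple_process n p \<xi> (q (Suc k)) \<omega>"
proof -
  have "q k < q (Suc k)" using assms by simp
  then have "s \<in> {p j<..p (Suc j)} \<longleftrightarrow> q (Suc k) \<in> {p j<..p (Suc j)}" if "j < n" for j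
    using refined_less_iff[of j k s] refined_less_iff[of j k "q (Suc k)"]
      refined_less_iff[of "Suc j" k s] refined_less_iff[of "Suc j" k "q (Suc k)"] that assms
    by (auto simp: not_less[symmetric])
  then show ?thesis unfolding simple_process_def
    by (intro sum.cong refl) (auto simp: indicator_def)
qed

text \<open>A coefficient \<open>\<xi> j\<close> that contributes on the interval has
  \<open>p j \<le> q k\<close>, so it is known at time \<open>q k\<close>; the other terms
  vanish.\<close>

lemma simple_process_refined_measurable:
  assumes "k < N"
  shows "(\<lambda>\<omega>. simple_process n p \<xi> (q (Suc k)) \<omega>) \<in> borel_measurable (F (q k))"
  unfolding simple_process_def
proof (rule borel_measurable_sum)
  fix j assume "j \<in> {..<n}"
  then have j: "j < n" by simp
  have "q k < q (Suc k)" using r assms by (auto simp: refines_def)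
  then show "(\<lambda>\<omega>. indicat_real {p j<..p (Suc j)} (q (Suc k)) *\<^sub>R \<xi> j \<omega>) \<in> borel_measurable (F (q k))"
    using refined_less_iff[of j k "q (Suc k)"] j assms simple_data_nonneg[OF d, of j] d
      measurable_F_mono[of "p j" "q k" "\<xi> j" borel]
    by (cases "p j < q (Suc k)") (auto simp: simple_data_def indicator_def)
qed

lemma simple_integral_refined:
  "simple_integral B n p \<xi> t \<omega> =
    (\<Sum>k<N. (B (q (Suc k)) \<omega> - B (q k) \<omega>) *\<^sub>R simple_process n p \<xi> (q (Suc k)) \<omega>)"
proof -
  have q0: "q 0 = 0" and qN: "q N = t"
    using r by (auto simp: refines_def)
  have t: "0 \<le> t" using refines_le[OF r, of 0 N] q0 qN by simp
  \<comment> \<open>Each \<open>min t (p j)\<close> is a partition point, so the path from time 0 up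
    to it telescopes over the intervals on its left. Subtracting two such sums isolates the
    intervals between consecutive \<open>p j\<close>.\<close>
  have tel: "B (min t (p j)) \<omega> - B 0 \<omega> = (\<Sum>k<N. (if q (Suc k) \<le> p j then B (q (Suc k)) \<omega> - B (q k) \<omega> else 0))"
    if j: "j \<le> n" for j
  proof -
    have "min t (p j) \<in> q ` {..N}"
    proof (cases "p j \<le> t")
      case True
      then have "p j \<in> p ` {..n} \<inter> {0..t}" using j simple_data_nonneg[OF d j] by auto
      then show ?thesis using r True unfolding refines_def by (auto simp: min_def)
    qed (use qN in auto)
    then obtain m where m: "m \<le> N" "min t (p j) = q m" by auto
    have "q (Suc k) \<le> p j \<longleftrightarrow> k < m" if "k < N" for k
    proof -
      have "q (Suc k) \<le> p j \<longleftrightarrow> q (Suc k) \<le> q m"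
        using refines_le[OF r, of "Suc k" N] qN that by (simp add: m(2)[symmetric])
      also have "\<dots> \<longleftrightarrow> k < m"
        using refines_le[OF r, of "Suc k" m] refines_less[OF r, of m "Suc k"] m that
        by (cases "k < m") auto
      finally show ?thesis .
    qed
    then have "(\<Sum>k<N. (if q (Suc k) \<le> p j then B (q (Suc k)) \<omega> - B (q k) \<omega> else 0)) =
        (\<Sum>k<N. if k < m then B (q (Suc k)) \<omega> - B (q k) \<omega> else 0)"
      by (intro sum.cong) auto
    also have "\<dots> = (\<Sum>k<m. B (q (Suc k)) \<omega> - B (q k) \<omega>)"
      using m(1) by (subst sum.inter_filter[symmetric]) (auto intro!: sum.cong)
    also have "\<dots> = B (q m) \<omega> - B 0 \<omega>"
      using sum_lessThan_telescope[of "\<lambda>k. B (q k) \<omega>" m] q0 by simp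
    finally show ?thesis by (simp add: m(2))
  qed
  have "B (min t (p (Suc j))) \<omega> - B (min t (p j)) \<omega> =
      (\<Sum>k<N. indicat_real {p j<..p (Suc j)} (q (Suc k)) * (B (q (Suc k)) \<omega> - B (q k) \<omega>))"
    if j: "j < n" for j
  proof -
    have "p j < p (Suc j)" using d j by (simp add: simple_data_def)
    have "B (min t (p (Suc j))) \<omega> - B (min t (p j)) \<omega> =
        (B (min t (p (Suc j))) \<omega> - B 0 \<omega>) - (B (min t (p j)) \<omega> - B 0 \<omega>)" by simp
    also have "\<dots> = (\<Sum>k<N. indicat_real {p j<..p (Suc j)} (q (Suc k)) * (B (q (Suc k)) \<omega> - B (q k) \<omega>))"
      unfolding tel[OF Suc_leI[OF j]] tel[OF less_imp_le[OF j]] sum_subtractf[symmetric]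
      using \<open>p j < p (Suc j)\<close> by (intro sum.cong refl) (auto simp: indicator_def)
    finally show ?thesis .
  qed
  then have "simple_integral B n p \<xi> t \<omega> = (\<Sum>j<n. \<Sum>k<N.
      (indicat_real {p j<..p (Suc j)} (q (Suc k)) * (B (q (Suc k)) \<omega> - B (q k) \<omega>)) *\<^sub>R \<xi> j \<omega>)"
    unfolding simple_integral_def by (intro sum.cong refl) (simp only: lessThan_iff scaleR_sum_left)
  also have "\<dots> = (\<Sum>k<N. \<Sum>j<n.
      (indicat_real {p j<..p (Suc j)} (q (Suc k)) * (B (q (Suc k)) \<omega> - B (q k) \<omega>)) *\<^sub>R \<xi> j \<omega>)"
    by (rule sum.swap)
  also have "\<dots> = (\<Sum>k<N. (B (q (Suc k)) \<omega> - B (q k) \<omega>) *\<^sub>R simple_process n p \<xi> (q (Suc k)) \<omega>)"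
    unfolding simple_process_def scaleR_sum_right scaleR_scaleR by (simp only: mult.commute)
  finally show ?thesis .
qed

end

lemma simple_process_bounded:
  assumes "simple_data M F n p \<xi>"
  shows "bounded ((\<lambda>\<omega>. simple_process n p \<xi> s \<omega>) ` space M)"
proof -
  have "\<exists>K. \<forall>\<omega>\<in>space M. norm (\<xi> j \<omega>) \<le> K" if "j < n" for j
    using assms that by (auto simp: simple_data_def bounded_iff)
  then obtain K where K: "\<And>j \<omega>. j < n \<Longrightarrow> \<omega> \<in> space M \<Longrightarrow> norm (\<xi> j \<omega>) \<le> K j" by metis
  have "norm (simple_process n p \<xi> s \<omega>) \<le> (\<Sum>j<n. K j)" if "\<omega> \<in> space M" for \<omega>
    unfolding simple_process_def
  proof (intro order_trans[OF norm_sum] sum_mono)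
    fix j assume "j \<in> {..<n}"
    then show "norm (indicat_real {p j<..p (Suc j)} s *\<^sub>R \<xi> j \<omega>) \<le> K j"
      using K[of j \<omega>] that by (auto simp: indicator_def intro: order_trans[OF norm_ge_zero])
  qed
  then show ?thesis by (auto simp: bounded_iff)
qed

end

section \<open>The stochastic integral on a decreasing adapted family of events\<close>

context cylindrical_brownian_motion
begin

text \<open>On \<open>E t\<close> the coefficients of the simple processes may be multiplied by the indicators
  of the larger events \<open>E (q\<^sub>k)\<close>, which are known at the left end points \<open>q\<^sub>k\<close>; the isometry then
  applies. This replaces stopping the integral.\<close>

lemma simple_integral_localised:
  fixes \<xi> \<eta> :: "nat \<Rightarrow> nat \<Rightarrow> 'w \<Rightarrow> 'h::{real_inner, banach, second_countable_topology}"
  assumes d: "\<And>i. i < m \<Longrightarrow> simple_data M F (n i) (p i) (\<xi> i)"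
    "\<And>i. i < m \<Longrightarrow> simple_data M F (n' i) (p' i) (\<eta> i)"
    and E: "\<And>s. 0 \<le> s \<Longrightarrow> E s \<in> sets (F s)" "\<And>s s'. 0 \<le> s \<Longrightarrow> s \<le> s' \<Longrightarrow> E s' \<subseteq> E s"
    and t: "0 < t" and \<delta>: "0 < \<delta>"
  defines "X \<equiv> \<lambda>i s \<omega>. simple_process (n i) (p i) (\<xi> i) s \<omega> - simple_process (n' i) (p' i) (\<eta> i) s \<omega>"
  shows "(\<integral>\<^sup>+\<omega>. indicator (E t) \<omega> * ennreal ((norm (\<Sum>i<m. simple_integral (W i) (n i) (p i) (\<xi> i) t \<omega>
        - simple_integral (W i) (n' i) (p' i) (\<eta> i) t \<omega>))\<^sup>2) \<partial>M)
    \<le> (\<integral>\<^sup>+\<omega>. (\<Sum>i<m. \<integral>\<^sup>+s\<in>{0..t}. (indicator (E (max 0 (s - \<delta>))) \<omega> * ennreal ((norm (X i s \<omega>))\<^sup>2)) \<partial>lborel) \<partial>M)"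
proof -
  have "finite (\<Union>i<m. p i ` {..n i} \<union> p' i ` {..n' i})" by simp
  from refinement_exists[OF this t \<delta>] obtain q N where
    r: "refines q N t (\<Union>i<m. p i ` {..n i} \<union> p' i ` {..n' i})"
    and mesh: "\<And>k. k < N \<Longrightarrow> q (Suc k) - q k \<le> \<delta>" by blast
  have q: "0 \<le> q 0" "\<And>k. k < N \<Longrightarrow> q k < q (Suc k)" "q N = t" using r by (auto simp: refines_def)
  have q_nonneg: "0 \<le> q k" if "k \<le> N" for k using refines_le[OF r, of 0 k] q(1) that by simp
  have q_le: "q k \<le> t" if "k \<le> N" for k using refines_le[OF r, of k N] q(3) that by simp
  have r1: "refines q N t (p i ` {..n i})" and r2: "refines q N t (p' i ` {..n' i})" if "i < m" for i
    using that by (auto intro: refines_mono[OF r])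
  \<comment> \<open>The event is taken at the left end point, for adaptedness, and the process at
    the right one, where its value on the interval is found.\<close>
  define Y where "Y z \<omega> = indicat_real (E (q (snd z))) \<omega> *\<^sub>R X (fst z) (q (Suc (snd z))) \<omega>" for z \<omega>
  have Y_meas: "Y z \<in> borel_measurable (F (q (snd z)))" if "z \<in> {..<m} \<times> {..<N}" for z
  proof -
    have z: "fst z < m" "snd z < N" using that by auto
    show ?thesis unfolding Y_def X_def
      by (intro borel_measurable_scaleR borel_measurable_indicator E(1) q_nonneg borel_measurable_diff
        simple_process_refined_measurable[OF d(1) r1] simple_process_refined_measurable[OF d(2) r2])
        (use z in auto)
  qed
  have Y_bdd: "bounded (Y z ` space M)" if "z \<in> {..<m} \<times> {..<N}" for z
  proof -
    have z: "fst z < m" using that by auto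
    obtain a b where ab: "\<And>\<omega>. \<omega>\<in>space M \<Longrightarrow> norm (simple_process (n (fst z)) (p (fst z)) (\<xi> (fst z)) (q (Suc (snd z))) \<omega>) \<le> a"
      "\<And>\<omega>. \<omega>\<in>space M \<Longrightarrow> norm (simple_process (n' (fst z)) (p' (fst z)) (\<eta> (fst z)) (q (Suc (snd z))) \<omega>) \<le> b"
      using simple_process_bounded[OF d(1)[OF z], of "q (Suc (snd z))"]
        simple_process_bounded[OF d(2)[OF z], of "q (Suc (snd z))"] unfolding bounded_iff by blast
    have "norm (Y z \<omega>) \<le> a + b" if "\<omega> \<in> space M" for \<omega>
    proof -
      have "norm (Y z \<omega>) \<le> norm (X (fst z) (q (Suc (snd z))) \<omega>)" by (simp add: Y_def indicator_def)
      also have "\<dots> \<le> a + b" unfolding X_def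
        using ab[OF that] by (intro order_trans[OF norm_triangle_ineq4] add_mono)
      finally show ?thesis .
    qed
    then show ?thesis by (auto simp: bounded_iff)
  qed
  have YM: "Y z \<in> borel_measurable M" if "z \<in> {..<m} \<times> {..<N}" for z
    using that by (intro measurable_F_M[OF q_nonneg Y_meas[OF that]]) auto
  have "indicator (E t) \<omega> * ennreal ((norm (\<Sum>i<m. simple_integral (W i) (n i) (p i) (\<xi> i) t \<omega>
        - simple_integral (W i) (n' i) (p' i) (\<eta> i) t \<omega>))\<^sup>2)
      \<le> ennreal ((norm (\<Sum>z\<in>{..<m} \<times> {..<N}. increment q z \<omega> *\<^sub>R Y z \<omega>))\<^sup>2)" for \<omega>
  proof (cases "\<omega> \<in> E t")
    case True
    have "(\<Sum>i<m. simple_integral (W i) (n i) (p i) (\<xi> i) t \<omega> - simple_integral (W i) (n' i) (p' i) (\<eta> i) t \<omega>)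
        = (\<Sum>i<m. \<Sum>k<N. (W i (q (Suc k)) \<omega> - W i (q k) \<omega>) *\<^sub>R X i (q (Suc k)) \<omega>)"
      unfolding X_def scaleR_diff_right sum_subtractf
      by (intro arg_cong2[where f="(-)"] sum.cong refl simple_integral_refined[OF d(1) r1] simple_integral_refined[OF d(2) r2]) auto
    also have "\<dots> = (\<Sum>i<m. \<Sum>k<N. increment q (i, k) \<omega> *\<^sub>R Y (i, k) \<omega>)"
    proof (intro sum.cong refl)
      fix i k assume "k \<in> {..<N}"
      then have "\<omega> \<in> E (q k)" using E(2)[of "q k" t] q_nonneg[of k] q_le[of k] True by auto
      then show "(W i (q (Suc k)) \<omega> - W i (q k) \<omega>) *\<^sub>R X i (q (Suc k)) \<omega> = increment q (i, k) \<omega> *\<^sub>R Y (i, k) \<omega>"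
        by (simp add: increment_def Y_def)
    qed
    also have "\<dots> = (\<Sum>z\<in>{..<m} \<times> {..<N}. increment q z \<omega> *\<^sub>R Y z \<omega>)"
      unfolding sum.cartesian_product by (simp add: case_prod_unfold)
    finally show ?thesis using True by simp
  qed simp
  then have "(\<integral>\<^sup>+\<omega>. indicator (E t) \<omega> * ennreal ((norm (\<Sum>i<m. simple_integral (W i) (n i) (p i) (\<xi> i) t \<omega>
        - simple_integral (W i) (n' i) (p' i) (\<eta> i) t \<omega>))\<^sup>2) \<partial>M)
      \<le> (\<integral>\<^sup>+\<omega>. ennreal ((norm (\<Sum>z\<in>{..<m} \<times> {..<N}. increment q z \<omega> *\<^sub>R Y z \<omega>))\<^sup>2) \<partial>M)"
    by (intro nn_integral_mono)
  also have "\<dots> = (\<Sum>z\<in>{..<m} \<times> {..<N}. ennreal (q (Suc (snd z)) - q (snd z)) * (\<integral>\<^sup>+\<omega>. ennreal ((norm (Y z \<omega>))\<^sup>2) \<partial>M))"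
    by (rule nn_integral_increments_sum[OF q(1,2) Y_meas Y_bdd])
  also have "\<dots> = (\<Sum>z\<in>{..<m} \<times> {..<N}. \<integral>\<^sup>+\<omega>. ennreal (q (Suc (snd z)) - q (snd z)) * ennreal ((norm (Y z \<omega>))\<^sup>2) \<partial>M)"
    using YM by (intro sum.cong refl nn_integral_cmult[symmetric]) simp
  also have "\<dots> = (\<integral>\<^sup>+\<omega>. (\<Sum>z\<in>{..<m} \<times> {..<N}. ennreal (q (Suc (snd z)) - q (snd z)) * ennreal ((norm (Y z \<omega>))\<^sup>2)) \<partial>M)"
    using YM by (intro nn_integral_sum[symmetric]) simp
  also have "\<dots> = (\<integral>\<^sup>+\<omega>. (\<Sum>i<m. \<Sum>k<N. ennreal (q (Suc k) - q k) * ennreal ((norm (Y (i, k) \<omega>))\<^sup>2)) \<partial>M)"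
    unfolding sum.cartesian_product by (simp add: case_prod_unfold)
  \<comment> \<open>The delay makes the bound independent of the partition, which changes with the
    approximating simple processes: for \<open>s\<close> between \<open>q k\<close> and
    \<open>q (Suc k)\<close> the mesh gives \<open>s - \<delta> \<le> q k\<close>, so
    \<open>E (q k)\<close> is contained in the delayed event.\<close>
  also have "\<dots> \<le> (\<integral>\<^sup>+\<omega>. (\<Sum>i<m. \<integral>\<^sup>+s\<in>{0..t}. (indicator (E (max 0 (s - \<delta>))) \<omega> * ennreal ((norm (X i s \<omega>))\<^sup>2)) \<partial>lborel) \<partial>M)"
  proof (intro nn_integral_mono sum_mono)
    fix \<omega> i assume i: "i \<in> {..<m}"
    let ?R = "\<lambda>s. indicator (E (max 0 (s - \<delta>))) \<omega> * ennreal ((norm (X i s \<omega>))\<^sup>2) * indicator {0..t} s"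
    have "(\<Sum>k<N. ennreal (q (Suc k) - q k) * ennreal ((norm (Y (i, k) \<omega>))\<^sup>2)) =
        (\<Sum>k<N. \<integral>\<^sup>+s. ennreal ((norm (Y (i, k) \<omega>))\<^sup>2) * indicator {q k<..q (Suc k)} s \<partial>lborel)"
      using q(2) by (intro sum.cong refl, subst nn_integral_cmult_indicator) (auto simp: mult.commute less_imp_le)
    also have "\<dots> = (\<integral>\<^sup>+s. (\<Sum>k<N. ennreal ((norm (Y (i, k) \<omega>))\<^sup>2) * indicator {q k<..q (Suc k)} s) \<partial>lborel)"
      by (intro nn_integral_sum[symmetric]) simp
    also have "\<dots> \<le> (\<integral>\<^sup>+s. ?R s \<partial>lborel)"
    proof (rule nn_integral_mono)
      fix s
      show "(\<Sum>k<N. ennreal ((norm (Y (i, k) \<omega>))\<^sup>2) * indicator {q k<..q (Suc k)} s) \<le> ?R s"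
      proof (cases "\<exists>k<N. s \<in> {q k<..q (Suc k)}")
        case True
        then obtain k where k: "k < N" "q k < s" "s \<le> q (Suc k)" by auto
        have "s \<notin> {q j<..q (Suc j)}" if "j < N" "j \<noteq> k" for j
          using that k refines_le[OF r, of "Suc j" k] refines_le[OF r, of "Suc k" j]
          by (cases j k rule: linorder_cases) auto
        then have "(\<Sum>k<N. ennreal ((norm (Y (i, k) \<omega>))\<^sup>2) * indicator {q k<..q (Suc k)} s) =
            (\<Sum>j<N. if j = k then ennreal ((norm (Y (i, k) \<omega>))\<^sup>2) else 0)"
          using k by (intro sum.cong refl) (auto simp: indicator_def)
        also have "\<dots> = ennreal ((norm (Y (i, k) \<omega>))\<^sup>2)" using k by simp
        also have "\<dots> \<le> ?R s"
        proof -
          have "X i s \<omega> = X i (q (Suc k)) \<omega>"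
            using i unfolding X_def
            by (simp add: simple_process_refined[OF d(1) r1 k] simple_process_refined[OF d(2) r2 k])
          moreover have "\<omega> \<in> E (max 0 (s - \<delta>))" if "\<omega> \<in> E (q k)"
            using E(2)[of "max 0 (s - \<delta>)" "q k"] mesh[of k] q_nonneg[of k] k that by auto
          moreover have "s \<in> {0..t}" using q_nonneg[of k] q_le[of "Suc k"] k by auto
          ultimately show ?thesis by (auto simp: Y_def indicator_def)
        qed
        finally show ?thesis .
      next
        case False
        then have "(\<Sum>k<N. ennreal ((norm (Y (i, k) \<omega>))\<^sup>2) * indicator {q k<..q (Suc k)} s) = 0"
          by (intro sum.neutral) (auto simp: indicator_def)
        then show ?thesis by simp
      qed
    qed
    finally show "(\<Sum>k<N. ennreal (q (Suc k) - q k) * ennreal ((norm (Y (i, k) \<omega>))\<^sup>2)) \<le> (\<integral>\<^sup>+s. ?R s \<partial>lborel)" .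
  qed
  finally show ?thesis .
qed

end

section \<open>Passage to the limit\<close>

abbreviation time_measure :: "real \<Rightarrow> real measure" where
  "time_measure t \<equiv> restrict_space lborel {0..t}"

lemma sigma_finite_time_measure: "sigma_finite_measure (time_measure t)"
  by (rule sigma_finite_measure_restrict_space) (auto intro: sigma_finite_lborel)

lemma norm_sum_squared_le:
  fixes f :: "'a \<Rightarrow> 'b::real_normed_vector"
  shows "(norm (\<Sum>i\<in>I. f i))\<^sup>2 \<le> real (card I) * (\<Sum>i\<in>I. (norm (f i))\<^sup>2)"
proof -
  have "(norm (\<Sum>i\<in>I. f i))\<^sup>2 \<le> (\<Sum>i\<in>I. norm (f i))\<^sup>2"
    by (intro power_mono norm_sum) simp
  also have "\<dots> \<le> (\<Sum>i\<in>I. (norm (f i))\<^sup>2) * real (card I)"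
    by (rule sum_squared_le_sum_of_squares)
  finally show ?thesis by (simp add: mult.commute)
qed

lemma norm_diff_squared_le:
  fixes x y :: "'a::real_normed_vector"
  shows "(norm (x - y))\<^sup>2 \<le> 2 * (norm x)\<^sup>2 + 2 * (norm y)\<^sup>2"
  using norm_add_squared_le[of x "- y"] by simp

section \<open>Integration over sample space and time jointly\<close>

context filtered_prob_space
begin

text \<open>The pair has \<omega> first, opposite to \<open>prog_measurable\<close>, to match the
  iterated integral in \<open>energy\<close>, whose inner variable is time.\<close>

definition jointly_measurable :: "real \<Rightarrow> (real \<Rightarrow> 'w \<Rightarrow> ennreal) \<Rightarrow> bool" where
  "jointly_measurable t h \<longleftrightarrow> (\<lambda>(\<omega>, s). h s \<omega>) \<in> borel_measurable (M \<Otimes>\<^sub>M time_measure t)"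

text \<open>Applied to a squared norm, this is the squared norm of L^2 over \<Omega> times [0, t],
  in which simple processes approximate an Ito integrand.\<close>

definition energy :: "real \<Rightarrow> (real \<Rightarrow> 'w \<Rightarrow> ennreal) \<Rightarrow> ennreal" where
  "energy t h = (\<integral>\<^sup>+\<omega>. (\<integral>\<^sup>+s\<in>{0..t}. h s \<omega> \<partial>lborel) \<partial>M)"

lemma energy_eq:
  assumes "jointly_measurable t h"
  shows "energy t h = (\<integral>\<^sup>+(\<omega>, s). h s \<omega> \<partial>(M \<Otimes>\<^sub>M time_measure t))"
  unfolding energy_def using assms unfolding jointly_measurable_def
  by (subst sigma_finite_measure.nn_integral_fst[OF sigma_finite_time_measure, symmetric])
    (simp_all add: nn_integral_restrict_space)

lemma energy_mono:
  assumes "\<And>s \<omega>. s \<in> {0..t} \<Longrightarrow> \<omega> \<in> space M \<Longrightarrow> g s \<omega> \<le> h s \<omega>"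
  shows "energy t g \<le> energy t h"
  unfolding energy_def using assms by (auto intro!: nn_integral_mono simp: indicator_def)

lemma energy_add:
  assumes "jointly_measurable t g" "jointly_measurable t h"
  shows "energy t (\<lambda>s \<omega>. g s \<omega> + h s \<omega>) = energy t g + energy t h"
proof -
  have "jointly_measurable t (\<lambda>s \<omega>. g s \<omega> + h s \<omega>)"
    using assms by (simp add: jointly_measurable_def case_prod_unfold)
  then show ?thesis
    using assms by (simp add: energy_eq case_prod_unfold nn_integral_add jointly_measurable_def)
qed

lemma energy_cmult:
  assumes "jointly_measurable t h"
  shows "energy t (\<lambda>s \<omega>. a * h s \<omega>) = a * energy t h"
proof -
  have "jointly_measurable t (\<lambda>s \<omega>. a * h s \<omega>)"
    using assms by (simp add: jointly_measurable_def case_prod_unfold)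
  then show ?thesis
    using assms by (simp add: energy_eq case_prod_unfold nn_integral_cmult jointly_measurable_def)
qed

lemma energy_sum:
  assumes "\<And>i. i \<in> I \<Longrightarrow> jointly_measurable t (h i)"
  shows "(\<integral>\<^sup>+\<omega>. (\<Sum>i\<in>I. \<integral>\<^sup>+s\<in>{0..t}. h i s \<omega> \<partial>lborel) \<partial>M) = (\<Sum>i\<in>I. energy t (h i))"
  unfolding energy_def
proof (rule nn_integral_sum)
  fix i assume "i \<in> I"
  from assms[OF this] show "(\<lambda>\<omega>. \<integral>\<^sup>+s\<in>{0..t}. h i s \<omega> \<partial>lborel) \<in> borel_measurable M"
    using sigma_finite_measure.borel_measurable_nn_integral_fst[OF sigma_finite_time_measure, of "\<lambda>(\<omega>, s). h i s \<omega>" M t]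
    by (simp add: jointly_measurable_def nn_integral_restrict_space)
qed

lemma energy_tendsto:
  assumes "\<And>j. jointly_measurable t (h j)" "jointly_measurable t h'" "jointly_measurable t w"
    and "\<And>j s \<omega>. s \<in> {0..t} \<Longrightarrow> \<omega> \<in> space M \<Longrightarrow> h j s \<omega> \<le> w s \<omega>"
    and "\<And>s \<omega>. s \<in> {0..t} \<Longrightarrow> \<omega> \<in> space M \<Longrightarrow> (\<lambda>j. h j s \<omega>) \<longlonglongrightarrow> h' s \<omega>"
    and "energy t w < \<infinity>"
  shows "(\<lambda>j. energy t (h j)) \<longlonglongrightarrow> energy t h'"
  using assms unfolding energy_eq[OF assms(1)] energy_eq[OF assms(2)] jointly_measurable_def
  by (intro nn_integral_dominated_convergence[where w="\<lambda>(\<omega>, s). w s \<omega>"])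
    (auto simp: space_pair_measure space_restrict_space energy_eq[OF assms(3)])

lemma prog_measurable_joint:
  assumes "prog_measurable F N X" "0 \<le> t"
  shows "(\<lambda>(\<omega>, s). X s \<omega>) \<in> measurable (M \<Otimes>\<^sub>M time_measure t) N"
proof -
  have id: "(\<lambda>\<omega>. \<omega>) \<in> measurable M (F t)"
    using measurable_F_M[OF assms(2), of "\<lambda>\<omega>. \<omega>" "F t"] by simp
  have "(\<lambda>(\<omega>, s). (s, \<omega>)) \<in> measurable (M \<Otimes>\<^sub>M time_measure t) (restrict_space borel {0..t} \<Otimes>\<^sub>M F t)"
    unfolding case_prod_unfold
  proof (rule measurable_Pair)
    have "sets (restrict_space borel {0..t}) = sets (time_measure t)" by (rule sets_restrict_space_cong) simp
    then show "snd \<in> measurable (M \<Otimes>\<^sub>M time_measure t) (restrict_space borel {0..t})"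
      using measurable_snd[of M "time_measure t"] by (metis measurable_cong_sets)
    show "fst \<in> measurable (M \<Otimes>\<^sub>M time_measure t) (F t)"
      by (rule measurable_compose[OF measurable_fst id])
  qed
  moreover have "(\<lambda>(s, \<omega>). X s \<omega>) \<in> measurable (restrict_space borel {0..t} \<Otimes>\<^sub>M F t) N"
    using assms by (simp add: prog_measurable_def)
  ultimately show ?thesis
    unfolding case_prod_unfold by - (drule (1) measurable_compose, simp)
qed

lemma simple_process_joint:
  assumes d: "simple_data M F n p \<xi>"
  shows "(\<lambda>(\<omega>, s). simple_process n p \<xi> s \<omega>) \<in> borel_measurable (M \<Otimes>\<^sub>M time_measure t)"
proof -
  have "\<xi> j \<in> borel_measurable M" if "j < n" for j
    using d that simple_data_nonneg[OF d, of j] by (intro measurable_F_M[of "p j"]) (auto simp: simple_data_def)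
  note [measurable] = measurable_compose[OF measurable_fst this]
  have [measurable]: "(\<lambda>z. indicat_real {p j<..p (Suc j)} (snd z)) \<in> borel_measurable (M \<Otimes>\<^sub>M time_measure t)" for j
    by (intro measurable_compose[OF measurable_snd] measurable_restrict_space1) simp
  show ?thesis unfolding simple_process_def case_prod_unfold
    by (intro borel_measurable_sum borel_measurable_scaleR) auto
qed

text \<open>Abstractly a stochastic interval [0, \<sigma>]: for fixed \<omega>, the times s \<ge> 0
  with \<omega> in \<open>E s\<close> form the empty set or a closed, possibly unbounded, interval
  starting at 0. Left continuity makes the delayed events shrink to the undelayed ones.\<close>

definition localising_family :: "(real \<Rightarrow> 'w set) \<Rightarrow> bool" where
  "localising_family E \<longleftrightarrow>
     (\<forall>s\<ge>0. E s \<in> sets (F s)) \<and> (\<forall>s\<ge>0. \<forall>s'\<ge>s. E s' \<subseteq> E s) \<and>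
     (\<forall>s>0. (\<Inter>r\<in>{0..<s}. E r) \<subseteq> E s) \<and>
     (\<forall>t>0. jointly_measurable t (\<lambda>s. indicator (E s)))"

lemma localising_family_delayed:
  assumes "localising_family E" "0 < t" "0 < \<delta>"
  shows "jointly_measurable t (\<lambda>s. indicator (E (max 0 (s - \<delta>))))"
proof -
  have "(\<lambda>(\<omega>, s). (\<omega>, max 0 (s - \<delta>))) \<in> measurable (M \<Otimes>\<^sub>M time_measure t) (M \<Otimes>\<^sub>M time_measure t)"
    unfolding case_prod_unfold
  proof (rule measurable_Pair)
    have "(\<lambda>s. max 0 (s - \<delta>)) \<in> measurable (time_measure t) (time_measure t)"
      using assms by (intro measurable_restrict_space3) auto
    from measurable_compose[OF measurable_snd this]
    show "(\<lambda>z. max 0 (snd z - \<delta>)) \<in> measurable (M \<Otimes>\<^sub>M time_measure t) (time_measure t)" .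
  qed simp
  moreover have "(\<lambda>(\<omega>, s). indicator (E s) \<omega> :: ennreal) \<in> borel_measurable (M \<Otimes>\<^sub>M time_measure t)"
    using assms by (simp add: localising_family_def jointly_measurable_def)
  ultimately show ?thesis
    unfolding jointly_measurable_def case_prod_unfold by - (drule (1) measurable_compose, simp)
qed

end

context cylindrical_brownian_motion
begin

lemma simple_integral_measurable:
  assumes d: "simple_data M F n p \<xi>" and t: "0 \<le> t"
  shows "simple_integral (W i) n p \<xi> t \<in> borel_measurable M"
proof -
  have "\<xi> j \<in> borel_measurable M" if "j < n" for j
    using d that simple_data_nonneg[OF d, of j] by (intro measurable_F_M[of "p j"]) (auto simp: simple_data_def)
  moreover have "W i s \<in> borel_measurable M" if "0 \<le> s" for s
    using brownian[of i] that measurable_F_M[of s "W i s"] by (auto simp: standard_brownian_motion_def)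
  ultimately show ?thesis
    unfolding simple_integral_def using t simple_data_nonneg[OF d]
    by (intro borel_measurable_sum borel_measurable_scaleR borel_measurable_diff) simp_all
qed

text \<open>The bound for simple processes passes to the limit. One factor 2 splits off the errors
  of the simple integrals, another those of the integrands; both kinds of error vanish without any
  localisation. Orthogonality of the Brownian motions keeps the constant 4 independent of
  \<open>m\<close>, as the later passage to infinitely many of them requires.\<close>

lemma ito_difference_bound_delayed:
  fixes f g :: "nat \<Rightarrow> real \<Rightarrow> 'w \<Rightarrow> 'h::{real_inner, banach, second_countable_topology}"
  assumes f: "\<And>i. i < m \<Longrightarrow> has_ito_integral M F (W i) (f i) t (I i)"
    and g: "\<And>i. i < m \<Longrightarrow> has_ito_integral M F (W i) (g i) t (J i)"
    and E: "localising_family E" and t: "0 < t" and \<delta>: "0 < \<delta>"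
  shows "(\<integral>\<^sup>+\<omega>. indicator (E t) \<omega> * ennreal ((norm (\<Sum>i<m. I i \<omega> - J i \<omega>))\<^sup>2) \<partial>M)
    \<le> 4 * (\<Sum>i<m. energy t (\<lambda>s \<omega>. indicator (E (max 0 (s - \<delta>))) \<omega> * ennreal ((norm (f i s \<omega> - g i s \<omega>))\<^sup>2)))"
    (is "?L \<le> 4 * (\<Sum>i<m. ?D i)")
proof -
  define Q where "Q i f I n p \<xi> \<longleftrightarrow> (\<forall>r. simple_data M F (n r) (p r) (\<xi> r)) \<and>
        (\<lambda>r. energy t (\<lambda>s \<omega>. ennreal ((norm (f s \<omega> - simple_process (n r) (p r) (\<xi> r) s \<omega>))\<^sup>2))) \<longlonglongrightarrow> 0 \<and>
        (\<lambda>r. \<integral>\<^sup>+\<omega>. ennreal ((norm (I \<omega> - simple_integral (W i) (n r) (p r) (\<xi> r) t \<omega>))\<^sup>2) \<partial>M) \<longlonglongrightarrow> 0"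
    for i and f :: "real \<Rightarrow> 'w \<Rightarrow> 'h" and I n p \<xi>
  have Qex: "\<exists>n p \<xi>. Q i f I n p \<xi>" if "has_ito_integral M F (W i) f t I" for i f I
    using that unfolding has_ito_integral_def energy_def Q_def by (elim conjE)
  obtain n p \<xi> where Q: "\<And>i. i < m \<Longrightarrow> Q i (f i) (I i) (n i) (p i) (\<xi> i)"
    using Qex[OF f] by metis
  obtain n' p' \<xi>' where Q': "\<And>i. i < m \<Longrightarrow> Q i (g i) (J i) (n' i) (p' i) (\<xi>' i)"
    using Qex[OF g] by metis
  note d = Q[unfolded Q_def, THEN conjunct1, rule_format] and d' = Q'[unfolded Q_def, THEN conjunct1, rule_format]
  define Sf where "Sf i r \<omega> = simple_integral (W i) (n i r) (p i r) (\<xi> i r) t \<omega>" for i r \<omega>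
  define Sg where "Sg i r \<omega> = simple_integral (W i) (n' i r) (p' i r) (\<xi>' i r) t \<omega>" for i r \<omega>
  define Pf where "Pf i r s \<omega> = simple_process (n i r) (p i r) (\<xi> i r) s \<omega>" for i r s \<omega>
  define Pg where "Pg i r s \<omega> = simple_process (n' i r) (p' i r) (\<xi>' i r) s \<omega>" for i r s \<omega>
  define A where "A i r = energy t (\<lambda>s \<omega>. ennreal ((norm (f i s \<omega> - Pf i r s \<omega>))\<^sup>2))" for i r
  define A' where "A' i r = energy t (\<lambda>s \<omega>. ennreal ((norm (g i s \<omega> - Pg i r s \<omega>))\<^sup>2))" for i r
  define B where "B i r = (\<integral>\<^sup>+\<omega>. ennreal ((norm (I i \<omega> - Sf i r \<omega>))\<^sup>2) \<partial>M)" for i r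
  define B' where "B' i r = (\<integral>\<^sup>+\<omega>. ennreal ((norm (J i \<omega> - Sg i r \<omega>))\<^sup>2) \<partial>M)" for i r
  let ?E = "\<lambda>s. indicator (E (max 0 (s - \<delta>))) :: 'w \<Rightarrow> ennreal"
  have E_meas: "jointly_measurable t ?E"
    by (rule localising_family_delayed[OF E t \<delta>])
  have Em: "E t \<in> sets M"
    using E t filtration_subalgebra[of t] by (auto simp: localising_family_def subalgebra_def)
  have Ssum: "(\<integral>\<^sup>+\<omega>. indicator (E t) \<omega> * ennreal ((norm (\<Sum>i<m. Sf i r \<omega> - Sg i r \<omega>))\<^sup>2) \<partial>M)
      \<le> (\<Sum>i<m. 2 * ?D i + 4 * (A i r + A' i r))" for r
  proof -
    have fg: "(\<lambda>(\<omega>, s). f i s \<omega>) \<in> borel_measurable (M \<Otimes>\<^sub>M time_measure t)"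
      "(\<lambda>(\<omega>, s). g i s \<omega>) \<in> borel_measurable (M \<Otimes>\<^sub>M time_measure t)" if "i < m" for i
      using f[OF that] g[OF that] t by (intro prog_measurable_joint; simp add: has_ito_integral_def)+
    have P: "(\<lambda>(\<omega>, s). Pf i r s \<omega>) \<in> borel_measurable (M \<Otimes>\<^sub>M time_measure t)"
      "(\<lambda>(\<omega>, s). Pg i r s \<omega>) \<in> borel_measurable (M \<Otimes>\<^sub>M time_measure t)" if "i < m" for i
      unfolding Pf_def Pg_def by (rule simple_process_joint[OF d[OF that]] simple_process_joint[OF d'[OF that]])+
    have jm: "jointly_measurable t (\<lambda>s \<omega>. ?E s \<omega> * ennreal ((norm (Pf i r s \<omega> - Pg i r s \<omega>))\<^sup>2))"
      "jointly_measurable t (\<lambda>s \<omega>. ?E s \<omega> * ennreal ((norm (f i s \<omega> - g i s \<omega>))\<^sup>2))"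
      "jointly_measurable t (\<lambda>s \<omega>. ennreal ((norm (f i s \<omega> - Pf i r s \<omega>))\<^sup>2))"
      "jointly_measurable t (\<lambda>s \<omega>. ennreal ((norm (g i s \<omega> - Pg i r s \<omega>))\<^sup>2))" if "i < m" for i
      using E_meas fg[OF that] P[OF that] unfolding jointly_measurable_def case_prod_unfold by auto
    have "(\<integral>\<^sup>+\<omega>. indicator (E t) \<omega> * ennreal ((norm (\<Sum>i<m. Sf i r \<omega> - Sg i r \<omega>))\<^sup>2) \<partial>M)
        \<le> (\<integral>\<^sup>+\<omega>. (\<Sum>i<m. \<integral>\<^sup>+s\<in>{0..t}. (?E s \<omega> * ennreal ((norm (Pf i r s \<omega> - Pg i r s \<omega>))\<^sup>2)) \<partial>lborel) \<partial>M)"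
      unfolding Sf_def Sg_def Pf_def Pg_def
      using simple_integral_localised[of m "\<lambda>i. n i r" "\<lambda>i. p i r" "\<lambda>i. \<xi> i r" "\<lambda>i. n' i r" "\<lambda>i. p' i r" "\<lambda>i. \<xi>' i r" E t \<delta>]
        d d' E t \<delta> by (simp add: localising_family_def)
    also have "\<dots> = (\<Sum>i<m. energy t (\<lambda>s \<omega>. ?E s \<omega> * ennreal ((norm (Pf i r s \<omega> - Pg i r s \<omega>))\<^sup>2)))"
      using jm by (intro energy_sum) auto
    also have "\<dots> \<le> (\<Sum>i<m. 2 * ?D i + 4 * (A i r + A' i r))"
    proof (rule sum_mono)
      fix i assume "i \<in> {..<m}"
      then have i: "i < m" by simp
      have "energy t (\<lambda>s \<omega>. ?E s \<omega> * ennreal ((norm (Pf i r s \<omega> - Pg i r s \<omega>))\<^sup>2))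
        \<le> energy t (\<lambda>s \<omega>. 2 * (?E s \<omega> * ennreal ((norm (f i s \<omega> - g i s \<omega>))\<^sup>2)) +
            4 * (ennreal ((norm (f i s \<omega> - Pf i r s \<omega>))\<^sup>2) + ennreal ((norm (g i s \<omega> - Pg i r s \<omega>))\<^sup>2)))"
      proof (rule energy_mono)
        fix s \<omega>
        have "(norm (Pf i r s \<omega> - Pg i r s \<omega>))\<^sup>2 \<le> 2 * (norm (f i s \<omega> - g i s \<omega>))\<^sup>2 +
            4 * ((norm (f i s \<omega> - Pf i r s \<omega>))\<^sup>2 + (norm (g i s \<omega> - Pg i r s \<omega>))\<^sup>2)"
          using norm_diff_squared_le[of "f i s \<omega> - g i s \<omega>" "(f i s \<omega> - Pf i r s \<omega>) - (g i s \<omega> - Pg i r s \<omega>)"]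
            norm_diff_squared_le[of "f i s \<omega> - Pf i r s \<omega>" "g i s \<omega> - Pg i r s \<omega>"]
          by (simp add: algebra_simps)
        then have "ennreal ((norm (Pf i r s \<omega> - Pg i r s \<omega>))\<^sup>2) \<le> 2 * ennreal ((norm (f i s \<omega> - g i s \<omega>))\<^sup>2) +
            4 * (ennreal ((norm (f i s \<omega> - Pf i r s \<omega>))\<^sup>2) + ennreal ((norm (g i s \<omega> - Pg i r s \<omega>))\<^sup>2))"
          by (simp add: ennreal_plus[symmetric] ennreal_mult[symmetric] ennreal_numeral[symmetric]
            del: ennreal_plus ennreal_numeral)
        then show "?E s \<omega> * ennreal ((norm (Pf i r s \<omega> - Pg i r s \<omega>))\<^sup>2) \<le>
            2 * (?E s \<omega> * ennreal ((norm (f i s \<omega> - g i s \<omega>))\<^sup>2)) +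
            4 * (ennreal ((norm (f i s \<omega> - Pf i r s \<omega>))\<^sup>2) + ennreal ((norm (g i s \<omega> - Pg i r s \<omega>))\<^sup>2))"
          by (auto simp: indicator_def)
      qed
      also have "\<dots> = 2 * ?D i + 4 * (A i r + A' i r)"
        using jm[OF i] unfolding A_def A'_def
        by (simp add: energy_add energy_cmult jointly_measurable_def case_prod_unfold)
      finally show "energy t (\<lambda>s \<omega>. ?E s \<omega> * ennreal ((norm (Pf i r s \<omega> - Pg i r s \<omega>))\<^sup>2)) \<le> 2 * ?D i + 4 * (A i r + A' i r)" .
    qed
    finally show ?thesis .
  qed
  \<comment> \<open>The factor \<open>m\<close> comes from bounding the square of a sum by the sum
    of the squares. It only multiplies approximation errors, which vanish as \<open>r\<close> grows
    with \<open>m\<close> fixed.\<close>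
  have le: "?L \<le> ennreal (4 * real m) * (\<Sum>i<m. B i r + B' i r) + 2 * (\<Sum>i<m. 2 * ?D i + 4 * (A i r + A' i r))" for r
  proof -
    have IJ: "I i \<in> borel_measurable M" "J i \<in> borel_measurable M" if "i < m" for i
      using f[OF that] g[OF that] by (simp_all add: has_ito_integral_def)
    have S: "Sf i r \<in> borel_measurable M" "Sg i r \<in> borel_measurable M" if "i < m" for i
      unfolding Sf_def Sg_def using simple_integral_measurable[OF d[OF that], of t i]
        simple_integral_measurable[OF d'[OF that], of t i] t by simp_all
    have "?L \<le> (\<integral>\<^sup>+\<omega>. ennreal (4 * real m) * (\<Sum>i<m. ennreal ((norm (I i \<omega> - Sf i r \<omega>))\<^sup>2) + ennreal ((norm (J i \<omega> - Sg i r \<omega>))\<^sup>2))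
        + 2 * (indicator (E t) \<omega> * ennreal ((norm (\<Sum>i<m. Sf i r \<omega> - Sg i r \<omega>))\<^sup>2)) \<partial>M)"
    proof (rule nn_integral_mono)
      fix \<omega>
      let ?x = "\<lambda>i. I i \<omega> - Sf i r \<omega>" and ?y = "\<lambda>i. J i \<omega> - Sg i r \<omega>"
      have "(norm (\<Sum>i<m. ?x i - ?y i))\<^sup>2 \<le> real m * (\<Sum>i<m. 2 * (norm (?x i))\<^sup>2 + 2 * (norm (?y i))\<^sup>2)"
        using norm_sum_squared_le[of "\<lambda>i. ?x i - ?y i" "{..<m}"]
        by (elim order_trans) (auto intro!: mult_left_mono sum_mono norm_diff_squared_le)
      also have "\<dots> = 2 * real m * (\<Sum>i<m. (norm (?x i))\<^sup>2 + (norm (?y i))\<^sup>2)"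
        by (simp add: sum_distrib_left algebra_simps)
      finally have 1: "(norm (\<Sum>i<m. ?x i - ?y i))\<^sup>2 \<le> 2 * real m * (\<Sum>i<m. (norm (?x i))\<^sup>2 + (norm (?y i))\<^sup>2)" .
      have "(\<Sum>i<m. I i \<omega> - J i \<omega>) = (\<Sum>i<m. ?x i - ?y i) + (\<Sum>i<m. Sf i r \<omega> - Sg i r \<omega>)"
        by (simp add: sum.distrib[symmetric])
      then have "(norm (\<Sum>i<m. I i \<omega> - J i \<omega>))\<^sup>2 \<le>
          2 * (norm (\<Sum>i<m. ?x i - ?y i))\<^sup>2 + 2 * (norm (\<Sum>i<m. Sf i r \<omega> - Sg i r \<omega>))\<^sup>2"
        using norm_add_squared_le by simp
      also have "\<dots> \<le> 4 * real m * (\<Sum>i<m. (norm (?x i))\<^sup>2 + (norm (?y i))\<^sup>2) + 2 * (norm (\<Sum>i<m. Sf i r \<omega> - Sg i r \<omega>))\<^sup>2"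
        using 1 by simp
      finally have "ennreal ((norm (\<Sum>i<m. I i \<omega> - J i \<omega>))\<^sup>2) \<le>
          ennreal (4 * real m * (\<Sum>i<m. (norm (?x i))\<^sup>2 + (norm (?y i))\<^sup>2) + 2 * (norm (\<Sum>i<m. Sf i r \<omega> - Sg i r \<omega>))\<^sup>2)"
        by (rule ennreal_leI)
      also have "\<dots> = ennreal (4 * real m) * (\<Sum>i<m. ennreal ((norm (?x i))\<^sup>2) + ennreal ((norm (?y i))\<^sup>2))
          + 2 * ennreal ((norm (\<Sum>i<m. Sf i r \<omega> - Sg i r \<omega>))\<^sup>2)"
      proof -
        have S: "0 \<le> (\<Sum>i<m. (norm (?x i))\<^sup>2 + (norm (?y i))\<^sup>2)" by (intro sum_nonneg) simp
        have "ennreal (\<Sum>i<m. (norm (?x i))\<^sup>2 + (norm (?y i))\<^sup>2) = (\<Sum>i<m. ennreal ((norm (?x i))\<^sup>2) + ennreal ((norm (?y i))\<^sup>2))"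
          by (subst sum_ennreal[symmetric]) (simp_all add: ennreal_plus)
        then show ?thesis using S by (simp add: ennreal_plus ennreal_mult)
      qed
      finally show "indicator (E t) \<omega> * ennreal ((norm (\<Sum>i<m. I i \<omega> - J i \<omega>))\<^sup>2) \<le>
          ennreal (4 * real m) * (\<Sum>i<m. ennreal ((norm (?x i))\<^sup>2) + ennreal ((norm (?y i))\<^sup>2))
          + 2 * (indicator (E t) \<omega> * ennreal ((norm (\<Sum>i<m. Sf i r \<omega> - Sg i r \<omega>))\<^sup>2))"
        by (auto simp: indicator_def)
    qed
    also have "\<dots> = ennreal (4 * real m) * (\<Sum>i<m. B i r + B' i r) +
        2 * (\<integral>\<^sup>+\<omega>. indicator (E t) \<omega> * ennreal ((norm (\<Sum>i<m. Sf i r \<omega> - Sg i r \<omega>))\<^sup>2) \<partial>M)"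
    proof -
      have "(\<lambda>\<omega>. indicator (E t) \<omega> * ennreal ((norm (\<Sum>i<m. Sf i r \<omega> - Sg i r \<omega>))\<^sup>2)) \<in> borel_measurable M"
        using S Em by simp
      moreover have "(\<integral>\<^sup>+\<omega>. (\<Sum>i<m. ennreal ((norm (I i \<omega> - Sf i r \<omega>))\<^sup>2) + ennreal ((norm (J i \<omega> - Sg i r \<omega>))\<^sup>2)) \<partial>M)
          = (\<Sum>i<m. B i r + B' i r)"
      proof (subst nn_integral_sum)
        show "(\<Sum>i<m. \<integral>\<^sup>+\<omega>. (ennreal ((norm (I i \<omega> - Sf i r \<omega>))\<^sup>2) + ennreal ((norm (J i \<omega> - Sg i r \<omega>))\<^sup>2)) \<partial>M)
          = (\<Sum>i<m. B i r + B' i r)"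
          unfolding B_def B'_def using IJ S by (intro sum.cong refl nn_integral_add) auto
      qed (use IJ S in auto)
      ultimately show ?thesis
        using IJ S by (simp add: nn_integral_add nn_integral_cmult)
    qed
    also have "\<dots> \<le> ennreal (4 * real m) * (\<Sum>i<m. B i r + B' i r) + 2 * (\<Sum>i<m. 2 * ?D i + 4 * (A i r + A' i r))"
      by (intro add_left_mono mult_left_mono Ssum) simp
    finally show ?thesis .
  qed
  have "(\<lambda>r. ennreal (4 * real m) * (\<Sum>i<m. B i r + B' i r) + 2 * (\<Sum>i<m. 2 * ?D i + 4 * (A i r + A' i r)))
      \<longlonglongrightarrow> ennreal (4 * real m) * (\<Sum>i<m. 0 + 0) + 2 * (\<Sum>i<m. 2 * ?D i + 4 * (0 + 0))"
    using Q Q'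
    by (intro tendsto_add ennreal_tendsto_cmult tendsto_sum tendsto_const)
      (auto simp: Q_def A_def A'_def B_def B'_def Pf_def Pg_def Sf_def Sg_def)
  then have "?L \<le> ennreal (4 * real m) * (\<Sum>i<m. 0 + 0) + 2 * (\<Sum>i<m. 2 * ?D i + 4 * (0 + 0))"
    using le by (intro LIMSEQ_le_const) auto
  also have "\<dots> = 4 * (\<Sum>i<m. ?D i)"
    by (simp add: sum_distrib_left[symmetric] mult.assoc[symmetric])
  finally show ?thesis .
qed

end

lemma Cauchy_Schwarz_time_integral:
  fixes h :: "real \<Rightarrow> ennreal"
  assumes "(\<lambda>s. h s * indicator {0..t} s) \<in> borel_measurable lborel" "0 \<le> t"
  shows "(\<integral>\<^sup>+s\<in>{0..t}. h s \<partial>lborel)\<^sup>2 \<le> ennreal t * (\<integral>\<^sup>+s\<in>{0..t}. (h s)\<^sup>2 \<partial>lborel)"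
proof -
  have "(\<integral>\<^sup>+s. (h s * indicator {0..t} s) * indicator {0..t} s \<partial>lborel)\<^sup>2
      \<le> (\<integral>\<^sup>+s. (h s * indicator {0..t} s)\<^sup>2 \<partial>lborel) * (\<integral>\<^sup>+s. (indicator {0..t} s)\<^sup>2 \<partial>lborel)"
    by (rule Cauchy_Schwarz_nn_integral) (use assms in auto)
  moreover have "(indicator {0..t} s :: ennreal)\<^sup>2 = indicator {0..t} s" for s :: real
    by (simp add: indicator_def)
  ultimately show ?thesis
    using assms(2) by (simp add: power_mult_distrib mult.assoc mult.commute[of "ennreal t"]
      flip: power2_eq_square)
qed

context cylindrical_brownian_motion
begin

text \<open>The delay tends to 0 under dominated convergence. For s > 0, a point outside
  \<open>E s\<close> is already outside some earlier event by left continuity, so the delayed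
  indicators eventually equal that of \<open>E s\<close>; at s = 0 the maximum with 0 hides the
  delay. The dominating function has finite energy because both integrands are square
  integrable.\<close>

lemma ito_difference_bound:
  fixes f g :: "nat \<Rightarrow> real \<Rightarrow> 'w \<Rightarrow> 'h::{real_inner, banach, second_countable_topology}"
  assumes f: "\<And>i. i < m \<Longrightarrow> has_ito_integral M F (W i) (f i) t (I i)"
    and g: "\<And>i. i < m \<Longrightarrow> has_ito_integral M F (W i) (g i) t (J i)"
    and E: "localising_family E" and t: "0 < t"
  shows "(\<integral>\<^sup>+\<omega>. indicator (E t) \<omega> * ennreal ((norm (\<Sum>i<m. I i \<omega> - J i \<omega>))\<^sup>2) \<partial>M)
    \<le> 4 * (\<Sum>i<m. energy t (\<lambda>s \<omega>. indicator (E s) \<omega> * ennreal ((norm (f i s \<omega> - g i s \<omega>))\<^sup>2)))"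
    (is "?L \<le> 4 * (\<Sum>i<m. energy t (?h i))")
proof -
  define \<delta> where "\<delta> j = 1 / real (Suc j)" for j
  have \<delta>: "0 < \<delta> j" for j by (simp add: \<delta>_def)
  let ?D = "\<lambda>i j s \<omega>. indicator (E (max 0 (s - \<delta> j))) \<omega> * ennreal ((norm (f i s \<omega> - g i s \<omega>))\<^sup>2)"
  have lim: "(\<lambda>j. energy t (?D i j)) \<longlonglongrightarrow> energy t (?h i)" if i: "i < m" for i
  proof (rule energy_tendsto)
    have [measurable]: "(\<lambda>(\<omega>, s). f i s \<omega>) \<in> borel_measurable (M \<Otimes>\<^sub>M time_measure t)"
      "(\<lambda>(\<omega>, s). g i s \<omega>) \<in> borel_measurable (M \<Otimes>\<^sub>M time_measure t)"
      using f[OF i] g[OF i] t by (intro prog_measurable_joint; simp add: has_ito_integral_def)+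
    have jf: "jointly_measurable t (\<lambda>s \<omega>. ennreal ((norm (f i s \<omega>))\<^sup>2))"
      and jg: "jointly_measurable t (\<lambda>s \<omega>. ennreal ((norm (g i s \<omega>))\<^sup>2))"
      and jfg: "jointly_measurable t (\<lambda>s \<omega>. ennreal ((norm (f i s \<omega> - g i s \<omega>))\<^sup>2))"
      unfolding jointly_measurable_def by measurable
    show "jointly_measurable t (?D i j)" for j
      using localising_family_delayed[OF E t \<delta>[of j]] jfg by (simp add: jointly_measurable_def case_prod_unfold)
    have "jointly_measurable t (\<lambda>s. indicator (E s))" using E t by (simp add: localising_family_def)
    then show "jointly_measurable t (?h i)"
      using jfg by (simp add: jointly_measurable_def case_prod_unfold)
    let ?w = "\<lambda>s \<omega>. 2 * ennreal ((norm (f i s \<omega>))\<^sup>2) + 2 * ennreal ((norm (g i s \<omega>))\<^sup>2)"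
    show "jointly_measurable t ?w"
      using jf jg by (simp add: jointly_measurable_def case_prod_unfold)
    have "energy t ?w = 2 * energy t (\<lambda>s \<omega>. ennreal ((norm (f i s \<omega>))\<^sup>2)) + 2 * energy t (\<lambda>s \<omega>. ennreal ((norm (g i s \<omega>))\<^sup>2))"
      using jf jg by (subst energy_add) (simp_all add: energy_cmult jointly_measurable_def case_prod_unfold)
    also have "\<dots> < \<infinity>"
      using f[OF i] g[OF i] t by (auto simp: has_ito_integral_def energy_def ennreal_mult_less_top)
    finally show "energy t ?w < \<infinity>" .
    fix s \<omega> assume s: "s \<in> {0..t}"
    show "?D i j s \<omega> \<le> ?w s \<omega>" for j
    proof -
      have "?D i j s \<omega> \<le> ennreal ((norm (f i s \<omega> - g i s \<omega>))\<^sup>2)" by (simp add: indicator_def)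
      also have "\<dots> \<le> ennreal (2 * (norm (f i s \<omega>))\<^sup>2 + 2 * (norm (g i s \<omega>))\<^sup>2)"
        by (intro ennreal_leI norm_diff_squared_le)
      also have "\<dots> = ?w s \<omega>" by (simp add: ennreal_plus ennreal_mult)
      finally show ?thesis .
    qed
    have "\<forall>\<^sub>F j in sequentially. indicator (E (max 0 (s - \<delta> j))) \<omega> = (indicator (E s) \<omega> :: ennreal)"
    proof (cases "\<omega> \<in> E s")
      case True
      have "E s \<subseteq> E r" if "0 \<le> r" "r \<le> s" for r
        using E that by (simp add: localising_family_def)
      then have "\<omega> \<in> E (max 0 (s - \<delta> j))" for j
        using True s less_imp_le[OF \<delta>[of j]] by (meson atLeastAtMost_iff diff_le_eq le_add_same_cancel1 max.bounded_iff max.cobounded1 subsetD)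
      then show ?thesis using True by simp
    next
      case False
      show ?thesis
      proof (cases "s = 0")
        case True
        then show ?thesis using \<delta> by (intro always_eventually) (simp add: max_absorb1 less_imp_le)
      next
        case False
        then have "(\<Inter>r\<in>{0..<s}. E r) \<subseteq> E s"
          using s E by (simp add: localising_family_def)
        then obtain r where r: "r \<in> {0..<s}" "\<omega> \<notin> E r" using \<open>\<omega> \<notin> E s\<close> by blast
        have "\<delta> \<longlonglongrightarrow> 0" unfolding \<delta>_def by (rule LIMSEQ_inverse_real_of_nat[unfolded inverse_eq_divide])
        then have "\<forall>\<^sub>F j in sequentially. \<delta> j < s - r" using r by (intro order_tendstoD) auto
        then show ?thesis
        proof eventually_elim
          case (elim j)
          then have "E (max 0 (s - \<delta> j)) \<subseteq> E r" using E r unfolding localising_family_def by auto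
          then have "\<omega> \<notin> E (max 0 (s - \<delta> j))" using r by blast
          then show ?case using \<open>\<omega> \<notin> E s\<close> by simp
        qed
      qed
    qed
    then show "(\<lambda>j. ?D i j s \<omega>) \<longlonglongrightarrow> ?h i s \<omega>"
      by (intro tendsto_eventually) (auto elim: eventually_mono)
  qed
  have "(\<lambda>j. 4 * (\<Sum>i<m. energy t (?D i j))) \<longlonglongrightarrow> 4 * (\<Sum>i<m. energy t (?h i))"
    using lim by (intro ennreal_tendsto_cmult tendsto_sum) auto
  then show ?thesis
    using ito_difference_bound_delayed[OF f g E t \<delta>] by (intro LIMSEQ_le_const) auto
qed

text \<open>Partial sums of the two series replace \<open>I\<close> and \<open>J\<close> up to
  errors that vanish in L^2. Splitting these errors off doubles the constant 4, and the finite sums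
  on the right are dominated by the full series.\<close>

lemma cylindrical_integral_difference_bound:
  fixes B B' :: "real \<Rightarrow> 'w \<Rightarrow> 'u \<Rightarrow>\<^sub>L 'h::{real_inner, banach, second_countable_topology}"
  assumes B: "has_cylindrical_integral_L2 M F e W B t I"
    and B': "has_cylindrical_integral_L2 M F e W B' t J"
    and E: "localising_family E" and t: "0 < t"
  shows "(\<integral>\<^sup>+\<omega>. indicator (E t) \<omega> * ennreal ((norm (I \<omega> - J \<omega>))\<^sup>2) \<partial>M)
    \<le> 8 * (\<Sum>i. energy t (\<lambda>s \<omega>. indicator (E s) \<omega> * ennreal ((norm (B s \<omega> (e i) - B' s \<omega> (e i)))\<^sup>2)))"
    (is "?L \<le> 8 * (\<Sum>i. ?D i)")
proof -
  obtain Is where Is: "\<And>i. has_ito_integral M F (W i) (\<lambda>s \<omega>. B s \<omega> (e i)) t (Is i)"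
    and Il: "(\<lambda>n. \<integral>\<^sup>+\<omega>. ennreal ((norm (I \<omega> - (\<Sum>i<n. Is i \<omega>)))\<^sup>2) \<partial>M) \<longlonglongrightarrow> 0"
    using B unfolding has_cylindrical_integral_L2_def by blast
  obtain Js where Js: "\<And>i. has_ito_integral M F (W i) (\<lambda>s \<omega>. B' s \<omega> (e i)) t (Js i)"
    and Jl: "(\<lambda>n. \<integral>\<^sup>+\<omega>. ennreal ((norm (J \<omega> - (\<Sum>i<n. Js i \<omega>)))\<^sup>2) \<partial>M) \<longlonglongrightarrow> 0"
    using B' unfolding has_cylindrical_integral_L2_def by blast
  have [measurable]: "I \<in> borel_measurable M" "J \<in> borel_measurable M"
    using B B' by (auto simp: has_cylindrical_integral_L2_def)
  have [measurable]: "Is i \<in> borel_measurable M" "Js i \<in> borel_measurable M" for i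
    using Is[of i] Js[of i] by (simp_all add: has_ito_integral_def)
  have [measurable]: "E t \<in> sets M"
    using E t filtration_subalgebra[of t] by (auto simp: localising_family_def subalgebra_def)
  let ?a = "\<lambda>n. \<integral>\<^sup>+\<omega>. ennreal ((norm (I \<omega> - (\<Sum>i<n. Is i \<omega>)))\<^sup>2) \<partial>M"
  let ?b = "\<lambda>n. \<integral>\<^sup>+\<omega>. ennreal ((norm (J \<omega> - (\<Sum>i<n. Js i \<omega>)))\<^sup>2) \<partial>M"
  have "?L \<le> 4 * ?a n + 4 * ?b n + 8 * (\<Sum>i. ?D i)" for n
  proof -
    have "?L \<le> (\<integral>\<^sup>+\<omega>. 4 * ennreal ((norm (I \<omega> - (\<Sum>i<n. Is i \<omega>)))\<^sup>2) + 4 * ennreal ((norm (J \<omega> - (\<Sum>i<n. Js i \<omega>)))\<^sup>2)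
        + 2 * (indicator (E t) \<omega> * ennreal ((norm (\<Sum>i<n. Is i \<omega> - Js i \<omega>))\<^sup>2)) \<partial>M)"
    proof (rule nn_integral_mono)
      fix \<omega>
      let ?x = "I \<omega> - (\<Sum>i<n. Is i \<omega>)" and ?y = "J \<omega> - (\<Sum>i<n. Js i \<omega>)" and ?z = "\<Sum>i<n. Is i \<omega> - Js i \<omega>"
      have "I \<omega> - J \<omega> = (?x - ?y) + ?z" by (simp add: sum_subtractf)
      then have "(norm (I \<omega> - J \<omega>))\<^sup>2 \<le> 2 * (norm (?x - ?y))\<^sup>2 + 2 * (norm ?z)\<^sup>2"
        using norm_add_squared_le by metis
      also have "\<dots> \<le> 4 * (norm ?x)\<^sup>2 + 4 * (norm ?y)\<^sup>2 + 2 * (norm ?z)\<^sup>2"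
        using norm_diff_squared_le[of ?x ?y] by linarith
      finally have "ennreal ((norm (I \<omega> - J \<omega>))\<^sup>2) \<le> ennreal (4 * (norm ?x)\<^sup>2 + 4 * (norm ?y)\<^sup>2 + 2 * (norm ?z)\<^sup>2)"
        by (rule ennreal_leI)
      also have "\<dots> = 4 * ennreal ((norm ?x)\<^sup>2) + 4 * ennreal ((norm ?y)\<^sup>2) + 2 * ennreal ((norm ?z)\<^sup>2)"
        by (simp add: ennreal_plus ennreal_mult)
      finally show "indicator (E t) \<omega> * ennreal ((norm (I \<omega> - J \<omega>))\<^sup>2) \<le>
          4 * ennreal ((norm ?x)\<^sup>2) + 4 * ennreal ((norm ?y)\<^sup>2) + 2 * (indicator (E t) \<omega> * ennreal ((norm ?z)\<^sup>2))"
        by (simp add: indicator_def)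
    qed
    also have "\<dots> = 4 * ?a n + 4 * ?b n + 2 * (\<integral>\<^sup>+\<omega>. indicator (E t) \<omega> * ennreal ((norm (\<Sum>i<n. Is i \<omega> - Js i \<omega>))\<^sup>2) \<partial>M)"
      by (subst nn_integral_add; (subst nn_integral_add)?; (subst nn_integral_cmult)?; simp add: nn_integral_cmult)
    also have "\<dots> \<le> 4 * ?a n + 4 * ?b n + 2 * (4 * (\<Sum>i<n. ?D i))"
      by (intro add_left_mono mult_left_mono ito_difference_bound Is Js E t) simp
    also have "\<dots> \<le> 4 * ?a n + 4 * ?b n + 8 * (\<Sum>i. ?D i)"
    proof -
      have "2 * (4 * (\<Sum>i<n. ?D i)) = 8 * (\<Sum>i<n. ?D i)" by (simp add: mult.assoc[symmetric])
      also have "\<dots> \<le> 8 * (\<Sum>i. ?D i)" by (intro mult_left_mono sum_le_suminf) auto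
      finally show ?thesis by (intro add_left_mono)
    qed
    finally show ?thesis .
  qed
  moreover have "(\<lambda>n. 4 * ?a n + 4 * ?b n + 8 * (\<Sum>i. ?D i)) \<longlonglongrightarrow> 4 * 0 + 4 * 0 + 8 * (\<Sum>i. ?D i)"
    by (intro tendsto_add ennreal_tendsto_cmult tendsto_const Il Jl) auto
  ultimately have "?L \<le> 4 * 0 + 4 * 0 + 8 * (\<Sum>i. ?D i)"
    by (intro LIMSEQ_le_const) auto
  then show ?thesis by simp
qed

end

section \<open>Hilbert-Schmidt operators, Gronwall's lemma and level sets\<close>

lemma hs_ops_diff:
  assumes "B \<in> hs_ops e" "C \<in> hs_ops e"
  shows "C - B \<in> hs_ops e"
proof -
  have "summable (\<lambda>i. 2 * (norm (C (e i)))\<^sup>2 + 2 * (norm (B (e i)))\<^sup>2)"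
    using assms by (intro summable_add summable_mult) (simp_all add: hs_ops_def)
  then have "summable (\<lambda>i. (norm (C (e i) - B (e i)))\<^sup>2)"
    by (rule summable_comparison_test'[of _ 0]) (simp add: norm_diff_squared_le)
  then show ?thesis by (simp add: hs_ops_def blinfun.diff_left)
qed

lemma norm_basis_le_hs_norm:
  assumes "B \<in> hs_ops e"
  shows "norm (blinfun_apply B (e i)) \<le> hs_norm e B"
proof -
  have "(norm (blinfun_apply B (e i)))\<^sup>2 \<le> (\<Sum>i. (norm (blinfun_apply B (e i)))\<^sup>2)"
    using sum_le_suminf[of "\<lambda>i. (norm (blinfun_apply B (e i)))\<^sup>2" "{i}"] assms by (simp add: hs_ops_def)
  then show ?thesis unfolding hs_norm_def by (rule real_le_rsqrt)
qed

lemma hs_norm_squared_ennreal: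
  assumes "B \<in> hs_ops e"
  shows "ennreal ((hs_norm e B)\<^sup>2) = (\<Sum>i. ennreal ((norm (blinfun_apply B (e i)))\<^sup>2))"
  using assms by (subst suminf_ennreal2) (simp_all add: hs_ops_def hs_norm_def suminf_nonneg)

lemma space_hs_borel: "space (hs_borel e) = hs_ops e"
  unfolding hs_borel_def by (rule space_measure_of) auto

text \<open>Evaluation at \<open>e i\<close> is a contraction for the Hilbert-Schmidt norm, so the
  preimage of an open set is one of the open sets that generate \<open>hs_borel e\<close>.
  Progressive measurability of an operator-valued process thus passes to its components.\<close>

lemma basis_evaluation_measurable:
  "(\<lambda>B. blinfun_apply B (e i)) \<in> borel_measurable (hs_borel e :: ('u::{real_inner, banach} \<Rightarrow>\<^sub>L 'h::{real_inner, banach}) measure)"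
proof (rule borel_measurableI)
  fix S :: "'h set" assume "open S"
  let ?U = "(\<lambda>B. blinfun_apply B (e i)) -` S \<inter> space (hs_borel e)"
  let ?G = "{U :: ('u \<Rightarrow>\<^sub>L 'h) set. U \<subseteq> hs_ops e \<and> (\<forall>B\<in>U. \<exists>r>0. \<forall>C\<in>hs_ops e. hs_norm e (C - B) < r \<longrightarrow> C \<in> U)}"
  have "?U \<in> ?G"
  proof (intro CollectI conjI ballI)
    fix B assume B: "B \<in> ?U"
    then obtain r where r: "r > 0" "\<And>y. dist y (blinfun_apply B (e i)) < r \<Longrightarrow> y \<in> S"
      using \<open>open S\<close> unfolding open_dist by auto
    have "C \<in> ?U" if C: "C \<in> hs_ops e" "hs_norm e (C - B) < r" for C
    proof -
      have "norm (blinfun_apply (C - B) (e i)) \<le> hs_norm e (C - B)"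
        using B C by (intro norm_basis_le_hs_norm hs_ops_diff) (auto simp: space_hs_borel)
      then show ?thesis using r C by (simp add: space_hs_borel dist_norm blinfun.diff_left)
    qed
    then show "\<exists>r>0. \<forall>C\<in>hs_ops e. hs_norm e (C - B) < r \<longrightarrow> C \<in> ?U" using r by blast
  qed (auto simp: space_hs_borel)
  moreover have "sets (hs_borel e) = sigma_sets (hs_ops e) ?G"
    unfolding hs_borel_def by (rule sets_measure_of) auto
  ultimately show "?U \<in> sets (hs_borel e)" by (simp only: sigma_sets.Basic)
qed

text \<open>On \<open>hs_ops e\<close> the squared norm is a countable sum of squared evaluations,
  each of them measurable.\<close>

lemma hs_norm_squared_measurable:
  "(\<lambda>B. ennreal ((hs_norm e B)\<^sup>2)) \<in> borel_measurable (hs_borel e :: ('u::{real_inner, banach} \<Rightarrow>\<^sub>L 'h::{real_inner, banach}) measure)"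
proof (subst measurable_cong)
  show "(\<lambda>B. \<Sum>i. ennreal ((norm (blinfun_apply B (e i)))\<^sup>2)) \<in> borel_measurable (hs_borel e :: ('u \<Rightarrow>\<^sub>L 'h) measure)"
    by (intro borel_measurable_suminf_order measurable_compose[OF _ measurable_ennreal]
        borel_measurable_power measurable_compose[OF basis_evaluation_measurable, of norm]) simp
qed (simp add: hs_norm_squared_ennreal space_hs_borel)

text \<open>Once \<open>f\<close> vanishes on \<open>(0, a]\<close>, it is bounded on
  \<open>(0, b]\<close> by a constant multiple of its own integral, supported on \<open>(a, b]\<close>, which forces the
  integral to vanish if \<open>b - a\<close> is small.\<close>

lemma gronwall_zero:
  fixes f :: "real \<Rightarrow> ennreal" and K T :: real
  assumes K: "0 \<le> K"
    and f: "\<And>t. 0 < t \<Longrightarrow> t \<le> T \<Longrightarrow> f t \<le> ennreal K * (\<integral>\<^sup>+s\<in>{0..t}. f s \<partial>lborel)"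
    and fin: "(\<integral>\<^sup>+s\<in>{0..T}. f s \<partial>lborel) < \<infinity>"
    and t: "0 < t" "t \<le> T"
  shows "f t = 0"
proof -
  define I where "I b = (\<integral>\<^sup>+s\<in>{0..b}. f s \<partial>lborel)" for b
  have I_mono: "I a \<le> I b" if "a \<le> b" for a b
    unfolding I_def using that by (intro nn_integral_mono) (auto simp: indicator_def)
  \<comment> \<open>One step of this length bounds the integral by half of itself; the added 1
    covers \<open>K = 0\<close>.\<close>
  define h where "h = 1 / (2 * (K + 1))"
  have h: "0 < h" "h * K \<le> 1 / 2" using K by (simp_all add: h_def field_simps)
  have step: "I b = 0" if ab: "0 \<le> a" "a \<le> b" "b \<le> T" "b - a \<le> h" and a: "I a = 0" for a b
  proof -
    have "I b \<le> (\<integral>\<^sup>+s. ennreal K * I b * indicator {a<..b} s \<partial>lborel)"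
      unfolding I_def[of b]
    proof (rule nn_integral_mono_AE)
      show "AE s in lborel. f s * indicator {0..b} s \<le> ennreal K * (\<integral>\<^sup>+s\<in>{0..b}. f s \<partial>lborel) * indicator {a<..b} s"
        \<comment> \<open>The bound on \<open>f\<close> starts at positive times; time 0 is
          discarded as a null set.\<close>
        using AE_lborel_singleton[of 0]
      proof eventually_elim
        case (elim s)
        show ?case
        proof (cases "0 < s \<and> s \<le> b")
          case True
          then have fs: "f s \<le> ennreal K * I s" using f[of s] ab by (simp add: I_def)
          show ?thesis
          proof (cases "s \<le> a")
            case True
            then have "I s = 0" using I_mono[of s a] a by simp
            then show ?thesis using fs by simp
          next
            case False
            have "ennreal K * I s \<le> ennreal K * I b" using True by (intro mult_left_mono I_mono) auto
            then show ?thesis using fs False True by (simp add: I_def)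
          qed
        next
          case False
          then show ?thesis using elim by (auto simp: indicator_def)
        qed
      qed
    qed
    also have "\<dots> = ennreal K * I b * ennreal (b - a)"
      using ab by (subst nn_integral_cmult_indicator) auto
    also have "\<dots> = ennreal (K * (b - a)) * I b" using K ab by (simp add: ennreal_mult ac_simps)
    also have "\<dots> \<le> ennreal (1 / 2) * I b"
      using h mult_left_mono[OF ab(4) K] by (intro mult_right_mono ennreal_leI) (auto simp: mult.commute)
    finally have le: "I b \<le> ennreal (1 / 2) * I b" .
    \<comment> \<open>Finiteness excludes \<open>\<infinity>\<close>, the other solution of x \<le>
      x / 2.\<close>
    have "I b < \<infinity>" using I_mono[OF ab(3)] fin by (simp add: I_def)
    then obtain x where x: "I b = ennreal x" "0 \<le> x" by (cases "I b") auto
    have "ennreal (1 / 2) * ennreal x = ennreal (1 / 2 * x)" using x(2) by (intro ennreal_mult[symmetric]) auto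
    then have "ennreal x \<le> ennreal (1 / 2 * x)" using le unfolding x(1) by (simp only:)
    then have "x \<le> 1 / 2 * x" using x(2) by (subst (asm) ennreal_le_iff) auto
    then show ?thesis using x by simp
  qed
  have zero: "I (min T (real k * h)) = 0" for k
  proof (induction k)
    case 0
    have "I 0 = 0" unfolding I_def
      by (intro nn_integral_zero' eventually_mono[OF AE_lborel_singleton[of 0]]) (auto simp: indicator_def)
    then show ?case using t by simp
  next
    case (Suc k)
    show ?case
      by (rule step[OF _ _ _ _ Suc]) (use t h in \<open>auto simp: algebra_simps min_def\<close>)
  qed
  obtain k :: nat where "T / h \<le> k" using real_arch_simple by blast
  then have "T \<le> k * h" using h by (simp add: field_simps)
  then have "I T = 0" using zero[of k] by (simp add: min_def)
  then have "I t = 0" using I_mono[OF t(2)] by simp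
  then show ?thesis using f[OF t] by (simp add: I_def)
qed

section \<open>Level sets of an accumulated nonnegative process\<close>

context filtered_prob_space
begin

context
  fixes z :: "real \<Rightarrow> 'w \<Rightarrow> ennreal" and c :: ennreal
  assumes z: "prog_measurable F borel z"
begin

text \<open>The non-strict inequality is what makes the family left continuous, since it survives a
  supremum over earlier times.\<close>

definition level_set :: "real \<Rightarrow> 'w set" where
  "level_set t = {\<omega> \<in> space M. (\<integral>\<^sup>+s\<in>{0..t}. z s \<omega> \<partial>lborel) \<le> c}"

lemma level_set_antimono: "s \<le> t \<Longrightarrow> level_set t \<subseteq> level_set s"
proof (clarsimp simp: level_set_def)
  fix \<omega> assume "s \<le> t" "(\<integral>\<^sup>+s\<in>{0..t}. z s \<omega> \<partial>lborel) \<le> c"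
  moreover have "(\<integral>\<^sup>+r\<in>{0..s}. z r \<omega> \<partial>lborel) \<le> (\<integral>\<^sup>+r\<in>{0..t}. z r \<omega> \<partial>lborel)"
    using \<open>s \<le> t\<close> by (intro nn_integral_mono) (auto simp: indicator_def)
  ultimately show "(\<integral>\<^sup>+r\<in>{0..s}. z r \<omega> \<partial>lborel) \<le> c" by simp
qed

lemma section_measurable:
  assumes "0 \<le> t" "\<omega> \<in> space M"
  shows "(\<lambda>s. z s \<omega> * indicator {0..t} s) \<in> borel_measurable lborel"
proof -
  have "(\<lambda>s. z s \<omega>) \<in> borel_measurable (time_measure t)"
    using measurable_compose[OF measurable_Pair1'[OF assms(2)] prog_measurable_joint[OF z assms(1)]] by simp
  then show ?thesis by (simp add: borel_measurable_restrict_space_iff_ennreal)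
qed

text \<open>Continuity from below of the measure with density \<open>z\<close> along intervals that
  exhaust \<open>{0..<s}\<close>; the end point \<open>s\<close> is a null set.\<close>

lemma level_set_left_continuous:
  assumes "0 < s"
  shows "(\<Inter>r\<in>{0..<s}. level_set r) \<subseteq> level_set s"
proof
  fix \<omega> assume \<omega>: "\<omega> \<in> (\<Inter>r\<in>{0..<s}. level_set r)"
  then have sp: "\<omega> \<in> space M" using assms by (force simp: level_set_def)
  let ?N = "density lborel (\<lambda>r. z r \<omega> * indicator {0..s} r)"
  note zm = section_measurable[OF less_imp_le[OF assms] sp]
  define A where "A j = {0..s * (1 - 1 / real (Suc j))}" for j
  have A: "range A \<subseteq> sets ?N" "incseq A"
    unfolding A_def incseq_def using assms by (auto intro!: mult_left_mono frac_le elim!: order_trans)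
  have UA: "(\<Union>j. A j) = {0..<s}"
  proof (rule set_eqI)
    fix x
    have "x < s \<longleftrightarrow> (\<exists>j. x \<le> s * (1 - 1 / real (Suc j)))" if "0 \<le> x"
    proof
      assume "x < s"
      then have "0 < 1 - x / s" using assms by simp
      then obtain j where "1 / real (Suc j) < 1 - x / s" using nat_approx_posE by blast
      then have "x / s < 1 - 1 / real (Suc j)" by simp
      then have "x < (1 - 1 / real (Suc j)) * s" using assms by (simp only: pos_divide_less_eq)
      then show "\<exists>j. x \<le> s * (1 - 1 / real (Suc j))" by (metis less_imp_le mult.commute)
    next
      assume "\<exists>j. x \<le> s * (1 - 1 / real (Suc j))"
      then obtain j where "x \<le> s * (1 - 1 / real (Suc j))" by blast
      also have "\<dots> < s * 1" using assms by (intro mult_strict_left_mono) auto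
      finally show "x < s" by simp
    qed
    then show "x \<in> (\<Union>j. A j) \<longleftrightarrow> x \<in> {0..<s}" by (auto simp: A_def)
  qed
  have "(\<integral>\<^sup>+r\<in>{0..s}. z r \<omega> \<partial>lborel) = (\<integral>\<^sup>+r. z r \<omega> * indicator {0..s} r * indicator {0..<s} r \<partial>lborel)"
    by (intro nn_integral_cong_AE eventually_mono[OF AE_lborel_singleton[of s]]) (auto simp: indicator_def)
  also have "\<dots> = emeasure ?N (\<Union>j. A j)"
    unfolding UA using zm by (simp add: emeasure_density)
  also have "\<dots> = (SUP j. emeasure ?N (A j))"
    by (rule SUP_emeasure_incseq[OF A, symmetric])
  also have "\<dots> \<le> c"
  proof (rule SUP_least)
    fix j
    have "0 \<le> s * (1 - 1 / real (Suc j))" "s * (1 - 1 / real (Suc j)) < s * 1"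
      using assms by (intro mult_nonneg_nonneg mult_strict_left_mono; simp)+
    then have *: "\<omega> \<in> level_set (s * (1 - 1 / real (Suc j)))" using \<omega> by simp
    have "emeasure ?N (A j) = (\<integral>\<^sup>+r. z r \<omega> * indicator {0..s} r * indicator (A j) r \<partial>lborel)"
      using zm by (intro emeasure_density) (auto simp: A_def)
    also have "\<dots> \<le> (\<integral>\<^sup>+r\<in>{0..s * (1 - 1 / real (Suc j))}. z r \<omega> \<partial>lborel)"
      by (intro nn_integral_mono) (auto simp: A_def indicator_def)
    also have "\<dots> \<le> c" using * by (simp add: level_set_def)
    finally show "emeasure ?N (A j) \<le> c" .
  qed
  finally show "\<omega> \<in> level_set s" using sp by (simp add: level_set_def)
qed

lemma localising_family_level_set: "localising_family level_set"
  unfolding localising_family_def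
proof (intro conjI allI impI)
  fix s :: real assume s: "0 \<le> s"
  \<comment> \<open>Progressive measurability up to time \<open>s\<close> refers to
    \<open>F s\<close> alone, so Tonelli's theorem on the product of \<open>F s\<close> with time
    gives adaptedness.\<close>
  show "level_set s \<in> sets (F s)"
  proof -
    have "sets (restrict_space borel {0..s}) = sets (time_measure s)" by (rule sets_restrict_space_cong) simp
    from sets_pair_measure_cong[OF this refl, of "F s"]
    have "measurable (restrict_space borel {0..s} \<Otimes>\<^sub>M F s) (borel :: ennreal measure) =
        measurable (time_measure s \<Otimes>\<^sub>M F s) borel" by (rule measurable_cong_sets) simp
    then have "(\<lambda>(r, \<omega>). z r \<omega>) \<in> borel_measurable (time_measure s \<Otimes>\<^sub>M F s)"
      using z s unfolding prog_measurable_def by auto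
    from measurable_compose[OF measurable_pair_swap' this]
    have "(\<lambda>(\<omega>, r). z r \<omega>) \<in> borel_measurable (F s \<Otimes>\<^sub>M time_measure s)"
      by (simp add: case_prod_unfold)
    from sigma_finite_measure.borel_measurable_nn_integral[OF sigma_finite_time_measure this]
    have "(\<lambda>\<omega>. \<integral>\<^sup>+r\<in>{0..s}. z r \<omega> \<partial>lborel) \<in> borel_measurable (F s)"
      by (simp add: nn_integral_restrict_space)
    then show ?thesis unfolding level_set_def space_F[OF s, symmetric] by measurable
  qed
next
  fix s t :: real assume "s \<le> t"
  then show "level_set t \<subseteq> level_set s" by (rule level_set_antimono)
next
  fix s :: real assume "0 < s"
  then show "(\<Inter>r\<in>{0..<s}. level_set r) \<subseteq> level_set s" by (rule level_set_left_continuous)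
next
  fix t :: real assume t: "0 < t"
  note zj = prog_measurable_joint[OF z less_imp_le[OF t]]
  let ?P = "M \<Otimes>\<^sub>M time_measure t"
  have [measurable]: "(\<lambda>x. z (snd x) (fst (fst x))) \<in> borel_measurable (?P \<Otimes>\<^sub>M time_measure t)"
    using measurable_compose[OF _ zj, of "\<lambda>x. (fst (fst x), snd x)" "?P \<Otimes>\<^sub>M time_measure t"] by simp
  have b: "(\<lambda>s. s) \<in> borel_measurable (time_measure t)" by (rule measurable_restrict_space1) simp
  have [measurable]: "(\<lambda>x. snd x) \<in> borel_measurable (?P \<Otimes>\<^sub>M time_measure t)"
     "(\<lambda>x. snd (fst x)) \<in> borel_measurable (?P \<Otimes>\<^sub>M time_measure t)"
    by (rule measurable_compose[OF _ b]; simp)+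
  \<comment> \<open>The upper limit of the running integral is moved into the integrand as the
    condition \<open>r \<le> snd y\<close>. Integrating out \<open>r\<close> then gives
    measurability in \<omega> and time jointly.\<close>
  have "(\<lambda>(y, r). (if r \<le> snd y then z r (fst y) else 0)) \<in> borel_measurable (?P \<Otimes>\<^sub>M time_measure t)"
    unfolding case_prod_unfold by measurable
  from sigma_finite_measure.borel_measurable_nn_integral[OF sigma_finite_time_measure this]
  have *: "(\<lambda>y. \<integral>\<^sup>+r. (if r \<le> snd y then z r (fst y) else 0) \<partial>time_measure t) \<in> borel_measurable ?P"
    by simp
  have "(\<lambda>y. indicator {..c} (\<integral>\<^sup>+r. (if r \<le> snd y then z r (fst y) else 0) \<partial>time_measure t) :: ennreal)
      \<in> borel_measurable ?P"
    by (rule measurable_compose[OF *]) simp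
  also have "?this \<longleftrightarrow> jointly_measurable t (\<lambda>s. indicator (level_set s))"
    unfolding jointly_measurable_def
  proof (rule measurable_cong)
    fix y assume y: "y \<in> space ?P"
    then have s: "snd y \<in> {0..t}" and w: "fst y \<in> space M" by (auto simp: space_pair_measure space_restrict_space)
    have "(\<integral>\<^sup>+r. (if r \<le> snd y then z r (fst y) else 0) \<partial>time_measure t)
        = (\<integral>\<^sup>+r\<in>{0..snd y}. z r (fst y) \<partial>lborel)"
      using s by (auto simp: nn_integral_restrict_space indicator_def intro!: nn_integral_cong)
    then show "indicator {..c} (\<integral>\<^sup>+r. (if r \<le> snd y then z r (fst y) else 0) \<partial>time_measure t) =
        (case y of (\<omega>, s) \<Rightarrow> indicator (level_set s) \<omega>)"
      using w by (auto simp: level_set_def indicator_def case_prod_unfold)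
  qed
  finally show "jointly_measurable t (\<lambda>s. indicator (level_set s))" .
qed

text \<open>Let \<sigma> be the supremum of the times up to \<open>t\<close> at which \<omega> is in
  the level set; left continuity puts \<omega> in the level set at \<sigma> itself. The integrand
  vanishes after \<sigma>, and membership at \<sigma> bounds the rest by \<open>c\<close>. This
  pathwise bound supplies the finiteness for Gronwall's lemma.\<close>

lemma nn_integral_level_set_le:
  assumes "0 \<le> t" "\<omega> \<in> space M"
  shows "(\<integral>\<^sup>+s\<in>{0..t}. (indicator (level_set s) \<omega> * z s \<omega>) \<partial>lborel) \<le> c"
proof -
  let ?A = "{s. 0 \<le> s \<and> s \<le> t \<and> \<omega> \<in> level_set s}"
  have 0: "\<omega> \<in> level_set 0"
  proof -
    have "(\<integral>\<^sup>+s\<in>{0..0}. z s \<omega> \<partial>lborel) = 0"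
      by (intro nn_integral_zero' eventually_mono[OF AE_lborel_singleton[of 0]]) (auto simp: indicator_def)
    then show ?thesis using assms by (simp add: level_set_def)
  qed
  then have ne: "?A \<noteq> {}" using assms by auto
  have bdd: "bdd_above ?A" by (rule bdd_aboveI[of _ t]) auto
  define \<sigma> where "\<sigma> = Sup ?A"
  have \<sigma>: "0 \<le> \<sigma>" unfolding \<sigma>_def using 0 assms by (intro cSup_upper bdd) auto
  have "\<omega> \<in> level_set r" if "0 \<le> r" "r < \<sigma>" for r
  proof -
    have "\<exists>a\<in>?A. r < a" using that(2) unfolding \<sigma>_def less_cSup_iff[OF ne bdd] .
    then obtain a where "a \<in> ?A" "r < a" by (elim bexE)
    then show ?thesis using level_set_antimono[of r a] by auto
  qed
  then have \<omega>\<sigma>: "\<omega> \<in> level_set \<sigma>"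
    using level_set_left_continuous[of \<sigma>] 0 \<sigma> by (cases "\<sigma> = 0") auto
  have "(\<integral>\<^sup>+s\<in>{0..t}. (indicator (level_set s) \<omega> * z s \<omega>) \<partial>lborel) \<le> (\<integral>\<^sup>+s\<in>{0..\<sigma>}. z s \<omega> \<partial>lborel)"
  proof (rule nn_integral_mono)
    fix s
    have "s \<le> \<sigma>" if "s \<in> ?A" unfolding \<sigma>_def by (intro cSup_upper that bdd)
    then show "indicator (level_set s) \<omega> * z s \<omega> * indicator {0..t} s \<le> z s \<omega> * indicator {0..\<sigma>} s"
      by (auto simp: indicator_def)
  qed
  also have "\<dots> \<le> c" using \<omega>\<sigma> by (simp add: level_set_def)
  finally show ?thesis .
qed

end

end

section \<open>Pathwise uniqueness\<close>

context filtered_prob_space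
begin

lemma jointly_measurable_section:
  assumes "jointly_measurable t h" "\<omega> \<in> space M"
  shows "(\<lambda>s. h s \<omega> * indicator {0..t} s) \<in> borel_measurable lborel"
proof -
  have "(\<lambda>s. h s \<omega>) \<in> borel_measurable (time_measure t)"
    using measurable_compose[OF measurable_Pair1'[OF assms(2)] assms(1)[unfolded jointly_measurable_def]] by simp
  then show ?thesis by (simp add: borel_measurable_restrict_space_iff_ennreal)
qed

lemma jointly_measurable_time_integral:
  assumes "jointly_measurable t h"
  shows "(\<lambda>\<omega>. \<integral>\<^sup>+s\<in>{0..t}. h s \<omega> \<partial>lborel) \<in> borel_measurable M"
  using sigma_finite_measure.borel_measurable_nn_integral_fst[OF sigma_finite_time_measure, of "\<lambda>(\<omega>, s). h s \<omega>" M t]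
    assms by (simp add: jointly_measurable_def nn_integral_restrict_space)

lemma jointly_measurable_mult:
  assumes "jointly_measurable t g" "jointly_measurable t h"
  shows "jointly_measurable t (\<lambda>s \<omega>. g s \<omega> * h s \<omega>)"
  using assms by (simp add: jointly_measurable_def case_prod_unfold)

lemma energy_swap:
  assumes "jointly_measurable t h"
  shows "energy t h = (\<integral>\<^sup>+s\<in>{0..t}. (\<integral>\<^sup>+\<omega>. h s \<omega> \<partial>M) \<partial>lborel)"
proof -
  interpret pair_sigma_finite M "time_measure t"
    by (intro pair_sigma_finite.intro sigma_finite_time_measure) unfold_locales
  show ?thesis
    using nn_integral_snd[of "\<lambda>(\<omega>, s). h s \<omega>"] assms
    by (simp add: energy_eq jointly_measurable_def nn_integral_restrict_space)
qed

lemma energy_suminf: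
  assumes "\<And>i. jointly_measurable t (h i)"
  shows "(\<Sum>i. energy t (h i)) = energy t (\<lambda>s \<omega>. \<Sum>i. h i s \<omega>)"
proof -
  have "jointly_measurable t (\<lambda>s \<omega>. \<Sum>i. h i s \<omega>)"
    using assms by (simp add: jointly_measurable_def case_prod_unfold)
  then show ?thesis
    using assms by (simp add: energy_eq case_prod_unfold nn_integral_suminf jointly_measurable_def)
qed

lemma prog_measurable_compose:
  assumes "prog_measurable F N X" "f \<in> measurable N K"
  shows "prog_measurable F K (\<lambda>t \<omega>. f (X t \<omega>))"
  using measurable_compose[OF _ assms(2)] assms(1)
  unfolding prog_measurable_def case_prod_unfold by blast

lemma prog_measurable_add:
  fixes X Y :: "real \<Rightarrow> 'w \<Rightarrow> ennreal"
  assumes "prog_measurable F borel X" "prog_measurable F borel Y"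
  shows "prog_measurable F borel (\<lambda>t \<omega>. X t \<omega> + Y t \<omega>)"
  using assms unfolding prog_measurable_def case_prod_unfold by (intro allI impI borel_measurable_add) auto

end

text \<open>The accumulated squared norm is strictly below the threshold at time \<open>t\<close>,
  so by monotonicity it reaches the threshold only after \<open>t\<close>. The condition
  \<open>t \<le> real m\<close> deals with the cap at \<open>m\<close>.\<close>

lemma le_localising_time:
  assumes "0 \<le> t" "t \<le> real m" "(\<integral>\<^sup>+s\<in>{0..t}. ennreal ((hs_norm e (B s \<omega>))\<^sup>2) \<partial>lborel) < of_nat m"
  shows "t \<le> localising_time e B m \<omega>"
  unfolding localising_time_def
proof (rule cInf_greatest)
  fix u assume "u \<in> insert (real m) {t. 0 \<le> t \<and> (\<integral>\<^sup>+s\<in>{0..t}. ennreal ((hs_norm e (B s \<omega>))\<^sup>2) \<partial>lborel) \<ge> of_nat m}"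
  moreover have "t \<le> u" if u: "(\<integral>\<^sup>+s\<in>{0..u}. ennreal ((hs_norm e (B s \<omega>))\<^sup>2) \<partial>lborel) \<ge> of_nat m"
  proof (rule ccontr)
    assume "\<not> t \<le> u"
    then have "(\<integral>\<^sup>+s\<in>{0..u}. ennreal ((hs_norm e (B s \<omega>))\<^sup>2) \<partial>lborel) \<le> (\<integral>\<^sup>+s\<in>{0..t}. ennreal ((hs_norm e (B s \<omega>))\<^sup>2) \<partial>lborel)"
      by (intro nn_integral_mono) (auto simp: indicator_def)
    then show False using u assms(3) by simp
  qed
  ultimately show "t \<le> u" using assms(2) by auto
qed simp

text \<open>Cauchy-Schwarz in time: the square of an integral over [0, t] is at most t times the
  integral of the square, to which the Lipschitz bound applies pointwise.\<close>

lemma drift_difference_bound: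
  fixes a b x y :: "real \<Rightarrow> 'h::{real_inner, banach, second_countable_topology}"
  assumes a: "set_integrable lborel {0..t} a" and b: "set_integrable lborel {0..t} b"
    and t: "0 \<le> t"
    and lip: "\<And>s. 0 \<le> s \<Longrightarrow> s \<le> t \<Longrightarrow> (norm (a s - b s))\<^sup>2 \<le> K * (norm (x s - y s))\<^sup>2"
  shows "ennreal ((norm ((LINT s:{0..t}|lborel. a s) - (LINT s:{0..t}|lborel. b s)))\<^sup>2)
    \<le> ennreal t * (\<integral>\<^sup>+s\<in>{0..t}. ennreal (K * (norm (x s - y s))\<^sup>2) \<partial>lborel)"
proof -
  let ?d = "\<lambda>s. indicat_real {0..t} s *\<^sub>R (a s - b s)"
  have d: "integrable lborel ?d"
    using set_integral_diff(1)[OF a b] by (simp add: set_integrable_def)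
  have eq: "ennreal (norm (?d s)) = ennreal (norm (a s - b s)) * indicator {0..t} s" for s
    by (simp add: indicator_def)
  have "(LINT s:{0..t}|lborel. a s) - (LINT s:{0..t}|lborel. b s) = (LINT s|lborel. ?d s)"
    using set_integral_diff(2)[OF a b] by (simp add: set_lebesgue_integral_def)
  then have "ennreal (norm ((LINT s:{0..t}|lborel. a s) - (LINT s:{0..t}|lborel. b s)))
      \<le> (\<integral>\<^sup>+s\<in>{0..t}. ennreal (norm (a s - b s)) \<partial>lborel)"
    using integral_norm_bound_ennreal[OF d] unfolding eq by simp
  then have "(ennreal (norm ((LINT s:{0..t}|lborel. a s) - (LINT s:{0..t}|lborel. b s))))\<^sup>2
      \<le> (\<integral>\<^sup>+s\<in>{0..t}. ennreal (norm (a s - b s)) \<partial>lborel)\<^sup>2"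
    by (intro power_mono) auto
  also have "\<dots> \<le> ennreal t * (\<integral>\<^sup>+s\<in>{0..t}. (ennreal (norm (a s - b s)))\<^sup>2 \<partial>lborel)"
  proof (rule Cauchy_Schwarz_time_integral[OF _ t])
    have "(\<lambda>s. ennreal (norm (?d s))) \<in> borel_measurable lborel"
      using measurable_compose[OF borel_measurable_integrable[OF d], of "\<lambda>x. ennreal (norm x)"] by measurable
    then show "(\<lambda>s. ennreal (norm (a s - b s)) * indicator {0..t} s) \<in> borel_measurable lborel"
      unfolding eq .
  qed
  also have "\<dots> \<le> ennreal t * (\<integral>\<^sup>+s\<in>{0..t}. ennreal (K * (norm (x s - y s))\<^sup>2) \<partial>lborel)"
    using lip by (intro mult_left_mono nn_integral_mono) (auto simp: indicator_def ennreal_power intro!: ennreal_leI)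
  finally show ?thesis by (simp add: ennreal_power)
qed

context cylindrical_brownian_motion
begin

section \<open>Two solutions compared up to the horizon \<open>T\<close>\<close>

context
  fixes A :: "real \<Rightarrow> 'h \<Rightarrow> 'h::{real_inner, banach, second_countable_topology}"
    and G :: "real \<Rightarrow> 'h \<Rightarrow> 'u \<Rightarrow>\<^sub>L 'h" and \<Phi>\<^sub>0 \<Phi> \<Psi> and K T :: real
  assumes sol_\<Phi>: "strong_solution M F e W A G \<Phi>\<^sub>0 \<Phi>"
    and sol_\<Psi>: "strong_solution M F e W A G \<Phi>\<^sub>0 \<Psi>"
    and hs: "\<And>t \<phi>. 0 \<le> t \<Longrightarrow> G t \<phi> \<in> hs_ops e"
    and K: "0 \<le> K"
    and lip: "\<And>t \<phi> \<psi>. 0 \<le> t \<Longrightarrow> t \<le> T \<Longrightarrow> (norm (A t \<phi> - A t \<psi>))\<^sup>2 +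
      (\<Sum>i. (norm (blinfun_apply (G t \<phi>) (e i) - blinfun_apply (G t \<psi>) (e i)))\<^sup>2) \<le> K * (norm (\<phi> - \<psi>))\<^sup>2"
begin

text \<open>The integrand of Z. Its values are in \<open>ennreal\<close> because its integral along
  a path is finite only almost surely; where the integral is infinite, the path lies in no level set
  of finite level.\<close>

definition localiser :: "real \<Rightarrow> 'w \<Rightarrow> ennreal" where
  "localiser s \<omega> = ennreal ((hs_norm e (G s (\<Phi> s \<omega>)))\<^sup>2) + ennreal ((hs_norm e (G s (\<Psi> s \<omega>)))\<^sup>2) +
     ennreal ((norm (\<Phi> s \<omega> - \<Psi> s \<omega>))\<^sup>2)"

lemma coefficients_prog_measurable:
  shows "prog_measurable F (hs_borel e) (\<lambda>s \<omega>. G s (\<Phi> s \<omega>))"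
    and "prog_measurable F (hs_borel e) (\<lambda>s \<omega>. G s (\<Psi> s \<omega>))"
  using sol_\<Phi> sol_\<Psi> unfolding strong_solution_def has_cylindrical_integral_def by blast+

lemma solutions_prog_measurable: "prog_measurable F borel \<Phi>" "prog_measurable F borel \<Psi>"
  using sol_\<Phi> sol_\<Psi> by (simp_all add: strong_solution_def)

lemma difference_prog_measurable:
  "prog_measurable F borel (\<lambda>s \<omega>. ennreal ((norm (\<Phi> s \<omega> - \<Psi> s \<omega>))\<^sup>2))"
  unfolding prog_measurable_def case_prod_unfold
proof (intro allI impI)
  fix T :: real assume "0 \<le> T"
  then have [measurable]:
    "(\<lambda>p. \<Phi> (fst p) (snd p)) \<in> borel_measurable (restrict_space borel {0..T} \<Otimes>\<^sub>M F T)"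
    "(\<lambda>p. \<Psi> (fst p) (snd p)) \<in> borel_measurable (restrict_space borel {0..T} \<Otimes>\<^sub>M F T)"
    using solutions_prog_measurable by (simp_all add: prog_measurable_def case_prod_unfold)
  show "(\<lambda>p. ennreal ((norm (\<Phi> (fst p) (snd p) - \<Psi> (fst p) (snd p)))\<^sup>2))
      \<in> borel_measurable (restrict_space borel {0..T} \<Otimes>\<^sub>M F T)"
    by measurable
qed

lemma localiser_prog_measurable: "prog_measurable F borel (\<lambda>s \<omega>. localiser s \<omega>)"
  unfolding localiser_def
  by (intro prog_measurable_add difference_prog_measurable
      prog_measurable_compose[OF _ hs_norm_squared_measurable] coefficients_prog_measurable)

abbreviation "L n \<equiv> level_set localiser (of_nat n)"
abbreviation "dist2 n \<equiv> \<lambda>s \<omega>. indicator (L n s) \<omega> * ennreal ((norm (\<Phi> s \<omega> - \<Psi> s \<omega>))\<^sup>2)"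

lemma L_localising: "localising_family (L n)"
  by (rule localising_family_level_set[OF localiser_prog_measurable])

lemma L_measurable: "0 \<le> t \<Longrightarrow> L n t \<in> sets M"
  using L_localising[of n] filtration_subalgebra[of t] by (auto simp: localising_family_def subalgebra_def)

lemma dist2_joint:
  assumes "0 < t"
  shows "jointly_measurable t (dist2 n)"
proof (rule jointly_measurable_mult)
  show "jointly_measurable t (\<lambda>s. indicator (L n s))"
    using L_localising[of n] assms by (simp add: localising_family_def)
  show "jointly_measurable t (\<lambda>s \<omega>. ennreal ((norm (\<Phi> s \<omega> - \<Psi> s \<omega>))\<^sup>2))"
    using prog_measurable_joint[OF difference_prog_measurable, of t] assms by (simp add: jointly_measurable_def)
qed

text \<open>The integral of \<open>localiser\<close> dominates both accumulated operator norms, and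
  \<open>n < m\<close> turns its bound \<open>n\<close> into one strictly below the threshold
  \<open>m\<close> of the localising times.\<close>

lemma L_before_localising_time:
  assumes "\<omega> \<in> L n s" "0 \<le> s" "s \<le> real m" "n < m"
  shows "s \<le> localising_time e (\<lambda>s \<omega>. G s (\<Phi> s \<omega>)) m \<omega>"
    and "s \<le> localising_time e (\<lambda>s \<omega>. G s (\<Psi> s \<omega>)) m \<omega>"
proof -
  have *: "(\<integral>\<^sup>+r\<in>{0..s}. g r \<partial>lborel) < of_nat m" if "\<And>r. g r \<le> localiser r \<omega>" for g
  proof -
    have "(\<integral>\<^sup>+r\<in>{0..s}. g r \<partial>lborel) \<le> (\<integral>\<^sup>+r\<in>{0..s}. localiser r \<omega> \<partial>lborel)"
      using that by (intro nn_integral_mono mult_right_mono) auto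
    also have "\<dots> \<le> of_nat n" using assms(1) by (simp add: level_set_def[OF localiser_prog_measurable])
    also have "\<dots> < of_nat m" using assms(4) by (simp add: ennreal_of_nat_eq_real_of_nat ennreal_less_iff)
    finally show ?thesis .
  qed
  show "s \<le> localising_time e (\<lambda>s \<omega>. G s (\<Phi> s \<omega>)) m \<omega>" "s \<le> localising_time e (\<lambda>s \<omega>. G s (\<Psi> s \<omega>)) m \<omega>"
    by (intro le_localising_time assms *; simp add: localiser_def add_increasing add_increasing2)+
qed

text \<open>On \<open>L n s\<close> both truncating indicators equal 1, because \<open>s\<close>
  precedes both localising times, so the original coefficients reappear. Summing over the basis
  under the integral brings in the Lipschitz condition.\<close>

lemma diffusion_energy_bound:
  fixes n :: nat
  assumes t: "0 < t" "t \<le> T" and m: "t \<le> real m" "n < m"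
  defines "B \<equiv> \<lambda>X s \<omega>. indicat_real {..localising_time e (\<lambda>s \<omega>. G s (X s \<omega>)) m \<omega>} s *\<^sub>R G s (X s \<omega>)"
  shows "(\<Sum>i. energy t (\<lambda>s \<omega>. indicator (L n s) \<omega> * ennreal ((norm (B \<Phi> s \<omega> (e i) - B \<Psi> s \<omega> (e i)))\<^sup>2)))
    \<le> ennreal K * energy t (dist2 n)"
proof -
  let ?h = "\<lambda>i s \<omega>. indicator (L n s) \<omega> * ennreal ((norm (G s (\<Phi> s \<omega>) (e i) - G s (\<Psi> s \<omega>) (e i)))\<^sup>2)"
  have h: "jointly_measurable t (?h i)" for i
  proof -
    have [measurable]: "(\<lambda>(\<omega>, s). G s (\<Phi> s \<omega>) (e i)) \<in> borel_measurable (M \<Otimes>\<^sub>M time_measure t)"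
      "(\<lambda>(\<omega>, s). G s (\<Psi> s \<omega>) (e i)) \<in> borel_measurable (M \<Otimes>\<^sub>M time_measure t)"
      using t by (intro prog_measurable_joint prog_measurable_compose[OF _ basis_evaluation_measurable]
        coefficients_prog_measurable; simp)+
    show ?thesis
    proof (rule jointly_measurable_mult)
      show "jointly_measurable t (\<lambda>s. indicator (L n s))"
        using L_localising[of n] t by (simp add: localising_family_def)
      show "jointly_measurable t (\<lambda>s \<omega>. ennreal ((norm (G s (\<Phi> s \<omega>) (e i) - G s (\<Psi> s \<omega>) (e i)))\<^sup>2))"
        unfolding jointly_measurable_def by measurable
    qed
  qed
  have "energy t (\<lambda>s \<omega>. indicator (L n s) \<omega> * ennreal ((norm (B \<Phi> s \<omega> (e i) - B \<Psi> s \<omega> (e i)))\<^sup>2)) \<le> energy t (?h i)" for i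
  proof (rule energy_mono)
    fix s \<omega> assume s: "s \<in> {0..t}"
    show "indicator (L n s) \<omega> * ennreal ((norm (B \<Phi> s \<omega> (e i) - B \<Psi> s \<omega> (e i)))\<^sup>2) \<le> ?h i s \<omega>"
    proof (cases "\<omega> \<in> L n s")
      case True
      then show ?thesis
        using L_before_localising_time[OF True, of m] s m by (simp add: B_def)
    qed simp
  qed
  then have "(\<Sum>i. energy t (\<lambda>s \<omega>. indicator (L n s) \<omega> * ennreal ((norm (B \<Phi> s \<omega> (e i) - B \<Psi> s \<omega> (e i)))\<^sup>2)))
      \<le> (\<Sum>i. energy t (?h i))"
    by (intro suminf_le) auto
  also have "\<dots> = energy t (\<lambda>s \<omega>. \<Sum>i. ?h i s \<omega>)"
    by (rule energy_suminf[OF h])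
  also have "\<dots> \<le> energy t (\<lambda>s \<omega>. ennreal K * dist2 n s \<omega>)"
  proof (rule energy_mono)
    fix s \<omega> assume s: "s \<in> {0..t}"
    let ?b = "\<lambda>i. (norm (G s (\<Phi> s \<omega>) (e i) - G s (\<Psi> s \<omega>) (e i)))\<^sup>2"
    \<comment> \<open>For a series that is not summable, the real \<open>suminf\<close> has an
      unspecified value; membership in \<open>hs_ops e\<close> ties the real series in
      \<open>lip\<close> to the series in \<open>ennreal\<close>.\<close>
    have "G s (\<Phi> s \<omega>) - G s (\<Psi> s \<omega>) \<in> hs_ops e" using s by (intro hs_ops_diff hs) auto
    then have sm: "summable ?b" by (simp add: hs_ops_def blinfun.diff_left)
    have "(\<Sum>i. ennreal (?b i)) = ennreal (\<Sum>i. ?b i)"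
      using sm by (intro suminf_ennreal2) auto
    also have "\<dots> \<le> ennreal (K * (norm (\<Phi> s \<omega> - \<Psi> s \<omega>))\<^sup>2)"
      using s t by (intro ennreal_leI order_trans[OF _ lip[of s]]) auto
    also have "\<dots> = ennreal K * ennreal ((norm (\<Phi> s \<omega> - \<Psi> s \<omega>))\<^sup>2)"
      using K by (intro ennreal_mult) auto
    finally have "(\<Sum>i. ennreal (?b i)) \<le> ennreal K * ennreal ((norm (\<Phi> s \<omega> - \<Psi> s \<omega>))\<^sup>2)" .
    then show "(\<Sum>i. ?h i s \<omega>) \<le> ennreal K * dist2 n s \<omega>" by (simp add: indicator_def)
  qed
  also have "\<dots> = ennreal K * energy t (dist2 n)"
    by (rule energy_cmult[OF dist2_joint[OF t(1)]])
  finally show ?thesis .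
qed

text \<open>The summand \<open>2 * T * K\<close> comes from the drift and \<open>16 * K\<close> from
  the noise: a factor 2 for separating them, then \<open>T\<close> by Cauchy-Schwarz or 8 by the
  isometry bound. The common initial value cancels, so no constant term remains and Gronwall's lemma
  yields zero.\<close>

lemma difference_gronwall:
  assumes t: "0 < t" "t \<le> T"
  shows "(\<integral>\<^sup>+\<omega>. dist2 n t \<omega> \<partial>M) \<le> ennreal (2 * T * K + 16 * K) * energy t (dist2 n)"
proof -
  \<comment> \<open>The localisation level exceeds \<open>n\<close> and \<open>t\<close>, so on
    \<open>L n t\<close> the time \<open>t\<close> precedes both localising times and
    \<open>I1\<close>, \<open>I2\<close> may be exchanged for integrals \<open>J1\<close>,
    \<open>J2\<close> defined in L^2.\<close>
  define m where "m = n + nat \<lceil>t\<rceil> + 1"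
  have m: "t \<le> real m" "n < m" unfolding m_def by linarith+
  define B where "B X s \<omega> = indicat_real {..localising_time e (\<lambda>s \<omega>. G s (X s \<omega>)) m \<omega>} s *\<^sub>R G s (X s \<omega>)"
    for X :: "real \<Rightarrow> 'w \<Rightarrow> 'h" and s \<omega>
  obtain I1 where I1: "has_cylindrical_integral M F e W (\<lambda>s \<omega>. G s (\<Phi> s \<omega>)) t I1"
    and e1: "AE \<omega> in M. set_integrable lborel {0..t} (\<lambda>s. A s (\<Phi> s \<omega>)) \<and>
           \<Phi> t \<omega> = \<Phi>\<^sub>0 \<omega> + (LINT s:{0..t}|lborel. A s (\<Phi> s \<omega>)) + I1 \<omega>"
    using sol_\<Phi> t unfolding strong_solution_def by (meson less_imp_le)
  obtain I2 where I2: "has_cylindrical_integral M F e W (\<lambda>s \<omega>. G s (\<Psi> s \<omega>)) t I2"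
    and e2: "AE \<omega> in M. set_integrable lborel {0..t} (\<lambda>s. A s (\<Psi> s \<omega>)) \<and>
           \<Psi> t \<omega> = \<Phi>\<^sub>0 \<omega> + (LINT s:{0..t}|lborel. A s (\<Psi> s \<omega>)) + I2 \<omega>"
    using sol_\<Psi> t unfolding strong_solution_def by (meson less_imp_le)
  obtain J1 where J1: "has_cylindrical_integral_L2 M F e W (B \<Phi>) t J1"
    and ae1: "AE \<omega> in M. t \<le> localising_time e (\<lambda>s \<omega>. G s (\<Phi> s \<omega>)) m \<omega> \<longrightarrow> I1 \<omega> = J1 \<omega>"
    using I1 unfolding has_cylindrical_integral_def B_def by meson
  obtain J2 where J2: "has_cylindrical_integral_L2 M F e W (B \<Psi>) t J2"
    and ae2: "AE \<omega> in M. t \<le> localising_time e (\<lambda>s \<omega>. G s (\<Psi> s \<omega>)) m \<omega> \<longrightarrow> I2 \<omega> = J2 \<omega>"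
    using I2 unfolding has_cylindrical_integral_def B_def by meson
  have [measurable]: "J1 \<in> borel_measurable M" "J2 \<in> borel_measurable M" "L n t \<in> sets M"
    using J1 J2 L_measurable[of t n] t by (simp_all add: has_cylindrical_integral_L2_def)
  let ?H = "\<lambda>\<omega>. \<integral>\<^sup>+s\<in>{0..t}. dist2 n s \<omega> \<partial>lborel"
  have H[measurable]: "?H \<in> borel_measurable M"
    by (rule jointly_measurable_time_integral[OF dist2_joint[OF t(1)]])
  have J: "(\<lambda>\<omega>. indicator (L n t) \<omega> * ennreal ((norm (J1 \<omega> - J2 \<omega>))\<^sup>2)) \<in> borel_measurable M"
    by measurable
  have "AE \<omega> in M. dist2 n t \<omega> \<le> ennreal (2 * T * K) * ?H \<omega> + 2 * (indicator (L n t) \<omega> * ennreal ((norm (J1 \<omega> - J2 \<omega>))\<^sup>2))"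
    using e1 e2 ae1 ae2 AE_space
  proof eventually_elim
    case (elim \<omega>)
    show ?case
    proof (cases "\<omega> \<in> L n t")
      case True
      let ?a = "(LINT s:{0..t}|lborel. A s (\<Phi> s \<omega>)) - (LINT s:{0..t}|lborel. A s (\<Psi> s \<omega>))"
      have "I1 \<omega> = J1 \<omega>" "I2 \<omega> = J2 \<omega>"
        using L_before_localising_time[OF True _ m] elim t by auto
      then have "\<Phi> t \<omega> - \<Psi> t \<omega> = ?a + (J1 \<omega> - J2 \<omega>)" using elim by simp
      then have "(norm (\<Phi> t \<omega> - \<Psi> t \<omega>))\<^sup>2 \<le> 2 * (norm ?a)\<^sup>2 + 2 * (norm (J1 \<omega> - J2 \<omega>))\<^sup>2"
        using norm_add_squared_le by metis
      then have "ennreal ((norm (\<Phi> t \<omega> - \<Psi> t \<omega>))\<^sup>2) \<le> ennreal (2 * (norm ?a)\<^sup>2 + 2 * (norm (J1 \<omega> - J2 \<omega>))\<^sup>2)"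
        by (rule ennreal_leI)
      also have "\<dots> = 2 * ennreal ((norm ?a)\<^sup>2) + 2 * ennreal ((norm (J1 \<omega> - J2 \<omega>))\<^sup>2)"
        by (simp add: ennreal_plus ennreal_mult)
      also have "\<dots> \<le> 2 * (ennreal T * (ennreal K * ?H \<omega>)) + 2 * ennreal ((norm (J1 \<omega> - J2 \<omega>))\<^sup>2)"
      proof (intro add_right_mono mult_left_mono)
        have "ennreal ((norm ?a)\<^sup>2) \<le> ennreal t * (\<integral>\<^sup>+s\<in>{0..t}. ennreal (K * (norm (\<Phi> s \<omega> - \<Psi> s \<omega>))\<^sup>2) \<partial>lborel)"
        proof (rule drift_difference_bound)
          fix s assume s: "0 \<le> s" "s \<le> t"
          then have "G s (\<Phi> s \<omega>) - G s (\<Psi> s \<omega>) \<in> hs_ops e" by (intro hs_ops_diff hs) auto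
          then have "0 \<le> (\<Sum>i. (norm (G s (\<Phi> s \<omega>) (e i) - G s (\<Psi> s \<omega>) (e i)))\<^sup>2)"
            by (intro suminf_nonneg) (auto simp: hs_ops_def blinfun.diff_left)
          then show "(norm (A s (\<Phi> s \<omega>) - A s (\<Psi> s \<omega>)))\<^sup>2 \<le> K * (norm (\<Phi> s \<omega> - \<Psi> s \<omega>))\<^sup>2"
            using lip[of s "\<Phi> s \<omega>" "\<Psi> s \<omega>"] s t by simp
        qed (use elim t in auto)
        \<comment> \<open>Since the level sets decrease, a point of \<open>L n t\<close> lies in
          \<open>L n s\<close> for all earlier \<open>s\<close>; the indicators in
          \<open>dist2 n\<close> may be inserted under the time integral.\<close>
        also have "\<dots> \<le> ennreal T * (\<integral>\<^sup>+s. ennreal K * (dist2 n s \<omega> * indicator {0..t} s) \<partial>lborel)"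
        proof (rule mult_mono[OF ennreal_leI[OF t(2)] nn_integral_mono])
          fix s
          have "\<omega> \<in> L n s" if "s \<le> t"
            using level_set_antimono[OF localiser_prog_measurable that] True by blast
          then show "ennreal (K * (norm (\<Phi> s \<omega> - \<Psi> s \<omega>))\<^sup>2) * indicator {0..t} s \<le> ennreal K * (dist2 n s \<omega> * indicator {0..t} s)"
            using K by (auto simp: indicator_def ennreal_mult)
        qed (use t in auto)
        also have "\<dots> = ennreal T * (ennreal K * ?H \<omega>)"
          by (intro arg_cong[where f="\<lambda>x. ennreal T * x"] nn_integral_cmult jointly_measurable_section[OF dist2_joint[OF t(1)] elim(5)])
        finally show "ennreal ((norm ?a)\<^sup>2) \<le> ennreal T * (ennreal K * ?H \<omega>)" .
      qed simp
      also have "\<dots> = ennreal (2 * T * K) * ?H \<omega> + 2 * ennreal ((norm (J1 \<omega> - J2 \<omega>))\<^sup>2)"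
        using t K by (simp add: ennreal_mult mult.assoc)
      finally show ?thesis using True by simp
    qed simp
  qed
  then have "(\<integral>\<^sup>+\<omega>. dist2 n t \<omega> \<partial>M) \<le>
      (\<integral>\<^sup>+\<omega>. ennreal (2 * T * K) * ?H \<omega> + 2 * (indicator (L n t) \<omega> * ennreal ((norm (J1 \<omega> - J2 \<omega>))\<^sup>2)) \<partial>M)"
    by (rule nn_integral_mono_AE)
  also have "\<dots> = (\<integral>\<^sup>+\<omega>. ennreal (2 * T * K) * ?H \<omega> \<partial>M) + (\<integral>\<^sup>+\<omega>. 2 * (indicator (L n t) \<omega> * ennreal ((norm (J1 \<omega> - J2 \<omega>))\<^sup>2)) \<partial>M)"
    using borel_measurable_times_ennreal[OF borel_measurable_const H] borel_measurable_times_ennreal[OF borel_measurable_const J]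
    by (intro nn_integral_add)
  also have "\<dots> = ennreal (2 * T * K) * energy t (dist2 n) + 2 * (\<integral>\<^sup>+\<omega>. indicator (L n t) \<omega> * ennreal ((norm (J1 \<omega> - J2 \<omega>))\<^sup>2) \<partial>M)"
    unfolding energy_def nn_integral_cmult[OF H] nn_integral_cmult[OF J] ..
  also have "\<dots> \<le> ennreal (2 * T * K) * energy t (dist2 n) + 2 * (8 * (ennreal K * energy t (dist2 n)))"
    by (intro add_left_mono mult_left_mono
        order_trans[OF cylindrical_integral_difference_bound[OF J1 J2 L_localising t(1)]]
        diffusion_energy_bound[OF t m, folded B_def]) simp_all
  also have "\<dots> = ennreal (2 * T * K + 16 * K) * energy t (dist2 n)"
    using t K by (simp add: ennreal_plus ennreal_mult distrib_right mult.assoc[symmetric])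
  finally show ?thesis .
qed

text \<open>Gronwall's lemma applies to the expectation of \<open>dist2 n t\<close>, whose time
  integral is finite because the squared distance is a summand of \<open>localiser\<close>, and the
  integral of \<open>localiser\<close> restricted to its own level sets is at most \<open>n\<close>
  along every path.\<close>

lemma solutions_equal_on_level_set:
  assumes t: "0 < t" "t \<le> T"
  shows "AE \<omega> in M. \<omega> \<in> L n t \<longrightarrow> \<Phi> t \<omega> = \<Psi> t \<omega>"
proof -
  have T: "0 < T" using t by simp
  have "(\<integral>\<^sup>+\<omega>. dist2 n t \<omega> \<partial>M) = 0"
  proof (rule gronwall_zero[OF _ _ _ t])
    show "0 \<le> 2 * T * K + 16 * K" using T K by simp
    show "(\<integral>\<^sup>+\<omega>. dist2 n s \<omega> \<partial>M) \<le> ennreal (2 * T * K + 16 * K) * (\<integral>\<^sup>+s\<in>{0..s}. (\<integral>\<^sup>+\<omega>. dist2 n s \<omega> \<partial>M) \<partial>lborel)"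
      if "0 < s" "s \<le> T" for s
      using difference_gronwall[OF that, of n] energy_swap[OF dist2_joint[OF that(1)], of n] by simp
    have "energy T (dist2 n) \<le> (\<integral>\<^sup>+\<omega>. of_nat n \<partial>M)"
      unfolding energy_def
    proof (rule nn_integral_mono)
      fix \<omega> assume "\<omega> \<in> space M"
      have "(\<integral>\<^sup>+s\<in>{0..T}. dist2 n s \<omega> \<partial>lborel) \<le> (\<integral>\<^sup>+s\<in>{0..T}. (indicator (L n s) \<omega> * localiser s \<omega>) \<partial>lborel)"
        by (intro nn_integral_mono mult_right_mono mult_left_mono) (auto simp: localiser_def)
      also have "\<dots> \<le> of_nat n"
        using T \<open>\<omega> \<in> space M\<close> by (intro nn_integral_level_set_le[OF localiser_prog_measurable]) auto
      finally show "(\<integral>\<^sup>+s\<in>{0..T}. dist2 n s \<omega> \<partial>lborel) \<le> of_nat n" .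
    qed
    also have "\<dots> < \<infinity>" by (simp add: emeasure_space_1 of_nat_less_top)
    finally show "(\<integral>\<^sup>+s\<in>{0..T}. (\<integral>\<^sup>+\<omega>. dist2 n s \<omega> \<partial>M) \<partial>lborel) < \<infinity>"
      using energy_swap[OF dist2_joint[OF T], of n] by simp
  qed
  moreover have "dist2 n t \<in> borel_measurable M"
  proof -
    have y: "t \<in> space (time_measure t)" using t by (simp add: space_restrict_space)
    have "\<Phi> t \<in> borel_measurable M" "\<Psi> t \<in> borel_measurable M"
      using measurable_compose[OF measurable_Pair2'[OF y] prog_measurable_joint[OF solutions_prog_measurable(1)]]
        measurable_compose[OF measurable_Pair2'[OF y] prog_measurable_joint[OF solutions_prog_measurable(2)]] t
      by simp_all
    then show ?thesis using L_measurable[of t n] t by simp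
  qed
  ultimately have "AE \<omega> in M. dist2 n t \<omega> = 0"
    by (subst (asm) nn_integral_0_iff_AE)
  then show ?thesis by eventually_elim (auto simp: indicator_def split: if_splits)
qed

text \<open>The squared operator norms are integrable along almost every path by the definition of
  the localised stochastic integral; the squared distance is continuous, hence bounded on the
  compact interval.\<close>

lemma localiser_integral_finite:
  assumes t: "0 < t"
  shows "AE \<omega> in M. (\<integral>\<^sup>+s\<in>{0..t}. localiser s \<omega> \<partial>lborel) < \<infinity>"
proof -
  have hsf: "AE \<omega> in M. \<forall>T\<ge>0. (\<integral>\<^sup>+s\<in>{0..T}. ennreal ((hs_norm e (G s (\<Phi> s \<omega>)))\<^sup>2) \<partial>lborel) < \<infinity>"
    "AE \<omega> in M. \<forall>T\<ge>0. (\<integral>\<^sup>+s\<in>{0..T}. ennreal ((hs_norm e (G s (\<Psi> s \<omega>)))\<^sup>2) \<partial>lborel) < \<infinity>"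
    using sol_\<Phi> sol_\<Psi> unfolding strong_solution_def has_cylindrical_integral_def by blast+
  have cont: "AE \<omega> in M. \<forall>T>0. continuous_on {0..T} (\<lambda>t. \<Phi> t \<omega>)" "AE \<omega> in M. \<forall>T>0. continuous_on {0..T} (\<lambda>t. \<Psi> t \<omega>)"
    using sol_\<Phi> sol_\<Psi> by (simp_all add: strong_solution_def)
  show ?thesis
    using hsf cont AE_space
  proof eventually_elim
    case (elim \<omega>)
    have sm: "(\<lambda>s. ennreal ((hs_norm e (G s (\<Phi> s \<omega>)))\<^sup>2) * indicator {0..t} s) \<in> borel_measurable lborel"
      "(\<lambda>s. ennreal ((hs_norm e (G s (\<Psi> s \<omega>)))\<^sup>2) * indicator {0..t} s) \<in> borel_measurable lborel"
      "(\<lambda>s. ennreal ((norm (\<Phi> s \<omega> - \<Psi> s \<omega>))\<^sup>2) * indicator {0..t} s) \<in> borel_measurable lborel"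
      using t elim(5)
        section_measurable[OF prog_measurable_compose[OF coefficients_prog_measurable(1) hs_norm_squared_measurable], of t \<omega>]
        section_measurable[OF prog_measurable_compose[OF coefficients_prog_measurable(2) hs_norm_squared_measurable], of t \<omega>]
        section_measurable[OF difference_prog_measurable, of t \<omega>] by simp_all
    have "continuous_on {0..t} (\<lambda>s. (norm (\<Phi> s \<omega> - \<Psi> s \<omega>))\<^sup>2)"
      using elim(3,4) t by (intro continuous_intros) auto
    then have "bounded ((\<lambda>s. (norm (\<Phi> s \<omega> - \<Psi> s \<omega>))\<^sup>2) ` {0..t})"
      by (intro compact_imp_bounded compact_continuous_image) auto
    then obtain b where b: "\<forall>s\<in>{0..t}. (norm (\<Phi> s \<omega> - \<Psi> s \<omega>))\<^sup>2 \<le> b"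
      unfolding bounded_iff by auto
    have "(\<integral>\<^sup>+s\<in>{0..t}. ennreal ((norm (\<Phi> s \<omega> - \<Psi> s \<omega>))\<^sup>2) \<partial>lborel) \<le> (\<integral>\<^sup>+s. ennreal b * indicator {0..t} s \<partial>lborel)"
      using b by (intro nn_integral_mono) (auto simp: indicator_def intro!: ennreal_leI)
    also have "\<dots> < \<infinity>" using t by (subst nn_integral_cmult_indicator) (auto simp: ennreal_mult_less_top)
    finally have "(\<integral>\<^sup>+s\<in>{0..t}. ennreal ((norm (\<Phi> s \<omega> - \<Psi> s \<omega>))\<^sup>2) \<partial>lborel) < \<infinity>" .
    then show ?case
      using elim(1,2) sm t by (simp add: localiser_def distrib_right nn_integral_add)
  qed
qed

lemma solutions_equal:
  assumes t: "0 < t" "t \<le> T"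
  shows "AE \<omega> in M. \<Phi> t \<omega> = \<Psi> t \<omega>"
proof -
  have "AE \<omega> in M. \<forall>n. \<omega> \<in> L n t \<longrightarrow> \<Phi> t \<omega> = \<Psi> t \<omega>"
    unfolding AE_all_countable using solutions_equal_on_level_set[OF t] by blast
  then show ?thesis
    using localiser_integral_finite[OF t(1)] AE_space
  proof eventually_elim
    case (elim \<omega>)
    obtain n :: nat where "(\<integral>\<^sup>+s\<in>{0..t}. localiser s \<omega> \<partial>lborel) \<le> of_nat n"
      using elim(2) ennreal_Ex_less_of_nat by (metis infinity_ennreal_def less_imp_le)
    then show ?case using elim by (auto simp: level_set_def[OF localiser_prog_measurable])
  qed
qed

end

lemma strong_solutions_indistinguishable:
  fixes A :: "real \<Rightarrow> 'h \<Rightarrow> 'h::{real_inner, banach, second_countable_topology}"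
    and G :: "real \<Rightarrow> 'h \<Rightarrow> 'u \<Rightarrow>\<^sub>L 'h"
  assumes sol: "strong_solution M F e W A G \<Phi>\<^sub>0 \<Phi>" "strong_solution M F e W A G \<Phi>\<^sub>0 \<Psi>"
    and hs: "\<And>t \<phi>. 0 \<le> t \<Longrightarrow> G t \<phi> \<in> hs_ops e"
    and K: "0 \<le> K"
    and lip: "\<And>t \<phi> \<psi>. 0 \<le> t \<Longrightarrow> t \<le> T \<Longrightarrow> (norm (A t \<phi> - A t \<psi>))\<^sup>2 +
      (\<Sum>i. (norm (blinfun_apply (G t \<phi>) (e i) - blinfun_apply (G t \<psi>) (e i)))\<^sup>2) \<le> K * (norm (\<phi> - \<psi>))\<^sup>2"
    and T: "0 < T"
  shows "AE \<omega> in M. \<forall>t\<in>{0..T}. \<Phi> t \<omega> = \<Psi> t \<omega>"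
proof -
  \<comment> \<open>Almost sure equality is available at each positive time, so the countable dense
    set is chosen in the open interval; continuity recovers the end points, including time
    0.\<close>
  let ?S = "{0<..<T} \<inter> \<rat>"
  have "AE \<omega> in M. \<forall>t\<in>?S. \<Phi> t \<omega> = \<Psi> t \<omega>"
    using solutions_equal[OF sol hs K lip] by (subst AE_ball_countable) (auto intro: countable_Int2 countable_rat)
  moreover have "AE \<omega> in M. \<forall>T>0. continuous_on {0..T} (\<lambda>t. \<Phi> t \<omega>)" "AE \<omega> in M. \<forall>T>0. continuous_on {0..T} (\<lambda>t. \<Psi> t \<omega>)"
    using sol by (simp_all add: strong_solution_def)
  ultimately show ?thesis
  proof eventually_elim
    case (elim \<omega>)
    have "closure ?S = closure {0<..<T}"
      by (rule closure_open_Int_superset) (auto simp: Rats_closure_real)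
    also have "\<dots> = {0..T}" using T by simp
    finally have S: "closure ?S = {0..T}" .
    show ?case
    proof
      fix t assume "t \<in> {0..T}"
      have "continuous_on (closure ?S) (\<lambda>t. \<Phi> t \<omega> - \<Psi> t \<omega>)"
        unfolding S using elim(2,3) T by (intro continuous_intros) auto
      then have "\<Phi> t \<omega> - \<Psi> t \<omega> = 0"
        by (rule continuous_constant_on_closure) (use elim(1) S \<open>t \<in> {0..T}\<close> in auto)
      then show "\<Phi> t \<omega> = \<Psi> t \<omega>" by simp
    qed
  qed
qed

end

theorem theorem3p1p2:
  fixes M :: "'w measure" and F :: "real \<Rightarrow> 'w measure"
    and e :: "nat \<Rightarrow> 'u::{real_inner, banach}" and W :: "nat \<Rightarrow> real \<Rightarrow> 'w \<Rightarrow> real"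
    and A :: "real \<Rightarrow> 'h \<Rightarrow> 'h::{real_inner, banach, second_countable_topology}"
    and G :: "real \<Rightarrow> 'h \<Rightarrow> 'u \<Rightarrow>\<^sub>L 'h"
    and C :: "real \<Rightarrow> real" and c :: "nat \<Rightarrow> real"
    and \<Phi>\<^sub>0 :: "'w \<Rightarrow> 'h" and \<Phi> \<Psi> :: "real \<Rightarrow> 'w \<Rightarrow> 'h"
  assumes cylindrical: "cylindrical_brownian_motion M F e W"
    and finite_dim: "\<exists>S :: 'h set. finite S \<and> span S = UNIV"
    and A_meas: "\<And>T. T > 0 \<Longrightarrow>
      (\<lambda>(t, \<phi>). A t \<phi>) \<in> measurable (restrict_space borel {0..T} \<Otimes>\<^sub>M borel) borel"
    and G_meas: "\<And>T. T > 0 \<Longrightarrow>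
      (\<lambda>(t, \<phi>). G t \<phi>) \<in> measurable (restrict_space borel {0..T} \<Otimes>\<^sub>M borel) (hs_borel e)"
    and C_bounded: "\<And>T. bounded (C ` {0..T})"
    and A_growth: "\<And>t \<phi>. t \<ge> 0 \<Longrightarrow> (norm (A t \<phi>))\<^sup>2 \<le> C t * (1 + (norm \<phi>)\<^sup>2)"
    and G_growth: "\<And>t \<phi> i. t \<ge> 0 \<Longrightarrow>
      (norm (blinfun_apply (G t \<phi>) (e i)))\<^sup>2 \<le> C t * c i * (1 + (norm \<phi>)\<^sup>2)"
    and c_summable: "summable c"
    and lipschitz: "\<And>t \<phi> \<psi>. t \<ge> 0 \<Longrightarrow>
      (norm (A t \<phi> - A t \<psi>))\<^sup>2 +
      (\<Sum>i. (norm (blinfun_apply (G t \<phi>) (e i) - blinfun_apply (G t \<psi>) (e i)))\<^sup>2)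
        \<le> C t * (norm (\<phi> - \<psi>))\<^sup>2"
    and init_meas: "\<Phi>\<^sub>0 \<in> borel_measurable (F 0)"
    and init_L2: "integrable M (\<lambda>\<omega>. (norm (\<Phi>\<^sub>0 \<omega>))\<^sup>2)"
    and solution_\<Phi>: "strong_solution M F e W A G \<Phi>\<^sub>0 \<Phi>"
    and solution_\<Psi>: "strong_solution M F e W A G \<Phi>\<^sub>0 \<Psi>"
  shows "\<forall>T\<ge>0. measure M {\<omega> \<in> space M. \<forall>t\<in>{0..T}. \<Phi> t \<omega> = \<Psi> t \<omega>} = 1"
proof (intro allI impI)
  interpret cylindrical_brownian_motion M F e W by (rule cylindrical)
  fix T :: real assume T: "0 \<le> T"
  \<comment> \<open>Summability of \<open>c\<close> turns the growth bound into a convergent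
    majorant for the series of squared norms.\<close>
  have hs: "G t \<phi> \<in> hs_ops e" if "0 \<le> t" for t \<phi>
  proof -
    have "summable (\<lambda>i. C t * c i * (1 + (norm \<phi>)\<^sup>2))"
      using c_summable by (intro summable_mult summable_mult2)
    then have "summable (\<lambda>i. (norm (blinfun_apply (G t \<phi>) (e i)))\<^sup>2)"
      by (rule summable_comparison_test'[of _ 0]) (use G_growth[OF that] in simp)
    then show ?thesis by (simp add: hs_ops_def)
  qed
  \<comment> \<open>The horizon \<open>T + 1\<close> is positive even for \<open>T = 0\<close>, as
    \<open>strong_solutions_indistinguishable\<close> requires.\<close>
  obtain K where K: "\<forall>t\<in>{0..T + 1}. \<bar>C t\<bar> \<le> K"
    using C_bounded[of "T + 1"] unfolding bounded_iff by auto
  have "0 \<le> K" using bspec[OF K, of 0] T by simp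
  have "AE \<omega> in M. \<forall>t\<in>{0..T + 1}. \<Phi> t \<omega> = \<Psi> t \<omega>"
  proof (rule strong_solutions_indistinguishable[OF solution_\<Phi> solution_\<Psi> hs \<open>0 \<le> K\<close>])
    fix t and \<phi> \<psi> :: 'h assume t: "0 \<le> t" "t \<le> T + 1"
    have "C t * (norm (\<phi> - \<psi>))\<^sup>2 \<le> K * (norm (\<phi> - \<psi>))\<^sup>2"
      using bspec[OF K, of t] t by (intro mult_right_mono) auto
    then show "(norm (A t \<phi> - A t \<psi>))\<^sup>2 +
        (\<Sum>i. (norm (blinfun_apply (G t \<phi>) (e i) - blinfun_apply (G t \<psi>) (e i)))\<^sup>2) \<le> K * (norm (\<phi> - \<psi>))\<^sup>2"
      using lipschitz[OF t(1)] order_trans by blast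
  qed (use T in auto)
  then have ae: "AE \<omega> in M. \<forall>t\<in>{0..T}. \<Phi> t \<omega> = \<Psi> t \<omega>"
    by eventually_elim auto
  let ?S = "{\<omega> \<in> space M. \<forall>t\<in>{0..T}. \<Phi> t \<omega> = \<Psi> t \<omega>}"
  \<comment> \<open>The set is an intersection over uncountably many times; its measurability comes
    from completeness, as it differs from the whole space by a null set.\<close>
  have "AE \<omega> in M. \<omega> \<in> space M \<longleftrightarrow> \<omega> \<in> ?S" using ae by eventually_elim auto
  then have "?S \<in> sets M" by (rule in_sets_AE) auto
  then show "measure M ?S = 1" using ae by (subst prob_Collect_eq_1) auto
qed

end
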